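(* Let $\mathsf{A}^{(n)} = (a^{(n)}_{ij})_{i,j\in\mathbb{N}}$, $n\in\mathbb{N}$, be a sequence of symmetric Hilbert--Schmidt operators on $\ell^2(\mathbb{N})$ such that $a^{(n)}_{ii} = 0$ for all $i$ and $n$, $\operatorname{Tr}[(\mathsf{A}^{(n)})^2] = 1$ for all $n$, and $$\rho(\mathsf{A}^{(n)}) = \sup_{\lambda \in \mathrm{spec}(\mathsf{A}^{(n)})} |\lambda| \xrightarrow[n\to\infty]{} 0.$$ Let $(U_i)_{i\in\mathbb{N}}$ be a sequence of independent random variables uniformly distributed on $[-1,1]$, and let $Q_n = \sum_{i,j} a^{(n)}_{ij} U_i U_j$. Then $Q_n$ converges $\mathscr{C}^\infty$ to the Gaussian law $\mathcal{N}(0,2/9)$: denoting by $f$ the density of $\mathcal{N}(0,2/9)$, for every $p \in \mathbb{N}$ there exists $N_p$ such that for all $n \geq N_p$ the law of $Q_n$ has a density $f_n \in \mathscr{C}^p(\mathbb{R})$, and $\|f_n^{(p)} - f^{(p)}\|_\infty \to 0$ as $n\to\infty$.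
   Context: $\operatorname{Tr}[\mathsf{A}^2] = \sum_{i,j} a_{ij}^2$ for a symmetric Hilbert--Schmidt operator $\mathsf{A} = (a_{ij})$ on $\ell^2(\mathbb{N})$. The series defining $Q_n$ converges in $L^2$. $\|\cdot\|_\infty$ is the supremum norm on $\mathbb{R}$. *)

theory Defs
  imports "HOL-Probability.Probability"
begin

section \<open>The real Hilbert space of square-summable sequences\<close>

typedef ell2 = "{x :: nat \<Rightarrow> real. summable (\<lambda>i. (x i)\<^sup>2)}"
  morphisms coord Abs_ell2
  by (rule exI[of _ "\<lambda>_. 0"]) simp

setup_lifting type_definition_ell2

lemma summable_coord_sq: "summable (\<lambda>i. (coord x i)\<^sup>2)"
  using coord[of x] by simp

lemma ell2_summable_mult:
  fixes x y :: "nat \<Rightarrow> real"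
  assumes "summable (\<lambda>i. (x i)\<^sup>2)" "summable (\<lambda>i. (y i)\<^sup>2)"
  shows "summable (\<lambda>i. x i * y i)"
proof (rule summable_comparison_test'[where N = 0])
  show "summable (\<lambda>i. (x i)\<^sup>2 + (y i)\<^sup>2)"
    using assms by (rule summable_add)
  show "norm (x i * y i) \<le> (x i)\<^sup>2 + (y i)\<^sup>2" for i
    using sum_squares_bound[of "\<bar>x i\<bar>" "\<bar>y i\<bar>"] mult_nonneg_nonneg[of "\<bar>x i\<bar>" "\<bar>y i\<bar>"]
    by (simp add: abs_mult del: mult_nonneg_nonneg)
qed

lemma ell2_summable_add:
  fixes x y :: "nat \<Rightarrow> real"
  assumes "summable (\<lambda>i. (x i)\<^sup>2)" "summable (\<lambda>i. (y i)\<^sup>2)"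
  shows "summable (\<lambda>i. (x i + y i)\<^sup>2)"
proof -
  have "summable (\<lambda>i. (x i)\<^sup>2 + (y i)\<^sup>2 + 2 * (x i * y i))"
    using assms ell2_summable_mult[OF assms] by (intro summable_add summable_mult)
  then show ?thesis by (simp add: power2_sum mult.assoc)
qed

instantiation ell2 :: real_vector
begin

lift_definition zero_ell2 :: ell2 is "\<lambda>_. 0" by simp

lift_definition plus_ell2 :: "ell2 \<Rightarrow> ell2 \<Rightarrow> ell2" is "\<lambda>x y i. x i + y i"
  by (rule ell2_summable_add)

lift_definition uminus_ell2 :: "ell2 \<Rightarrow> ell2" is "\<lambda>x i. - x i" by simp

lift_definition minus_ell2 :: "ell2 \<Rightarrow> ell2 \<Rightarrow> ell2" is "\<lambda>x y i. x i - y i"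
  subgoal for x y using ell2_summable_add[of x "\<lambda>i. - y i"] by simp
  done

lift_definition scaleR_ell2 :: "real \<Rightarrow> ell2 \<Rightarrow> ell2" is "\<lambda>c x i. c * x i"
  by (simp add: power_mult_distrib)

instance
  by standard (transfer; simp add: algebra_simps fun_eq_iff)+

end

instantiation ell2 :: real_inner
begin

definition inner_ell2 :: "ell2 \<Rightarrow> ell2 \<Rightarrow> real"
  where "inner_ell2 x y = (\<Sum>i. coord x i * coord y i)"

definition norm_ell2 :: "ell2 \<Rightarrow> real"
  where "norm_ell2 x = sqrt (inner x x)"

definition sgn_ell2 :: "ell2 \<Rightarrow> ell2"
  where "sgn_ell2 x = x /\<^sub>R norm x"

definition dist_ell2 :: "ell2 \<Rightarrow> ell2 \<Rightarrow> real"
  where "dist_ell2 x y = norm (x - y)"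

definition uniformity_ell2 :: "(ell2 \<times> ell2) filter"
  where "uniformity_ell2 = (INF e\<in>{0<..}. principal {(x, y). dist x y < e})"

definition open_ell2 :: "ell2 set \<Rightarrow> bool"
  where "open_ell2 U \<longleftrightarrow> (\<forall>x\<in>U. eventually (\<lambda>(x', y). x' = x \<longrightarrow> y \<in> U) uniformity)"

instance
proof
  fix x y z :: ell2 and r :: real and U :: "ell2 set"
  note [simp] = ell2_summable_mult[OF summable_coord_sq summable_coord_sq]
  show "dist x y = norm (x - y)" by (rule dist_ell2_def)
  show "sgn x = x /\<^sub>R norm x" by (rule sgn_ell2_def)
  show "uniformity = (INF e\<in>{0<..}. principal {(x :: ell2, y). dist x y < e})"
    by (rule uniformity_ell2_def)
  show "open U \<longleftrightarrow> (\<forall>x\<in>U. eventually (\<lambda>(x', y). x' = x \<longrightarrow> y \<in> U) uniformity)"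
    by (rule open_ell2_def)
  show "inner x y = inner y x"
    by (simp add: inner_ell2_def mult.commute)
  show "inner (x + y) z = inner x z + inner y z"
    by (simp add: inner_ell2_def plus_ell2.rep_eq distrib_right suminf_add)
  show "inner (r *\<^sub>R x) y = r * inner x y"
    by (simp add: inner_ell2_def scaleR_ell2.rep_eq mult.assoc suminf_mult)
  show "0 \<le> inner x x"
    by (auto simp: inner_ell2_def intro: suminf_nonneg)
  show "inner x x = 0 \<longleftrightarrow> x = 0"
  proof -
    have "inner x x = 0 \<longleftrightarrow> (\<forall>i. coord x i * coord x i = 0)"
      unfolding inner_ell2_def by (rule suminf_eq_zero_iff) simp_all
    also have "\<dots> \<longleftrightarrow> x = 0"
      by (simp add: coord_inject[symmetric] zero_ell2.rep_eq fun_eq_iff)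
    finally show ?thesis .
  qed
  show "norm x = sqrt (inner x x)" by (rule norm_ell2_def)
qed

end

lift_definition unit_vec :: "nat \<Rightarrow> ell2" is "\<lambda>i j. if j = i then 1 else 0"
  subgoal for i by (rule summable_finite[of "{i}"]) auto
  done

lemma inner_unit_vec: "inner (unit_vec i) x = coord x i"
proof -
  have "inner (unit_vec i) x = (\<Sum>j\<in>{i}. coord (unit_vec i) j * coord x j)"
    unfolding inner_ell2_def by (rule suminf_finite) (auto simp: unit_vec.rep_eq)
  then show ?thesis by (simp add: unit_vec.rep_eq)
qed


section \<open>Operators\<close>

definition mat_entry :: "(ell2 \<Rightarrow> ell2) \<Rightarrow> nat \<Rightarrow> nat \<Rightarrow> real"
  where "mat_entry T i j = inner (unit_vec i) (T (unit_vec j))"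

definition symmetric_op :: "('a :: real_inner \<Rightarrow> 'a) \<Rightarrow> bool"
  where "symmetric_op T \<longleftrightarrow> (\<forall>x y. inner (T x) y = inner x (T y))"

definition Hilbert_Schmidt :: "(ell2 \<Rightarrow> ell2) \<Rightarrow> bool"
  where "Hilbert_Schmidt T \<longleftrightarrow>
    bounded_linear T \<and> summable (\<lambda>i. (norm (T (unit_vec i)))\<^sup>2)"

definition op_trace :: "(ell2 \<Rightarrow> ell2) \<Rightarrow> real"
  where "op_trace T = (\<Sum>i. inner (unit_vec i) (T (unit_vec i)))"

text \<open>
  Spectrum in the real Banach algebra of bounded operators. For a symmetric operator the
  spectrum of the complexification is contained in the real line, so that restricting to real
  scalars loses nothing.
\<close>

definition op_spectrum :: "('a :: real_normed_vector \<Rightarrow> 'a) \<Rightarrow> real set"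
  where "op_spectrum T =
    {c. \<not> (\<exists>R. bounded_linear R \<and>
              (\<forall>x. R (T x - c *\<^sub>R x) = x) \<and> (\<forall>x. T (R x) - c *\<^sub>R R x = x))}"

text \<open>Suprema are taken in \<^typ>\<open>ereal\<close>, where they exist unconditionally.\<close>

definition spectral_radius :: "('a :: real_normed_vector \<Rightarrow> 'a) \<Rightarrow> ereal"
  where "spectral_radius T = (SUP c\<in>op_spectrum T. ereal \<bar>c\<bar>)"

text \<open>Consistency of \<^const>\<open>op_trace\<close> with the formula for the trace of the square in terms of
  matrix entries:\<close>

lemma op_trace_square:
  assumes sym: "symmetric_op T" and HS: "Hilbert_Schmidt T"
  shows "((\<lambda>(i, j). (mat_entry T i j)\<^sup>2) has_sum op_trace (T \<circ> T)) UNIV"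
proof -
  have tr: "op_trace (T \<circ> T) = (\<Sum>i. (norm (T (unit_vec i)))\<^sup>2)"
    using sym by (simp add: op_trace_def symmetric_op_def power2_norm_eq_inner)
  have row: "((\<lambda>j. (mat_entry T i j)\<^sup>2) has_sum (norm (T (unit_vec i)))\<^sup>2) UNIV" for i
  proof -
    have e: "mat_entry T i j = coord (T (unit_vec i)) j" for j
      using sym inner_unit_vec[of j "T (unit_vec i)"]
      by (simp add: mat_entry_def symmetric_op_def inner_commute)
    have "(\<lambda>j. (mat_entry T i j)\<^sup>2) sums (norm (T (unit_vec i)))\<^sup>2"
      unfolding e power2_norm_eq_inner inner_ell2_def
      using summable_sums[OF summable_coord_sq[of "T (unit_vec i)"]]
      by (simp add: power2_eq_square)
    then show ?thesis
      by (rule sums_nonneg_imp_has_sum) simp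
  qed
  have "(\<lambda>i. (norm (T (unit_vec i)))\<^sup>2) sums op_trace (T \<circ> T)"
    using HS unfolding tr Hilbert_Schmidt_def by (intro summable_sums) simp
  then have col: "((\<lambda>i. (norm (T (unit_vec i)))\<^sup>2) has_sum op_trace (T \<circ> T)) UNIV"
    by (rule sums_nonneg_imp_has_sum) simp
  have "((\<lambda>(i, j). (mat_entry T i j)\<^sup>2) has_sum op_trace (T \<circ> T)) (Sigma UNIV (\<lambda>_. UNIV))"
  proof (rule has_sum_SigmaI)
    show "((\<lambda>j. case (i, j) of (i, j) \<Rightarrow> (mat_entry T i j)\<^sup>2) has_sum
            (norm (T (unit_vec i)))\<^sup>2) UNIV" for i
      using row by simp
    show "((\<lambda>i. (norm (T (unit_vec i)))\<^sup>2) has_sum op_trace (T \<circ> T)) UNIV"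
      by (rule col)
    show "(\<lambda>(i, j). (mat_entry T i j)\<^sup>2) summable_on Sigma UNIV (\<lambda>_. UNIV)"
    proof (rule summable_on_SigmaI)
      show "((\<lambda>j. case (i, j) of (i, j) \<Rightarrow> (mat_entry T i j)\<^sup>2) has_sum
              (norm (T (unit_vec i)))\<^sup>2) UNIV" for i
        using row by simp
      show "(\<lambda>i. (norm (T (unit_vec i)))\<^sup>2) summable_on UNIV"
        using col by (rule has_sum_imp_summable)
    qed simp
  qed
  then show ?thesis by simp
qed


section \<open>Convergence of random series in mean square\<close>

text \<open>The integral is the one for nonnegative functions, so that it also detects failure of
  square-integrability. The limit is determined by the series up to almost sure equality.\<close>

definition has_L2_sum ::
    "'w measure \<Rightarrow> ('i \<Rightarrow> 'w \<Rightarrow> real) \<Rightarrow> ('w \<Rightarrow> real) \<Rightarrow> 'i set \<Rightarrow> bool"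
  where "has_L2_sum M X Q I \<longleftrightarrow>
    Q \<in> borel_measurable M \<and>
    ((\<lambda>F. \<integral>\<^sup>+ w. ennreal ((Q w - (\<Sum>i\<in>F. X i w))\<^sup>2) \<partial>M) \<longlongrightarrow> 0)
      (finite_subsets_at_top I)"


section \<open>Regularity\<close>

definition Ck :: "nat \<Rightarrow> (real \<Rightarrow> real) \<Rightarrow> bool"
  where "Ck p g \<longleftrightarrow>
    (\<forall>k<p. \<forall>x. (deriv ^^ k) g differentiable at x) \<and> continuous_on UNIV ((deriv ^^ p) g)"

definition sup_norm :: "(real \<Rightarrow> real) \<Rightarrow> ereal"
  where "sup_norm g = (SUP x. ereal \<bar>g x\<bar>)"

end

theory Submission
  imports Defs "HOL-Real_Asymp.Real_Asymp"
begin

text \<open>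
  Write \<open>\<phi>\<^sub>n\<close> for the characteristic function of \<open>Q\<^sub>n\<close>. By Fourier inversion it suffices that
  \<open>\<phi>\<^sub>n(t)\<close> tends to \<open>exp(-t\<^sup>2/9)\<close> pointwise and that \<open>|\<phi>\<^sub>n(t)| \<le> C |t|\<^sup>-\<^sup>k\<close> for large \<open>n\<close>, for every \<open>k\<close>.
  Both are proved for the finite sections of the matrix, with bounds depending only on its operator
  norm, which is at most the spectral radius.

  For the pointwise limit, integration by parts for the uniform law,
  \<open>E[U g(U)] = E[(1 - U\<^sup>2)/2 g'(U)]\<close>, gives \<open>\<phi>' = -t E[\<Gamma> exp(itQ)]\<close> with
  \<open>\<Gamma> = \<Sum>\<^sub>i (1 - U\<^sub>i\<^sup>2) (A U)\<^sub>i\<^sup>2\<close>, and further integrations by parts show that \<open>\<Gamma>\<close> may be replaced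
  by its mean \<open>2/9\<close> up to an error of the order of the operator norm.

  For the decay, split the indices in two halves carrying a quarter of the Hilbert-Schmidt norm
  and apply the Cauchy-Schwarz inequality, which bounds \<open>|\<phi>|\<^sup>2\<close> by an expectation of a product of
  cardinal sines of linear forms. Dominating these by positive definite functions coming from
  Gaussian variables with random deletions reduces the claim to Gaussian bilinear forms, where a
  differential inequality gives the decay \<open>(1 + s \<rho>\<^sup>2) powr (- h / (2 \<rho>\<^sup>2))\<close>: a small operator
  norm \<open>\<rho>\<close> at fixed Hilbert-Schmidt norm makes the exponent large.
\<close>

section \<open>Differentiation under the integral sign\<close>

text \<open>The uniform law is not rotation invariant, so the matrix cannot be diagonalised inside
  \<open>Q\<close>. Everything is expressed through two quantities that behave well under
  restriction to submatrices, the operator norm and the Hilbert-Schmidt norm. The number 2/9 is 2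
  (1/3)^2, as E[U^2] = 1/3 and Tr A^2 = 1. It is also the mean of \<open>\<Gamma>\<close>: 1 - U_i^2
  has mean 2/3, the squares of (A U)_i have means adding up to 1/3, and the zero diagonal makes the
  two factors independent. The obstacle to the decay is that sin x / x is only O(1/|x|) and lies
  below no Gaussian function. An atom of mass d repairs this: d alone covers |x| > 1/d, and a
  Gaussian part of variance d^2/4 covers the rest. The dominating function is again a characteristic
  function, so integrals can be exchanged and rows traded for columns. The price is random deletion,
  which replaces the base theta of a power by d + (1 - d) theta, once for columns and once for rows;
  letting d tend to 0 slowly as |t| grows keeps this base small.\<close>

lemma onorm_scaleR_left_le:
  fixes z :: "'b::real_normed_vector"
  assumes "norm z \<le> B"
  shows "onorm (\<lambda>x::real. x *\<^sub>R z) \<le> B"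
  using assms order.trans[OF norm_ge_zero assms]
  by (intro onorm_bound) (simp_all add: mult.commute[of B] mult_left_mono)

text \<open>The mean value inequality on the convex set \<open>S\<close> bounds the difference
  quotients by \<open>G\<close>, so a majorant of the derivative alone suffices for dominated
  convergence. \<open>S\<close> need not be a neighbourhood of \<open>t\<close>: the one-sided
  derivative at the end of \<open>{0..}\<close> is taken later.\<close>

lemma has_vector_derivative_integral:
  fixes f :: "real \<Rightarrow> 'a \<Rightarrow> 'b::{banach, second_countable_topology}"
  assumes S: "convex S" "t \<in> S"
    and int: "\<And>s. s \<in> S \<Longrightarrow> integrable M (f s)"
    and der: "\<And>s x. s \<in> S \<Longrightarrow> x \<in> space M \<Longrightarrow>
      ((\<lambda>s. f s x) has_vector_derivative f' s x) (at s within S)"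
    and bound: "\<And>s x. s \<in> S \<Longrightarrow> x \<in> space M \<Longrightarrow> norm (f' s x) \<le> G x"
    and G: "integrable M G"
    and meas: "f' t \<in> borel_measurable M"
  shows "((\<lambda>s. \<integral>x. f s x \<partial>M) has_vector_derivative (\<integral>x. f' t x \<partial>M)) (at t within S)"
proof -
  have G0: "0 \<le> G x" if "x \<in> space M" for x
    using bound[OF S(2) that] norm_ge_zero order_trans by blast
  have int': "integrable M (f' t)"
    by (rule Bochner_Integration.integrable_bound[OF G meas]) (use bound[OF S(2)] G0 in auto)
  \<comment> \<open>First-order remainder divided by the increment. At \<open>y = t\<close> division
    by zero gives 0, so the bound by \<open>2 * G x\<close> holds there as well.\<close>
  define q where "q y x = (1 / norm (y - t)) *\<^sub>R (f y x - (f t x + (y - t) *\<^sub>R f' t x))" for y x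
  have q_int: "(\<integral>x. q y x \<partial>M) = (1 / norm (y - t)) *\<^sub>R
      ((\<integral>x. f y x \<partial>M) - ((\<integral>x. f t x \<partial>M) + (y - t) *\<^sub>R (\<integral>x. f' t x \<partial>M)))" if "y \<in> S" for y
    unfolding q_def using int[OF that] int[OF S(2)] int' by simp
  have q_bound: "norm (q y x) \<le> 2 * G x" if "y \<in> S" "x \<in> space M" for y x
  proof (cases "y = t")
    case False
    have 1: "norm (f y x - f t x) \<le> G x * norm (y - t)"
    proof (rule differentiable_bound[OF S(1), where f' = "\<lambda>s h. h *\<^sub>R f' s x"])
      fix s assume s: "s \<in> S"
      show "((\<lambda>s. f s x) has_derivative (\<lambda>h. h *\<^sub>R f' s x)) (at s within S)"
        using der[OF s that(2)] by (simp add: has_vector_derivative_def)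
      show "onorm (\<lambda>h. h *\<^sub>R f' s x) \<le> G x"
        by (rule onorm_scaleR_left_le[OF bound[OF s that(2)]])
    qed (use S(2) that in auto)
    have 2: "norm ((y - t) *\<^sub>R f' t x) \<le> G x * norm (y - t)"
      using bound[OF S(2) that(2)] by (simp add: mult.commute[of "G x"] mult_left_mono)
    have "norm (f y x - (f t x + (y - t) *\<^sub>R f' t x)) \<le> 2 * G x * norm (y - t)"
      using norm_triangle_ineq4[of "f y x - f t x" "(y - t) *\<^sub>R f' t x"] 1 2 by (simp add: algebra_simps)
    then show ?thesis using False
      by (simp add: q_def divide_le_eq del: scaleR_conv_of_real)
  qed (simp add: q_def G0 that)
  have lim: "((\<lambda>y. \<integral>x. q y x \<partial>M) \<longlongrightarrow> 0) (at t within S)"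
    unfolding tendsto_at_iff_sequentially comp_def
  proof (intro allI impI)
    fix Y :: "nat \<Rightarrow> real" assume Y: "\<forall>i. Y i \<in> S - {t}" "Y \<longlonglongrightarrow> t"
    have "(\<lambda>i. \<integral>x. q (Y i) x \<partial>M) \<longlonglongrightarrow> (\<integral>x. 0 \<partial>M)"
    proof (rule integral_dominated_convergence[where w = "\<lambda>x. 2 * G x"])
      show "q (Y i) \<in> borel_measurable M" for i
        using Y(1) int[of "Y i"] int[OF S(2)] meas unfolding q_def
        by (intro borel_measurable_scaleR borel_measurable_diff borel_measurable_add) auto
      show "AE x in M. norm (q (Y i) x) \<le> 2 * G x" for i
        using q_bound Y(1) by auto
      show "AE x in M. (\<lambda>i. q (Y i) x) \<longlonglongrightarrow> 0"
      proof (rule AE_I2)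
        fix x assume x: "x \<in> space M"
        have "((\<lambda>y. q y x) \<longlongrightarrow> 0) (at t within S)"
          using der[OF S(2) x] unfolding has_vector_derivative_def has_derivative_within q_def by auto
        then show "(\<lambda>i. q (Y i) x) \<longlonglongrightarrow> 0"
          using Y unfolding tendsto_at_iff_sequentially comp_def by auto
      qed
    qed (use G in auto)
    then show "(\<lambda>i. \<integral>x. q (Y i) x \<partial>M) \<longlonglongrightarrow> 0" by simp
  qed
  have "((\<lambda>y. (1 / norm (y - t)) *\<^sub>R
      ((\<integral>x. f y x \<partial>M) - ((\<integral>x. f t x \<partial>M) + (y - t) *\<^sub>R (\<integral>x. f' t x \<partial>M)))) \<longlongrightarrow> 0) (at t within S)"
    by (rule Lim_transform_eventually[OF lim]) (auto simp: eventually_at_filter q_int)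
  then show ?thesis
    unfolding has_vector_derivative_def has_derivative_within
    by (auto intro!: bounded_linear_scaleR_left)
qed

section \<open>Gaussian bilinear forms\<close>

abbreviation gauss :: "real measure" where "gauss \<equiv> std_normal_distribution"

lemma prob_space_gauss: "prob_space gauss"
  using real_dist_normal_dist real_distribution_def by blast

lemma gauss_int_abs_powers: "integrable gauss (\<lambda>x. \<bar>x\<bar> ^ k)"
  using integrable_std_normal_distribution_moment[of k]
  by (simp flip: power_abs add: integrable_abs)

lemma gauss_integrable_poly:
  fixes f :: "real \<Rightarrow> real"
  assumes [measurable]: "f \<in> borel_measurable borel" and b: "\<And>x. \<bar>f x\<bar> \<le> C * (1 + \<bar>x\<bar>) ^ k"
  shows "integrable gauss f"
proof (rule Bochner_Integration.integrable_bound[where f = "\<lambda>x. C * (1 + \<bar>x\<bar>) ^ k"])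
  have "integrable gauss (\<lambda>x. \<Sum>i\<le>k. C * (of_nat (k choose i) * (1 ^ i * \<bar>x\<bar> ^ (k - i))))"
    by (intro Bochner_Integration.integrable_sum integrable_mult_right gauss_int_abs_powers)
  then show "integrable gauss (\<lambda>x. C * (1 + \<bar>x\<bar>) ^ k)"
    by (simp add: binomial_ring sum_distrib_left mult.assoc)
  show "AE x in gauss. norm (f x) \<le> norm (C * (1 + \<bar>x\<bar>) ^ k)"
    using b order_trans[OF b abs_ge_self] by auto
qed simp

text \<open>The density \<open>n\<close> satisfies \<open>n' = - y * n\<close>, so the difference of
  the two integrands is the derivative of \<open>H * n\<close>; polynomial growth removes the
  boundary terms and gives integrability.\<close>

lemma gauss_stein:
  fixes H H' :: "real \<Rightarrow> real"
  assumes der: "\<And>y. (H has_real_derivative H' y) (at y)" and cont: "\<And>y. isCont H' y"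
    and b: "\<And>y. \<bar>H y\<bar> \<le> C * (1 + \<bar>y\<bar>) ^ k" and b': "\<And>y. \<bar>H' y\<bar> \<le> C * (1 + \<bar>y\<bar>) ^ k"
  shows "(\<integral>y. y * H y \<partial>gauss) = (\<integral>y. H' y \<partial>gauss)"
proof -
  let ?n = std_normal_density
  have C0: "C \<ge> 0" using b[of 0] by simp
  have contH: "isCont H y" for y using der DERIV_isCont by blast
  have [measurable]: "H \<in> borel_measurable borel" "H' \<in> borel_measurable borel"
    using contH cont by (auto intro!: borel_measurable_continuous_onI continuous_at_imp_continuous_on)
  have i1: "integrable gauss (\<lambda>y. y * H y)"
  proof (rule gauss_integrable_poly[of _ C "Suc k"])
    fix x
    have "\<bar>x\<bar> * \<bar>H x\<bar> \<le> (1 + \<bar>x\<bar>) * (C * (1 + \<bar>x\<bar>) ^ k)" by (intro mult_mono b) auto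
    then show "\<bar>x * H x\<bar> \<le> C * (1 + \<bar>x\<bar>) ^ Suc k" by (simp add: abs_mult algebra_simps)
  qed simp
  have i2: "integrable gauss H'" by (rule gauss_integrable_poly[OF _ b']) simp
  have dn: "(?n has_real_derivative - y * ?n y) (at y)" for y
    unfolding std_normal_density_def by (auto intro!: derivative_eq_intros simp: field_simps)
  have cn: "isCont ?n y" for y using dn DERIV_isCont by blast
  have i1': "integrable lborel (\<lambda>y. ?n y * (y * H y))" and i2': "integrable lborel (\<lambda>y. ?n y * H' y)"
    using i1 i2 by (simp_all add: integrable_density)
  have dom: "\<bar>H y * ?n y\<bar> \<le> C * (1 + \<bar>y\<bar>) ^ k * ?n y" for y
    using mult_right_mono[OF b[of y], of "?n y"] by (simp add: abs_mult)
  have L1: "((\<lambda>y. C * (1 + \<bar>y\<bar>) ^ k * ?n y) \<longlongrightarrow> 0) at_top" unfolding std_normal_density_def by real_asymp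
  have L2: "((\<lambda>y. C * (1 + \<bar>y\<bar>) ^ k * ?n y) \<longlongrightarrow> 0) at_bot" 
    using L1 unfolding filterlim_at_bot_mirror by (simp add: std_normal_density_def)
  have "(LBINT y=-\<infinity>..\<infinity>. ?n y * H' y - ?n y * (y * H y)) = 0 - 0"
  proof (rule interval_integral_FTC_integrable[where F = "\<lambda>y. H y * ?n y"])
    show "((\<lambda>y. H y * ?n y) has_vector_derivative ?n y * H' y - ?n y * (y * H y)) (at y)" for y
      unfolding has_real_derivative_iff_has_vector_derivative[symmetric]
      using DERIV_mult[OF der dn] by (rule DERIV_cong) (simp add: algebra_simps)
    show "isCont (\<lambda>y. ?n y * H' y - ?n y * (y * H y)) y" for y
      by (intro continuous_intros cont contH cn)
    show "set_integrable lborel (einterval (-\<infinity>) \<infinity>) (\<lambda>y. ?n y * H' y - ?n y * (y * H y))"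
      using i1' i2' by (simp add: set_integrable_def)
    show "(((\<lambda>y. H y * ?n y) \<circ> real_of_ereal) \<longlongrightarrow> 0) (at_right (-\<infinity>))"
      unfolding comp_def at_right_MInf filterlim_filtermap
      using tendsto_rabs_zero_cancel tendsto_sandwich[OF _ _ tendsto_const L2] dom
      by (auto intro!: tendsto_rabs_zero_cancel[OF tendsto_sandwich[OF _ _ tendsto_const L2]] always_eventually simp: comp_def)
    show "(((\<lambda>y. H y * ?n y) \<circ> real_of_ereal) \<longlongrightarrow> 0) (at_left \<infinity>)"
      unfolding comp_def at_left_PInf filterlim_filtermap
      using dom
      by (auto intro!: tendsto_rabs_zero_cancel[OF tendsto_sandwich[OF _ _ tendsto_const L1]] always_eventually simp: comp_def)
  qed simp
  then have "(\<integral>y. ?n y * H' y - ?n y * (y * H y) \<partial>lborel) = 0"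
    by (simp add: interval_integral_to_infinity_eq interval_lebesgue_integral_def set_lebesgue_integral_def)
  then show ?thesis
    using i1' i2' by (simp add: integral_density)
qed

section \<open>Product measures, one coordinate at a time\<close>

lemma measurable_PiM_coord:
  assumes "sets \<mu> = sets borel" "i \<in> I"
  shows "(\<lambda>x. x i) \<in> borel_measurable (PiM I (\<lambda>_. \<mu>))"
  using measurable_component_singleton[OF assms(2), of "\<lambda>_. \<mu>"]
  by (simp cong: measurable_cong_sets add: assms(1) measurable_cong_sets[OF refl assms(1)])

text \<open>Fubini with all other coordinates frozen. Both integrations by parts, Gaussian and
  uniform, reach the product measure through this lemma.\<close>

lemma PiM_integral_coord_eq:
  fixes f g :: "('i \<Rightarrow> 'a) \<Rightarrow> 'b::{banach, second_countable_topology}"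
  assumes "prob_space \<mu>" "finite I" "i \<in> I"
    and "integrable (PiM I (\<lambda>_. \<mu>)) f" "integrable (PiM I (\<lambda>_. \<mu>)) g"
    and eq: "\<And>x. (\<integral>y. f (x(i := y)) \<partial>\<mu>) = (\<integral>y. g (x(i := y)) \<partial>\<mu>)"
  shows "(\<integral>x. f x \<partial>PiM I (\<lambda>_. \<mu>)) = (\<integral>x. g x \<partial>PiM I (\<lambda>_. \<mu>))"
proof -
  interpret prob_space \<mu> by fact
  interpret product_sigma_finite "\<lambda>_::'i. \<mu>" by standard
  have I: "I = insert i (I - {i})" using assms by auto
  show ?thesis
    using assms(2-5)
    by (subst (1 2) I, subst (1 2) product_integral_insert) (auto simp: eq insert_absorb)
qed

lemma integrable_PiM_coord:
  fixes f :: "'a \<Rightarrow> 'b::{banach, second_countable_topology}"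
  assumes "prob_space \<mu>" "i \<in> I" "integrable \<mu> f"
  shows "integrable (PiM I (\<lambda>_. \<mu>)) (\<lambda>x. f (x i))"
proof -
  have "integrable (distr (PiM I (\<lambda>_. \<mu>)) \<mu> (\<lambda>x. x i)) f"
    using distr_PiM_component[of I "\<lambda>_. \<mu>" i] assms by simp
  then show ?thesis
    using assms(2,3) by (subst (asm) integrable_distr_eq) auto
qed

lemma integrable_gauss_product:
  assumes "i \<in> I" "k \<in> I"
  shows "integrable (PiM I (\<lambda>_. gauss)) (\<lambda>g. g i * g k)"
proof (rule Bochner_Integration.integrable_bound[where f = "\<lambda>g. (g i)\<^sup>2 + (g k)\<^sup>2"])
  have "integrable gauss (\<lambda>x. x\<^sup>2)" by (rule integrable_std_normal_distribution_moment)
  then show "integrable (PiM I (\<lambda>_. gauss)) (\<lambda>g. (g i)\<^sup>2 + (g k)\<^sup>2)"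
    using assms integrable_PiM_coord[OF prob_space_gauss, of _ I "\<lambda>x. x\<^sup>2"]
    by (intro Bochner_Integration.integrable_add) auto
  have [measurable]: "(\<lambda>x. x i) \<in> borel_measurable (PiM I (\<lambda>_. gauss))"
      "(\<lambda>x. x k) \<in> borel_measurable (PiM I (\<lambda>_. gauss))"
    using assms by (auto intro!: measurable_PiM_coord)
  show "(\<lambda>g. g i * g k) \<in> borel_measurable (PiM I (\<lambda>_. gauss))" by measurable
  have "\<bar>x * y\<bar> \<le> x\<^sup>2 + y\<^sup>2" for x y :: real
    using sum_squares_bound[of "\<bar>x\<bar>" "\<bar>y\<bar>"] mult_nonneg_nonneg[of "\<bar>x\<bar>" "\<bar>y\<bar>"]
    by (simp add: abs_mult del: mult_nonneg_nonneg)
  then show "AE g in PiM I (\<lambda>_. gauss). norm (g i * g k) \<le> norm ((g i)\<^sup>2 + (g k)\<^sup>2)"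
    by simp
qed

text \<open>
  If \<open>K s\<close> denotes the left-hand side and \<open>Z\<close> the quadratic form, Gaussian integration by parts
  gives \<open>E[Z exp(-sZ/2)] = h K - s E[|b z|\<^sup>2 exp(-sZ/2)] \<ge> h K - s r\<^sup>2 E[Z exp(-sZ/2)]\<close>, that is
  \<open>-2 K' \<ge> h K / (1 + s r\<^sup>2)\<close>. This replaces a diagonalisation: the bound is sharp when all
  nonzero singular values of \<open>b\<close> equal \<open>r\<close>.
\<close>

lemma gauss_bilinear_bound:
  fixes b :: "nat \<Rightarrow> nat \<Rightarrow> real"
  assumes fin: "finite R" "finite S" and r: "r > 0" and s: "s \<ge> 0"
    and op: "\<And>y. (\<Sum>i\<in>R. (\<Sum>j\<in>S. b i j * y j)\<^sup>2) \<le> r\<^sup>2 * (\<Sum>j\<in>S. (y j)\<^sup>2)"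
  shows "(\<integral>g. exp (- (s / 2) * (\<Sum>j\<in>S. (\<Sum>i\<in>R. b i j * g i)\<^sup>2)) \<partial>PiM R (\<lambda>_. gauss))
    \<le> (1 + s * r\<^sup>2) powr (- ((\<Sum>i\<in>R. \<Sum>j\<in>S. (b i j)\<^sup>2) / (2 * r\<^sup>2)))"
proof -
  interpret G: prob_space gauss by (rule prob_space_gauss)
  interpret GP: product_prob_space "\<lambda>_::nat. gauss" R by standard
  let ?M = "PiM R (\<lambda>_. gauss)"
  define h where "h = (\<Sum>i\<in>R. \<Sum>j\<in>S. (b i j)\<^sup>2)"
  define z where "z j g = (\<Sum>i\<in>R. b i j * g i)" for j and g :: "nat \<Rightarrow> real"
  define Z where "Z g = (\<Sum>j\<in>S. (z j g)\<^sup>2)" for g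
  define K where "K s = (\<integral>g. exp (- (s / 2) * Z g) \<partial>?M)" for s
  define D where "D s = (\<integral>g. Z g * exp (- (s / 2) * Z g) \<partial>?M)" for s
  have Z0: "Z g \<ge> 0" for g by (simp add: Z_def sum_nonneg)
  have [measurable]: "(\<lambda>g. g i) \<in> borel_measurable ?M" if "i \<in> R" for i
    using that by (auto intro!: measurable_PiM_coord)
  have zm [measurable]: "z j \<in> borel_measurable ?M" for j
    unfolding z_def by measurable
  have [measurable]: "Z \<in> borel_measurable ?M"
    unfolding Z_def by measurable
  have damp: "integrable ?M (\<lambda>g. f g * exp (- (s / 2) * Z g))" if "integrable ?M f" "s \<ge> 0" for f s
  proof (rule Bochner_Integration.integrable_bound[OF that(1)])
    show "(\<lambda>g. f g * exp (- (s / 2) * Z g)) \<in> borel_measurable ?M"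
      using that(1) by measurable
    have "\<bar>f g\<bar> * exp (- (s / 2) * Z g) \<le> \<bar>f g\<bar> * 1" for g
      using that(2) Z0[of g] by (intro mult_left_mono) auto
    then show "AE g in ?M. norm (f g * exp (- (s / 2) * Z g)) \<le> norm (f g)"
      by (simp add: abs_mult)
  qed
  have iz: "integrable ?M (\<lambda>g. g i * z j g)" if "i \<in> R" for i j
    unfolding z_def sum_distrib_left using integrable_gauss_product[OF that]
    by (auto intro!: Bochner_Integration.integrable_sum simp: mult.left_commute[of _ "b _ j"])
  have zz: "integrable ?M (\<lambda>g. z j g * z k g)" for j k
    unfolding z_def[of j] sum_distrib_right using iz
    by (auto intro!: Bochner_Integration.integrable_sum simp: mult.assoc)
  have iZ: "integrable ?M Z"
    unfolding Z_def power2_eq_square by (intro Bochner_Integration.integrable_sum zz)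
  \<comment> \<open>Only within \<open>{0..}\<close>: for negative \<open>s\<close> the exponential
    grows and integrability is not at hand. On this set the derivative is dominated by
    \<open>Z\<close>.\<close>
  have dK: "(K has_real_derivative - D s / 2) (at s within {0..})" if "s \<ge> 0" for s
  proof -
    have "((\<lambda>s. \<integral>g. exp (- (s / 2) * Z g) \<partial>?M) has_vector_derivative
      (\<integral>g. - (Z g / 2) * exp (- (s / 2) * Z g) \<partial>?M)) (at s within {0..})"
    proof (rule has_vector_derivative_integral[where G = Z])
      show "integrable ?M (\<lambda>g. exp (- (s / 2) * Z g))" if "s \<in> {0..}" for s
        using damp[of "\<lambda>_. 1" s] that by simp
      show "((\<lambda>s. exp (- (s / 2) * Z g)) has_vector_derivative
          - (Z g / 2) * exp (- (s / 2) * Z g)) (at s within {0..})" for s g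
        unfolding has_real_derivative_iff_has_vector_derivative[symmetric]
        by (auto intro!: derivative_eq_intros)
      show "norm (- (Z g / 2) * exp (- (s / 2) * Z g)) \<le> Z g" if "s \<in> {0..}" for s g
        using mult_mono[of "Z g / 2" "Z g" "exp (- (s / 2) * Z g)" 1] that Z0[of g] by (simp add: abs_mult)
    qed (use that iZ in auto)
    then show ?thesis
      unfolding K_def[abs_def] D_def has_real_derivative_iff_has_vector_derivative by simp
  qed
  \<comment> \<open>Integration by parts in \<open>g i\<close>: the derivative of \<open>z j\<close>
    gives \<open>b i j\<close>, that of the exponential gives \<open>- s\<close> times the sum of
    the \<open>b i k * z k\<close>.\<close>
  have stein: "(\<integral>g. g i * z j g * exp (- (s / 2) * Z g) \<partial>?M)
      = (\<integral>g. (b i j - s * (z j g * (\<Sum>k\<in>S. b i k * z k g))) * exp (- (s / 2) * Z g) \<partial>?M)"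
    if ij: "i \<in> R" "j \<in> S" and s: "s \<ge> 0" for i j s
  proof (rule PiM_integral_coord_eq[OF prob_space_gauss fin(1) ij(1)])
    show "integrable ?M (\<lambda>g. g i * z j g * exp (- (s / 2) * Z g))"
      by (intro damp iz ij s)
    show "integrable ?M (\<lambda>g. (b i j - s * (z j g * (\<Sum>k\<in>S. b i k * z k g))) * exp (- (s / 2) * Z g))"
      using zz s unfolding sum_distrib_left
      by (intro damp) (auto intro!: Bochner_Integration.integrable_sum simp: mult.left_commute[of _ "b i _"])
    fix x :: "nat \<Rightarrow> real"
    define c where "c k = (\<Sum>l\<in>R - {i}. b l k * x l)" for k
    have zx: "z k (x(i := y)) = b i k * y + c k" for k y
      unfolding z_def c_def using ij(1) fin(1) by (subst sum.remove[of _ i]) auto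
    define L where "L = (\<Sum>k\<in>S. \<bar>b i k\<bar> + \<bar>c k\<bar>)"
    define B where "B = (\<Sum>k\<in>S. \<bar>b i k\<bar>)"
    define E where "E y = exp (- (s / 2) * (\<Sum>k\<in>S. (b i k * y + c k)\<^sup>2))" for y
    \<comment> \<open>A common growth constant for the function and its derivative; the latter is
      quadratic in \<open>y\<close> apart from the damping factor \<open>E y\<close>, hence degree
      2.\<close>
    define C where "C = L + \<bar>b i j\<bar> + s * L * L * B"
    have L0: "L \<ge> 0" "B \<ge> 0" by (simp_all add: L_def B_def sum_nonneg)
    have lin: "\<bar>b i k * y + c k\<bar> \<le> L * (1 + \<bar>y\<bar>)" if "k \<in> S" for k y
    proof -
      have "\<bar>b i k\<bar> + \<bar>c k\<bar> \<le> L" unfolding L_def using that fin(2) by (intro member_le_sum) auto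
      then have *: "(\<bar>b i k\<bar> + \<bar>c k\<bar>) * (1 + \<bar>y\<bar>) \<le> L * (1 + \<bar>y\<bar>)" by (intro mult_right_mono) auto
      have "\<bar>b i k * y + c k\<bar> \<le> \<bar>b i k\<bar> * \<bar>y\<bar> + \<bar>c k\<bar>" by (simp add: abs_triangle_ineq order.trans abs_mult[symmetric])
      also have "\<dots> \<le> (\<bar>b i k\<bar> + \<bar>c k\<bar>) * (1 + \<bar>y\<bar>)" by (simp add: algebra_simps)
      finally show ?thesis using * by linarith
    qed
    have E: "0 < E y" "E y \<le> 1" for y
      using s by (auto simp: E_def sum_nonneg)
    have dE: "(E has_real_derivative - s * (\<Sum>k\<in>S. b i k * (b i k * y + c k)) * E y) (at y)" for y
    proof -
      have "((\<lambda>y. \<Sum>k\<in>S. (b i k * y + c k)\<^sup>2) has_real_derivative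
          (\<Sum>k\<in>S. 2 * (b i k * (b i k * y + c k)))) (at y)"
        by (auto intro!: derivative_eq_intros sum.cong)
      from DERIV_cmult[OF this, of "- (s / 2)"] show ?thesis
        unfolding E_def by (auto intro!: derivative_eq_intros simp: sum_distrib_left[symmetric])
    qed
    have "(\<integral>y. y * ((b i j * y + c j) * E y) \<partial>gauss) =
        (\<integral>y. (b i j - s * ((b i j * y + c j) * (\<Sum>k\<in>S. b i k * (b i k * y + c k)))) * E y \<partial>gauss)"
    proof (rule gauss_stein[where C = C and k = 2])
      show "((\<lambda>y. (b i j * y + c j) * E y) has_real_derivative
          (b i j - s * ((b i j * y + c j) * (\<Sum>k\<in>S. b i k * (b i k * y + c k)))) * E y) (at y)" for y
        by (rule derivative_eq_intros dE refl)+ (simp add: algebra_simps)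
      show "isCont (\<lambda>y. (b i j - s * ((b i j * y + c j) * (\<Sum>k\<in>S. b i k * (b i k * y + c k)))) * E y) y" for y
        unfolding E_def by (intro continuous_intros)
      fix y :: real
      have y1: "1 + \<bar>y\<bar> \<le> (1 + \<bar>y\<bar>)\<^sup>2" "1 \<le> (1 + \<bar>y\<bar>)\<^sup>2"
        by (rule self_le_power one_le_power; simp)+
      have "\<bar>(b i j * y + c j) * E y\<bar> \<le> L * (1 + \<bar>y\<bar>) * 1"
        unfolding abs_mult using E[of y] lin[OF ij(2)] by (intro mult_mono) (auto simp: L0)
      also have "\<dots> \<le> C * (1 + \<bar>y\<bar>)\<^sup>2"
        using y1 L0 s by (auto intro!: mult_mono simp: C_def)
      finally show "\<bar>(b i j * y + c j) * E y\<bar> \<le> C * (1 + \<bar>y\<bar>)\<^sup>2" .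
      have "\<bar>\<Sum>k\<in>S. b i k * (b i k * y + c k)\<bar> \<le> (\<Sum>k\<in>S. \<bar>b i k\<bar> * (L * (1 + \<bar>y\<bar>)))"
        by (intro order.trans[OF sum_abs] sum_mono) (auto simp: abs_mult intro!: mult_left_mono lin)
      then have S1: "\<bar>\<Sum>k\<in>S. b i k * (b i k * y + c k)\<bar> \<le> B * (L * (1 + \<bar>y\<bar>))"
        by (simp add: B_def sum_distrib_right)
      have "\<bar>b i j - s * ((b i j * y + c j) * (\<Sum>k\<in>S. b i k * (b i k * y + c k)))\<bar>
          \<le> \<bar>b i j\<bar> + s * ((L * (1 + \<bar>y\<bar>)) * (B * (L * (1 + \<bar>y\<bar>))))"
        using s L0 lin[OF ij(2)] S1
        by (intro order.trans[OF abs_triangle_ineq4] add_mono) (auto simp: abs_mult intro!: mult_mono)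
      also have "\<dots> = \<bar>b i j\<bar> + s * L * L * B * (1 + \<bar>y\<bar>)\<^sup>2" by (simp add: power2_eq_square algebra_simps)
      also have "\<dots> \<le> \<bar>b i j\<bar> * (1 + \<bar>y\<bar>)\<^sup>2 + s * L * L * B * (1 + \<bar>y\<bar>)\<^sup>2"
        using mult_left_mono[OF y1(2), of "\<bar>b i j\<bar>"] by simp
      also have "\<dots> \<le> C * (1 + \<bar>y\<bar>)\<^sup>2" using L0 by (simp add: C_def algebra_simps)
      finally have "\<bar>b i j - s * ((b i j * y + c j) * (\<Sum>k\<in>S. b i k * (b i k * y + c k)))\<bar> * E y \<le> C * (1 + \<bar>y\<bar>)\<^sup>2 * 1"
        using E[of y] by (intro mult_mono) auto
      then show "\<bar>(b i j - s * ((b i j * y + c j) * (\<Sum>k\<in>S. b i k * (b i k * y + c k)))) * E y\<bar> \<le> C * (1 + \<bar>y\<bar>)\<^sup>2"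
        using E(1)[of y] by (simp add: abs_mult)
    qed
    then show "(\<integral>y. (x(i := y)) i * z j (x(i := y)) * exp (- (s / 2) * Z (x(i := y))) \<partial>gauss) =
      (\<integral>y. (b i j - s * (z j (x(i := y)) * (\<Sum>k\<in>S. b i k * z k (x(i := y)))))
          * exp (- (s / 2) * Z (x(i := y))) \<partial>gauss)"
      by (simp add: Z_def zx E_def mult.assoc)
  qed
  \<comment> \<open>The identities \<open>stein\<close> are summed with weights
    \<open>b i j\<close>: the constant terms add up to \<open>h * K s\<close>, the others form the
    squared norm of \<open>b\<close> applied to \<open>z\<close>, which \<open>op\<close> bounds by
    \<open>r\<^sup>2 * Z\<close>.\<close>
  have DK: "h * K s \<le> (1 + s * r\<^sup>2) * D s" if s: "s \<ge> 0" for s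
  proof -
    let ?e = "\<lambda>g. exp (- (s / 2) * Z g)"
    have ib: "integrable ?M (\<lambda>g. z j g * (\<Sum>k\<in>S. b i k * z k g))" for i j
      using zz unfolding sum_distrib_left
      by (auto intro!: Bochner_Integration.integrable_sum simp: mult.left_commute[of _ "b i _"])
    have "D s = (\<integral>g. (\<Sum>j\<in>S. \<Sum>i\<in>R. b i j * (g i * z j g * ?e g)) \<partial>?M)"
      unfolding D_def Z_def power2_eq_square z_def[of _ _]
      by (simp add: sum_distrib_left sum_distrib_right mult_ac)
    also have "\<dots> = (\<Sum>j\<in>S. \<Sum>i\<in>R. b i j * (\<integral>g. g i * z j g * ?e g \<partial>?M))"
      using damp[OF iz s] by (subst Bochner_Integration.integral_sum; (intro Bochner_Integration.integrable_sum)?; simp)+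
    also have "\<dots> = (\<Sum>j\<in>S. \<Sum>i\<in>R. b i j * (b i j * K s - s * (\<integral>g. z j g * (\<Sum>k\<in>S. b i k * z k g) * ?e g \<partial>?M)))"
    proof (intro sum.cong refl arg_cong2[where f = "(*)"])
      fix i j assume ij: "j \<in> S" "i \<in> R"
      have "(\<integral>g. g i * z j g * ?e g \<partial>?M) = (\<integral>g. b i j * ?e g - s * (z j g * (\<Sum>k\<in>S. b i k * z k g) * ?e g) \<partial>?M)"
        using stein[OF ij(2,1) s] by (simp add: algebra_simps)
      also have "\<dots> = b i j * K s - s * (\<integral>g. z j g * (\<Sum>k\<in>S. b i k * z k g) * ?e g \<partial>?M)"
        using damp[of "\<lambda>_. 1", OF _ s] damp[OF ib s] by (simp add: K_def)
      finally show "(\<integral>g. g i * z j g * ?e g \<partial>?M) = \<dots>" .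
    qed
    also have "\<dots> = h * K s - s * (\<Sum>j\<in>S. \<Sum>i\<in>R. b i j * (\<integral>g. z j g * (\<Sum>k\<in>S. b i k * z k g) * ?e g \<partial>?M))"
      unfolding h_def sum.swap[of _ R S]
      by (simp add: right_diff_distrib sum_subtractf sum_distrib_left sum_distrib_right power2_eq_square mult_ac)
    finally have D_eq: "D s = h * K s - s *
        (\<Sum>j\<in>S. \<Sum>i\<in>R. b i j * (\<integral>g. z j g * (\<Sum>k\<in>S. b i k * z k g) * ?e g \<partial>?M))" .
    have "(\<Sum>j\<in>S. \<Sum>i\<in>R. b i j * (\<integral>g. z j g * (\<Sum>k\<in>S. b i k * z k g) * ?e g \<partial>?M)) =
        (\<integral>g. (\<Sum>j\<in>S. \<Sum>i\<in>R. b i j * (z j g * (\<Sum>k\<in>S. b i k * z k g) * ?e g)) \<partial>?M)"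
      using damp[OF ib s] by (subst Bochner_Integration.integral_sum; (intro Bochner_Integration.integrable_sum)?; simp)+
    also have "\<dots> = (\<integral>g. (\<Sum>i\<in>R. (\<Sum>k\<in>S. b i k * z k g)\<^sup>2) * ?e g \<partial>?M)"
      by (subst sum.swap) (simp only: power2_eq_square sum_distrib_right mult.assoc)
    also have "\<dots> \<le> (\<integral>g. r\<^sup>2 * (Z g * ?e g) \<partial>?M)"
    proof (rule integral_mono)
      show "integrable ?M (\<lambda>g. (\<Sum>i\<in>R. (\<Sum>k\<in>S. b i k * z k g)\<^sup>2) * ?e g)"
      proof (intro damp Bochner_Integration.integrable_sum s)
        fix i assume "i \<in> R"
        have "integrable ?M (\<lambda>g. \<Sum>j\<in>S. b i j * (z j g * (\<Sum>k\<in>S. b i k * z k g)))"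
          using ib by (intro Bochner_Integration.integrable_sum integrable_mult_right) auto
        then show "integrable ?M (\<lambda>g. (\<Sum>k\<in>S. b i k * z k g)\<^sup>2)"
          by (simp only: power2_eq_square sum_distrib_right mult.assoc)
      qed
      show "integrable ?M (\<lambda>g. r\<^sup>2 * (Z g * ?e g))" using damp[OF iZ s] by simp
      show "(\<Sum>i\<in>R. (\<Sum>k\<in>S. b i k * z k g)\<^sup>2) * ?e g \<le> r\<^sup>2 * (Z g * ?e g)" for g
        using mult_right_mono[OF op[of "\<lambda>k. z k g"], of "?e g"] by (simp add: Z_def mult.assoc)
    qed
    also have "\<dots> = r\<^sup>2 * D s" by (simp add: D_def)
    finally have "s * (\<Sum>j\<in>S. \<Sum>i\<in>R. b i j * (\<integral>g. z j g * (\<Sum>k\<in>S. b i k * z k g) * ?e g \<partial>?M))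
        \<le> s * (r\<^sup>2 * D s)"
      using s by (rule mult_left_mono)
    moreover have "(1 + s * r\<^sup>2) * D s = D s + s * (r\<^sup>2 * D s)" by (simp add: algebra_simps)
    ultimately show ?thesis using D_eq by linarith
  qed
  define q where "q = h / (2 * r\<^sup>2)"
  have pos: "0 < 1 + s * r\<^sup>2" if "s \<ge> 0" for s using that by (simp add: add_pos_nonneg)
  \<comment> \<open>In the equality case of \<open>DK\<close> the function \<open>K\<close> would be
    \<open>(1 + s * r\<^sup>2) powr (- q)\<close>; the quotient of \<open>K\<close> by this solution
    does not increase.\<close>
  define F where "F s = K s * (1 + s * r\<^sup>2) powr q" for s
  have dF: "(F has_real_derivative (- D s / 2) * (1 + s * r\<^sup>2) powr q +
      (q * (1 + s * r\<^sup>2) powr (q - 1) * r\<^sup>2) * K s) (at s within {0..})" if "s \<ge> 0" for s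
    unfolding F_def by (rule derivative_eq_intros dK that refl | use pos[OF that] in simp)+
  have "F s \<le> F 0"
  proof (rule DERIV_nonpos_imp_decreasing_open[OF s])
    show "continuous_on {0..s} F"
      by (rule DERIV_continuous_on[OF DERIV_subset[OF dF]]) auto
    fix x :: real assume x: "0 < x" "x < s"
    have P: "(1 + x * r\<^sup>2) powr q = (1 + x * r\<^sup>2) powr (q - 1) * (1 + x * r\<^sup>2)"
      using powr_add[of "1 + x * r\<^sup>2" "q - 1" 1] pos[of x] x by simp
    have q: "q * r\<^sup>2 = h / 2" using r by (simp add: q_def)
    have "(- D x / 2) * (1 + x * r\<^sup>2) powr q + (q * (1 + x * r\<^sup>2) powr (q - 1) * r\<^sup>2) * K x
        = (1 + x * r\<^sup>2) powr (q - 1) * ((q * r\<^sup>2) * K x - (1 + x * r\<^sup>2) * D x / 2)"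
      unfolding P by (simp add: field_simps)
    also have "\<dots> = (1 + x * r\<^sup>2) powr (q - 1) / 2 * (h * K x - (1 + x * r\<^sup>2) * D x)"
      unfolding q by (simp add: field_simps)
    also have "\<dots> \<le> 0"
      using DK[of x] x by (intro mult_nonneg_nonpos) auto
    finally show "\<exists>y. (F has_real_derivative y) (at x) \<and> y \<le> 0"
      using dF[of x] x at_within_interior[of x "{0..}"] by (auto simp: interior_Ici[of "-1"])
  qed
  also have "F 0 = 1"
    using prob_space.prob_space[OF prob_space_PiM, of R "\<lambda>_. gauss"] prob_space_gauss
    by (simp add: F_def K_def)
  finally have "K s \<le> (1 + s * r\<^sup>2) powr - q"
    using pos[OF s] by (simp add: F_def powr_minus field_simps)
  then show ?thesis
    by (simp add: K_def Z_def z_def q_def h_def)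
qed

section \<open>Characteristic functions of the uniform law\<close>

abbreviation unif :: "real measure" where "unif \<equiv> uniform_measure lborel {-1..1}"

lemma prob_space_unif: "prob_space unif"
  by (rule prob_space_uniform_measure) simp_all

lemma sets_unif: "sets unif = sets borel" by simp

lemma integral_unif:
  fixes f :: "real \<Rightarrow> 'b::{banach, second_countable_topology}"
  assumes [measurable]: "f \<in> borel_measurable borel"
  shows "(\<integral>x. f x \<partial>unif) = (1 / 2) *\<^sub>R (\<integral>x. indicator {-1..1} x *\<^sub>R f x \<partial>lborel)"
proof -
  have "unif = density lborel (\<lambda>x. ennreal (indicator {-1..1} x / 2))"
    unfolding uniform_measure_def
    by (intro density_cong) (auto simp: indicator_def divide_ennreal[symmetric])
  then have "(\<integral>x. f x \<partial>unif) = (\<integral>x. (indicator {-1..1} x / 2) *\<^sub>R f x \<partial>lborel)"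
    by (simp add: integral_density)
  also have "\<dots> = (\<integral>x. (1 / 2) *\<^sub>R (indicator {-1..1} x *\<^sub>R f x) \<partial>lborel)"
    by simp
  finally show ?thesis by (simp only: integral_scaleR_right)
qed

text \<open>The library has \<open>sinc\<close> only as an abbreviation, which the simplifier sees through.\<close>

definition csin :: "real \<Rightarrow> real" where "csin x = (if x = 0 then 1 else sin x / x)"

lemma csin_measurable [measurable]: "csin \<in> borel_measurable borel"
  unfolding csin_def[abs_def] by measurable

lemma char_unif: "char unif t = complex_of_real (csin t)"
proof (cases "t = 0")
  case True
  then show ?thesis using prob_space.prob_space[OF prob_space_unif] by (simp add: char_def csin_def)
next
  case False
  have der: "((\<lambda>x. iexp (t * x) / (\<i> * t)) has_vector_derivative iexp (t * x)) (at x within A)" for x A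
  proof -
    have "((\<lambda>z. exp (\<i> * (t * z)) / (\<i> * t)) has_field_derivative exp (\<i> * (t * x))) (at (complex_of_real x))"
      using False by (auto intro!: derivative_eq_intros simp: algebra_simps)
    from has_vector_derivative_real_field[OF this] show ?thesis by simp
  qed
  have "char unif t = (1 / 2) *\<^sub>R (\<integral>x. indicator {-1..1} x *\<^sub>R iexp (t * x) \<partial>lborel)"
    unfolding char_def by (subst integral_unif) auto
  also have "(\<integral>x. indicator {-1..1} x *\<^sub>R iexp (t * x) \<partial>lborel)
      = iexp (t * 1) / (\<i> * t) - iexp (t * (-1)) / (\<i> * t)"
    by (intro integral_FTC_Icc der) (auto intro!: continuous_intros)
  also have "(1 / 2) *\<^sub>R \<dots> = complex_of_real (csin t)"
    using False by (simp add: csin_def complex_eq_iff Re_divide Im_divide Re_exp Im_exp power2_eq_square field_simps)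
  finally show ?thesis .
qed

lemma abs_csin_le_1: "\<bar>csin x\<bar> \<le> 1"
  using abs_sin_x_le_abs_x[of x] by (simp add: csin_def abs_divide divide_le_eq)

text \<open>
  The right-hand side is the characteristic function of a variable that vanishes with probability
  \<open>d\<close> and is centred Gaussian of variance \<open>d\<^sup>2 / 4\<close> otherwise.
\<close>

lemma abs_csin_le_mixture:
  assumes d: "0 < d" "d \<le> 1"
  shows "\<bar>csin x\<bar> \<le> d + (1 - d) * exp (- (d\<^sup>2 / 4 * x\<^sup>2 / 2))"
proof -
  have main: "\<bar>csin x\<bar> \<le> d + (1 - d) * exp (- (d\<^sup>2 / 4 * x\<^sup>2 / 2))" if x: "x > 0" for x :: real
  proof -
    have ex: "1 - d\<^sup>2 * x\<^sup>2 / 8 \<le> exp (- (d\<^sup>2 / 4 * x\<^sup>2 / 2))"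
      using exp_ge_add_one_self[of "- (d\<^sup>2 / 4 * x\<^sup>2 / 2)"] by simp
    have e1: "exp (- (d\<^sup>2 / 4 * x\<^sup>2 / 2)) \<le> 1" by simp
    have "d * exp (- (d\<^sup>2 / 4 * x\<^sup>2 / 2)) \<le> d * 1" using d by (intro mult_left_mono e1) auto
    \<comment> \<open>As \<open>d\<close> is at least \<open>d\<close> times the exponential, the
      mixture is at least the exponential itself, and hence at least a quadratic.\<close>
    then have lo: "1 - d\<^sup>2 * x\<^sup>2 / 8 \<le> d + (1 - d) * exp (- (d\<^sup>2 / 4 * x\<^sup>2 / 2))"
      using ex by (simp add: algebra_simps)
    \<comment> \<open>Up to 2 the Taylor polynomial decides. Up to \<open>1 / d\<close> the left
      side is at most 1/2 and the right side at least 7/8. Beyond that the left side is at most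
      \<open>1 / x\<close>, which the atom \<open>d\<close> covers.\<close>
    consider "x \<le> 2" | "2 < x" "x \<le> 1 / d" | "1 / d < x" by linarith
    then show ?thesis
    proof cases
      case 1
      have "sin x \<ge> 0" using x 1 pi_gt3 by (intro sin_ge_zero) auto
      then have a: "\<bar>csin x\<bar> = sin x / x" using x by (simp add: csin_def)
      have "\<bar>sin x - (\<Sum>m<5. sin_coeff m * x ^ m)\<bar> \<le> inverse (fact 5) * \<bar>x\<bar> ^ 5"
        by (rule Maclaurin_sin_bound)
      moreover have "(\<Sum>m<5. sin_coeff m * x ^ m) = x - x ^ 3 / 6"
      proof -
        have "{..<5::nat} = {0, 1, 2, 3, 4}" by auto
        then show ?thesis by (simp add: sin_coeff_def fact_numeral)
      qed
      ultimately have "sin x \<le> x - x ^ 3 / 6 + x ^ 5 / 120"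
        using x abs_ge_self[of "sin x - (x - x ^ 3 / 6)"] by (simp add: fact_numeral)
      \<comment> \<open>Bounding the fifth-order term leaves the coefficient 1/6 - 4/120 = 2/15,
        still above 1/8.\<close>
      also have "x ^ 5 \<le> 4 * x ^ 3"
        using mult_mono[of "x\<^sup>2" 4 "x ^ 3" "x ^ 3"] power_mono[of x 2 2] 1 x
        by (simp add: power_add[symmetric])
      then have "x - x ^ 3 / 6 + x ^ 5 / 120 \<le> x * (1 - x\<^sup>2 / 8)"
        using zero_less_power[OF x, of 3] by (simp add: algebra_simps power2_eq_square power3_eq_cube)
      finally have "sin x / x \<le> 1 - x\<^sup>2 / 8" using x by (simp add: divide_le_eq mult.commute)
      also have "\<dots> \<le> 1 - d\<^sup>2 * x\<^sup>2 / 8"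
        using d mult_right_mono[of "d\<^sup>2" 1 "x\<^sup>2"] by (simp add: power_le_one)
      finally show ?thesis using a lo by linarith
    next
      case 2
      have "\<bar>csin x\<bar> \<le> 1 / x" using x by (simp add: csin_def divide_right_mono)
      also have "\<dots> \<le> 1 / 2" using 2 by simp
      finally have "\<bar>csin x\<bar> \<le> 1 / 2" .
      moreover have "(d * x)\<^sup>2 \<le> 1" using 2(2) d x by (intro power_le_one) (auto simp: field_simps)
      ultimately show ?thesis using lo by (simp add: power_mult_distrib)
    next
      case 3
      have "\<bar>csin x\<bar> \<le> 1 / x" using x by (simp add: csin_def divide_right_mono)
      also have "\<dots> \<le> d" using 3 d x by (simp add: field_simps)
      finally show ?thesis using d by (smt (verit) exp_ge_zero mult_nonneg_nonneg)
    qed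
  qed
  consider "x > 0" | "x = 0" | "- x > 0" by linarith
  then show ?thesis
  proof cases
    case 3 then show ?thesis using main[of "- x"] by (simp add: csin_def)
  qed (use main d in \<open>auto simp: csin_def\<close>)
qed

text \<open>Jensen's inequality for the concave function \<open>x powr c\<close> at the points 1 and
  \<open>\<theta>\<close> with weights \<open>d\<close> and \<open>1 - d\<close>.\<close>

lemma mixture_powr_le:
  fixes d \<theta> c :: real
  assumes "0 < d" "d \<le> 1" "0 < \<theta>" "0 \<le> c" "c \<le> 1"
  shows "d + (1 - d) * \<theta> powr c \<le> (d + (1 - d) * \<theta>) powr c"
proof -
  define m where "m = d + (1 - d) * \<theta>"
  have m: "m > 0" using assms by (simp add: m_def add_pos_nonneg)
  \<comment> \<open>The graph of \<open>x powr c\<close> lies below its tangent at the mean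
    \<open>m\<close>; this comes from Young's inequality. Averaged over the two points, the linear
    terms collapse.\<close>
  have y: "a powr c \<le> c * (a / m) * m powr c + (1 - c) * m powr c" if "a > 0" for a
  proof -
    have "(a / m) powr c * 1 powr (1 - c) \<le> c * (a / m) + (1 - c) * 1"
      using assms m that by (intro Youngs_inequality_0) auto
    then have "(a / m) powr c * m powr c \<le> (c * (a / m) + (1 - c)) * m powr c"
      by (intro mult_right_mono) auto
    then show ?thesis using m that by (simp add: powr_divide distrib_right)
  qed
  have "d * 1 powr c + (1 - d) * \<theta> powr c \<le>
      d * (c * (1 / m) * m powr c + (1 - c) * m powr c) +
      (1 - d) * (c * (\<theta> / m) * m powr c + (1 - c) * m powr c)"
    using assms y[of 1] y[of \<theta>] by (intro add_mono mult_left_mono) auto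
  also have "\<dots> = m powr c * (c * ((d + (1 - d) * \<theta>) / m) + (1 - c))"
    using m by (simp add: field_simps)
  also have "\<dots> = m powr c" using m by (simp add: m_def[symmetric])
  finally show ?thesis by (simp add: m_def)
qed

text \<open>In the application \<open>c j\<close> is the squared norm of a column or row divided by
  the squared operator norm, hence at most 1.\<close>

lemma prod_mixture_powr_le:
  fixes d \<theta> :: real
  assumes "0 < d" "d \<le> 1" "0 < \<theta>" and c: "\<And>j. j \<in> J \<Longrightarrow> 0 \<le> c j \<and> c j \<le> 1"
  shows "(\<Prod>j\<in>J. d + (1 - d) * \<theta> powr c j) \<le> (d + (1 - d) * \<theta>) powr (\<Sum>j\<in>J. c j)"
proof (cases "finite J")
  case True
  have pos: "0 < d + (1 - d) * \<theta>" using assms by (simp add: add_pos_nonneg)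
  have "(\<Prod>j\<in>J. d + (1 - d) * \<theta> powr c j) \<le> (\<Prod>j\<in>J. (d + (1 - d) * \<theta>) powr c j)"
    using assms by (intro prod_mono) (auto intro!: mixture_powr_le add_nonneg_nonneg)
  also have "\<dots> = (d + (1 - d) * \<theta>) powr (\<Sum>j\<in>J. c j)"
    using pos True by (subst powr_sum) auto
  finally show ?thesis .
next
  case False
  have "0 < d + (1 - d) * \<theta>" using assms by (simp add: add_pos_nonneg)
  then show ?thesis using False by simp
qed

text \<open>The weights form the law of a random set \<open>S\<close> in which each index survives
  independently with probability \<open>1 - d\<close>; a product of mixtures is the mean of the
  products over the survivors.\<close>

lemma prod_mixture_expand:
  fixes d :: real
  assumes "finite J"
  shows "(\<Prod>j\<in>J. d + (1 - d) * e j) =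
    (\<Sum>S\<in>Pow J. ((1 - d) ^ card S * d ^ card (J - S)) * (\<Prod>j\<in>S. e j))"
  using prod_add[OF assms, of "\<lambda>j. (1 - d) * e j" "\<lambda>_. d"]
  by (simp add: prod.distrib add.commute mult_ac)

lemma char_PiM:
  assumes \<mu>: "prob_space \<mu>" "sets \<mu> = sets borel" and c: "\<And>t. char \<mu> t = complex_of_real (c t)"
    and "finite I"
  shows "(\<integral>x. iexp (\<Sum>i\<in>I. a i * x i) \<partial>PiM I (\<lambda>_. \<mu>)) = complex_of_real (\<Prod>i\<in>I. c (a i))"
proof -
  interpret prob_space \<mu> by fact
  interpret product_sigma_finite "\<lambda>_. \<mu>" by standard
  have "integrable \<mu> (\<lambda>x. iexp (a i * x))" for i
    by (intro integrable_iexp) (auto simp: measurable_cong_sets[OF \<mu>(2) refl])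
  then have "(\<integral>x. (\<Prod>i\<in>I. iexp (a i * x i)) \<partial>PiM I (\<lambda>_. \<mu>)) = (\<Prod>i\<in>I. char \<mu> (a i))"
    unfolding char_def using \<open>finite I\<close> by (subst product_integral_prod) auto
  then show ?thesis
    using \<open>finite I\<close> by (simp add: c exp_sum[symmetric] sum_distrib_left)
qed

section \<open>Decoupling\<close>

lemma integral_pair_product:
  fixes f :: "'a \<Rightarrow> complex" and g :: "'b \<Rightarrow> complex"
  assumes "prob_space M" "prob_space N"
    and [measurable]: "f \<in> borel_measurable M" "g \<in> borel_measurable N"
    and b: "\<And>x. norm (f x) \<le> 1" "\<And>y. norm (g y) \<le> 1"
  shows "(\<integral>p. f (fst p) * g (snd p) \<partial>(M \<Otimes>\<^sub>M N)) = (\<integral>x. f x \<partial>M) * (\<integral>y. g y \<partial>N)"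
proof -
  interpret M: prob_space M by fact
  interpret N: prob_space N by fact
  interpret P: pair_prob_space M N ..
  have "integrable (M \<Otimes>\<^sub>M N) (\<lambda>p. f (fst p) * g (snd p))"
    by (rule P.integrable_const_bound[where B = 1]) (auto simp: norm_mult intro!: mult_le_one b)
  from P.integral_fst'[OF this] show ?thesis by simp
qed

lemma sq_norm_integral_le:
  fixes F :: "'a \<Rightarrow> complex"
  assumes "prob_space M" and [measurable]: "F \<in> borel_measurable M" and b: "\<And>x. norm (F x) \<le> 1"
  shows "(norm (\<integral>x. F x \<partial>M))\<^sup>2 \<le> (\<integral>x. (norm (F x))\<^sup>2 \<partial>M)"
proof -
  interpret prob_space M by fact
  have i1: "integrable M (\<lambda>x. norm (F x))" 
    by (rule integrable_const_bound[where B = 1]) (use b in auto)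
  have i2: "integrable M (\<lambda>x. (norm (F x))\<^sup>2)"
    by (rule integrable_const_bound[where B = 1]) (use b in \<open>simp_all add: power_le_one\<close>)
  have "(norm (\<integral>x. F x \<partial>M))\<^sup>2 \<le> (\<integral>x. norm (F x) \<partial>M)\<^sup>2"
    by (intro power_mono integral_norm_bound) auto
  also have "\<dots> \<le> (\<integral>x. (norm (F x))\<^sup>2 \<partial>M)"
    using variance_eq[OF i1 i2] variance_positive[of "\<lambda>x. norm (F x)"] by linarith
  finally show ?thesis .
qed

text \<open>Weyl differencing. The factor with \<open>\<alpha>\<close> has modulus 1 and disappears
  in the Cauchy-Schwarz step over \<open>x\<close>. The squared inner integral becomes an integral
  over two copies of \<open>y\<close>, and after Fubini the factor with \<open>\<beta>\<close> is a
  mere phase too. Only the interaction \<open>\<gamma>\<close> survives.\<close>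

lemma decoupling:
  fixes \<alpha> :: "'a \<Rightarrow> real" and \<beta> :: "'b \<Rightarrow> real" and \<gamma> :: "'a \<times> 'b \<Rightarrow> real"
  assumes M: "prob_space M" and N: "prob_space N"
    and [measurable]: "\<alpha> \<in> borel_measurable M" "\<beta> \<in> borel_measurable N" "\<gamma> \<in> borel_measurable (M \<Otimes>\<^sub>M N)"
  shows "(norm (\<integral>x. (\<integral>y. iexp (\<alpha> x + \<beta> y + \<gamma> (x, y)) \<partial>N) \<partial>M))\<^sup>2
    \<le> (\<integral>p. norm (\<integral>x. iexp (\<gamma> (x, fst p) - \<gamma> (x, snd p)) \<partial>M) \<partial>(N \<Otimes>\<^sub>M N))"
proof -
  interpret M: prob_space M by fact
  interpret N: prob_space N by fact
  interpret NN: pair_prob_space N N ..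
  interpret MNN: pair_prob_space M "N \<Otimes>\<^sub>M N" ..
  define F where "F x = (\<integral>y. iexp (\<beta> y + \<gamma> (x, y)) \<partial>N)" for x
  have [measurable]: "F \<in> borel_measurable M" unfolding F_def by measurable
  have F1: "norm (F x) \<le> 1" for x
    unfolding F_def by (rule order.trans[OF integral_norm_bound]) (simp add: N.prob_space)
  define D where "D x p = \<beta> (fst p) - \<beta> (snd p) + (\<gamma> (x, fst p) - \<gamma> (x, snd p))" for x p
  have F2: "complex_of_real ((norm (F x))\<^sup>2) = (\<integral>p. iexp (D x p) \<partial>(N \<Otimes>\<^sub>M N))" if "x \<in> space M" for x
  proof -
    have [measurable]: "(\<lambda>y. \<gamma> (x, y)) \<in> borel_measurable N" using that by measurable
    have "complex_of_real ((norm (F x))\<^sup>2) = F x * cnj (F x)" by (rule complex_norm_square)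
    also have "cnj (F x) = (\<integral>y. iexp (- (\<beta> y + \<gamma> (x, y))) \<partial>N)"
      unfolding F_def by (subst Bochner_Integration.integral_cnj[symmetric]) (simp add: exp_cnj algebra_simps)
    also have "F x * \<dots> = (\<integral>p. iexp (\<beta> (fst p) + \<gamma> (x, fst p)) * iexp (- (\<beta> (snd p) + \<gamma> (x, snd p))) \<partial>(N \<Otimes>\<^sub>M N))"
      unfolding F_def by (rule integral_pair_product[symmetric, OF N N]) auto
    finally show ?thesis by (simp add: D_def exp_add[symmetric] algebra_simps)
  qed
  have "(\<integral>x. (\<integral>y. iexp (\<alpha> x + \<beta> y + \<gamma> (x, y)) \<partial>N) \<partial>M) = (\<integral>x. iexp (\<alpha> x) * F x \<partial>M)"
    unfolding F_def by (simp add: exp_add[symmetric] algebra_simps flip: integral_mult_right_zero)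
  also have "(norm \<dots>)\<^sup>2 \<le> (\<integral>x. (norm (iexp (\<alpha> x) * F x))\<^sup>2 \<partial>M)"
    by (rule sq_norm_integral_le[OF M]) (auto simp: norm_mult F1)
  also have "\<dots> = (\<integral>x. (norm (F x))\<^sup>2 \<partial>M)" by (simp add: norm_mult)
  also have "\<dots> = norm (\<integral>x. complex_of_real ((norm (F x))\<^sup>2) \<partial>M)"
    by (simp add: integral_nonneg_AE flip: of_real_power)
  also have "(\<integral>x. complex_of_real ((norm (F x))\<^sup>2) \<partial>M) = (\<integral>x. (\<integral>p. iexp (D x p) \<partial>(N \<Otimes>\<^sub>M N)) \<partial>M)"
    by (intro Bochner_Integration.integral_cong refl F2)
  also have "\<dots> = (\<integral>p. (\<integral>x. iexp (D x p) \<partial>M) \<partial>(N \<Otimes>\<^sub>M N))"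
    by (intro MNN.Fubini_integral[symmetric] MNN.integrable_const_bound[where B = 1]) (auto simp: D_def)
  also have "norm \<dots> \<le> (\<integral>p. norm (\<integral>x. iexp (D x p) \<partial>M) \<partial>(N \<Otimes>\<^sub>M N))"
    by (rule integral_norm_bound)
  also have "\<dots> = (\<integral>p. norm (\<integral>x. iexp (\<gamma> (x, fst p) - \<gamma> (x, snd p)) \<partial>M) \<partial>(N \<Otimes>\<^sub>M N))"
  proof (intro Bochner_Integration.integral_cong refl)
    fix p
    have "(\<integral>x. iexp (D x p) \<partial>M) = iexp (\<beta> (fst p) - \<beta> (snd p)) * (\<integral>x. iexp (\<gamma> (x, fst p) - \<gamma> (x, snd p)) \<partial>M)"
      by (simp add: D_def exp_add[symmetric] algebra_simps flip: integral_mult_right_zero)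
    then show "norm (\<integral>x. iexp (D x p) \<partial>M) = norm (\<integral>x. iexp (\<gamma> (x, fst p) - \<gamma> (x, snd p)) \<partial>M)"
      by (simp add: norm_mult)
  qed
  finally show ?thesis .
qed

text \<open>Each \<open>exp (- (y\<^sup>2) / 2)\<close> is the Gaussian characteristic function at
  \<open>y\<close>. With Fubini the squares in the exponent become linear, so that in the
  application the independence of the coordinates of \<open>p\<close> can be exploited.\<close>

lemma gauss_smoothing:
  assumes P: "prob_space P" and R: "finite R" and y: "\<And>i. i \<in> R \<Longrightarrow> y i \<in> borel_measurable P"
  shows "complex_of_real (\<integral>p. exp (- (\<Sum>i\<in>R. (y i p)\<^sup>2) / 2) \<partial>P) =
    (\<integral>g. (\<integral>p. iexp (\<Sum>i\<in>R. y i p * g i) \<partial>P) \<partial>PiM R (\<lambda>_. gauss))"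
proof -
  let ?G = "PiM R (\<lambda>_. gauss)"
  interpret P: prob_space P by fact
  interpret G: prob_space ?G using prob_space_gauss by (intro prob_space_PiM)
  interpret PG: pair_prob_space P ?G ..
  have [measurable]: "y i \<in> borel_measurable P" "(\<lambda>g. g i) \<in> borel_measurable ?G" if "i \<in> R" for i
    using that y by (auto intro!: measurable_PiM_coord)
  have "complex_of_real (\<integral>p. exp (- (\<Sum>i\<in>R. (y i p)\<^sup>2) / 2) \<partial>P) =
      (\<integral>p. (\<integral>g. iexp (\<Sum>i\<in>R. y i p * g i) \<partial>?G) \<partial>P)"
    using char_PiM[OF prob_space_gauss, of "\<lambda>t. exp (- (t\<^sup>2) / 2)", OF _ _ R]
    by (simp add: char_std_normal_distribution exp_sum[OF R, symmetric] sum_negf sum_divide_distrib)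
  also have "\<dots> = (\<integral>g. (\<integral>p. iexp (\<Sum>i\<in>R. y i p * g i) \<partial>P) \<partial>?G)"
    by (rule PG.Fubini_integral[symmetric], rule PG.integrable_const_bound[where B = 1]) auto
  finally show ?thesis .
qed

text \<open>
  Each cardinal sine is bounded by the characteristic function of a Gaussian variable with random
  deletion, first in the rows and, after exchanging the integrals, in the columns. This leaves
  Gaussian bilinear forms of random submatrices. Deletions are averaged out by concavity of
  \<open>x powr c\<close>, as the entries squared enter additively in the exponent.
\<close>

lemma decoupled_bound:
  fixes b :: "nat \<Rightarrow> nat \<Rightarrow> real"
  assumes fin: "finite I" "finite J" and d: "0 < d" "d \<le> 1" and \<rho>: "\<rho> > 0"
    and op: "\<And>R S y. R \<subseteq> I \<Longrightarrow> S \<subseteq> J \<Longrightarrow>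
      (\<Sum>i\<in>R. (\<Sum>j\<in>S. b i j * y j)\<^sup>2) \<le> \<rho>\<^sup>2 * (\<Sum>j\<in>S. (y j)\<^sup>2)"
  shows "(\<integral>p. (\<Prod>i\<in>I. \<bar>csin (t * (\<Sum>j\<in>J. b i j * (fst p j - snd p j)))\<bar>)
        \<partial>(PiM J (\<lambda>_. unif) \<Otimes>\<^sub>M PiM J (\<lambda>_. unif)))
    \<le> (d + (1 - d) * (d + (1 - d) * (1 + (t * d\<^sup>2 / 4)\<^sup>2 * \<rho>\<^sup>2) powr (- 1 / 2)))
        powr ((\<Sum>i\<in>I. \<Sum>j\<in>J. (b i j)\<^sup>2) / \<rho>\<^sup>2)"
proof -
  let ?U = "PiM J (\<lambda>_. unif)"
  let ?PP = "?U \<Otimes>\<^sub>M ?U"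
  interpret U: prob_space ?U using prob_space_unif by (intro prob_space_PiM)
  interpret PP: pair_prob_space ?U ?U ..
  \<comment> \<open>The mixture bound at \<open>t * Y\<close> has the Gaussian exponent
    \<open>(\<kappa> * Y)\<^sup>2 / 2\<close>. A second application, at \<open>\<kappa> * z\<close>,
    multiplies \<open>\<kappa>\<^sup>2\<close> by \<open>d\<^sup>2 / 4\<close> once more, which
    gives \<open>s\<close>.\<close>
  define \<kappa> where "\<kappa> = t * d / 2"
  define s where "s = (t * d\<^sup>2 / 4)\<^sup>2"
  have s0: "s \<ge> 0" by (simp add: s_def)
  \<comment> \<open>Normalised so that \<open>gauss_bilinear_bound\<close> takes the form
    \<open>\<theta> powr (h / \<rho>\<^sup>2)\<close> with \<open>h\<close> the squared
    Hilbert-Schmidt norm of the submatrix.\<close>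
  define \<theta> where "\<theta> = (1 + s * \<rho>\<^sup>2) powr (- 1 / 2)"
  have sr: "1 + s * \<rho>\<^sup>2 > 0" using s0 by (simp add: add_pos_nonneg)
  have \<theta>: "\<theta> > 0" using sr by (simp add: \<theta>_def)
  define \<theta>' where "\<theta>' = d + (1 - d) * \<theta>"
  have \<theta>': "\<theta>' > 0" using d \<theta> by (simp add: \<theta>'_def add_pos_nonneg)
  \<comment> \<open>The probability that deletion from \<open>A\<close> leaves exactly
    \<open>S\<close>.\<close>
  define wt where "wt A S = (1 - d) ^ card S * d ^ card (A - S)" for A S :: "nat set"
  have wt0: "wt A S \<ge> 0" for A S using d by (simp add: wt_def)
  define Y where "Y i p = (\<Sum>j\<in>J. b i j * (fst p j - snd p j))" for i and p :: "(nat \<Rightarrow> real) \<times> (nat \<Rightarrow> real)"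
  define e where "e i p = exp (- ((\<kappa> * Y i p)\<^sup>2 / 2))" for i p
  have [measurable]: "(\<lambda>u. u j) \<in> borel_measurable ?U" if "j \<in> J" for j
    using that by (auto intro!: measurable_PiM_coord)
  have Ym [measurable]: "Y i \<in> borel_measurable ?PP" for i unfolding Y_def by measurable
  have [measurable]: "e i \<in> borel_measurable ?PP" for i unfolding e_def by measurable
  have e01: "0 \<le> e i p" "e i p \<le> 1" for i p by (auto simp: e_def)
  have ipe: "integrable ?PP (\<lambda>p. \<Prod>i\<in>R. e i p)" for R
    by (rule PP.integrable_const_bound[where B = 1]) (auto simp: prod_nonneg e01 intro!: prod_le_1)
  \<comment> \<open>The surviving rows \<open>R\<close> are fixed. Smoothing turns the row factors
    into Gaussian weights \<open>g\<close>; the integral over the uniform variables is then a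
    product over columns, which is dominated by mixtures in turn.\<close>
  have inner: "(\<integral>p. (\<Prod>i\<in>R. e i p) \<partial>?PP) \<le> (\<Prod>i\<in>R. \<theta>' powr ((\<Sum>j\<in>J. (b i j)\<^sup>2) / \<rho>\<^sup>2))"
    if R: "R \<subseteq> I" for R
  proof -
    let ?G = "PiM R (\<lambda>_. gauss)"
    interpret G: prob_space ?G using prob_space_gauss by (intro prob_space_PiM)
    have fR: "finite R" using R fin finite_subset by auto
    have [measurable]: "(\<lambda>g. g i) \<in> borel_measurable ?G" if "i \<in> R" for i
      using that by (auto intro!: measurable_PiM_coord)
    define z where "z j g = (\<Sum>i\<in>R. b i j * g i)" for j and g :: "nat \<Rightarrow> real"
    have [measurable]: "z j \<in> borel_measurable ?G" for j unfolding z_def by measurable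
    have "complex_of_real (\<integral>p. (\<Prod>i\<in>R. e i p) \<partial>?PP) = complex_of_real (\<integral>p. exp (- (\<Sum>i\<in>R. (\<kappa> * Y i p)\<^sup>2) / 2) \<partial>?PP)"
      by (simp add: e_def exp_sum[OF fR, symmetric] sum_negf sum_divide_distrib)
    also have "\<dots> = (\<integral>g. (\<integral>p. iexp (\<Sum>i\<in>R. (\<kappa> * Y i p) * g i) \<partial>?PP) \<partial>?G)"
      by (rule gauss_smoothing) (auto simp: fR PP.prob_space_axioms)
    also have "\<dots> = (\<integral>g. complex_of_real (\<Prod>j\<in>J. (csin (\<kappa> * z j g))\<^sup>2) \<partial>?G)"
    proof (intro Bochner_Integration.integral_cong refl)
      fix g
      have "(\<Sum>i\<in>R. (\<kappa> * Y i p) * g i) = (\<Sum>j\<in>J. (\<kappa> * z j g) * fst p j) + (\<Sum>j\<in>J. (- \<kappa> * z j g) * snd p j)" for p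
      proof -
        have "(\<Sum>i\<in>R. (\<kappa> * Y i p) * g i) = (\<Sum>j\<in>J. \<Sum>i\<in>R. \<kappa> * (b i j * (fst p j - snd p j)) * g i)"
          unfolding Y_def by (subst sum.swap) (simp add: sum_distrib_left sum_distrib_right)
        also have "\<dots> = (\<Sum>j\<in>J. (\<kappa> * z j g) * fst p j + (- \<kappa> * z j g) * snd p j)"
          unfolding z_def by (intro sum.cong refl)
            (simp add: sum_distrib_left sum_distrib_right sum.distrib[symmetric] algebra_simps sum_subtractf)
        finally show ?thesis by (simp only: sum.distrib)
      qed
      then have "(\<integral>p. iexp (\<Sum>i\<in>R. (\<kappa> * Y i p) * g i) \<partial>?PP) =
          (\<integral>p. iexp (\<Sum>j\<in>J. (\<kappa> * z j g) * fst p j) * iexp (\<Sum>j\<in>J. (- \<kappa> * z j g) * snd p j) \<partial>?PP)"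
        by (simp add: exp_add[symmetric] distrib_left)
      also have "\<dots> = (\<integral>u. iexp (\<Sum>j\<in>J. (\<kappa> * z j g) * u j) \<partial>?U) * (\<integral>u. iexp (\<Sum>j\<in>J. (- \<kappa> * z j g) * u j) \<partial>?U)"
        by (rule integral_pair_product) (auto simp: U.prob_space_axioms)
      also have "\<dots> = complex_of_real ((\<Prod>j\<in>J. csin (\<kappa> * z j g)) * (\<Prod>j\<in>J. csin (- \<kappa> * z j g)))"
        by (simp only: char_PiM[OF prob_space_unif sets_unif char_unif fin(2)] of_real_mult)
      also have "\<dots> = complex_of_real (\<Prod>j\<in>J. (csin (\<kappa> * z j g))\<^sup>2)"
      proof -
        have "csin (- \<kappa> * z j g) = csin (\<kappa> * z j g)" for j by (simp add: csin_def)
        then show ?thesis by (simp only: power2_eq_square prod.distrib)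
      qed
      finally show "(\<integral>p. iexp (\<Sum>i\<in>R. (\<kappa> * Y i p) * g i) \<partial>?PP) = complex_of_real (\<Prod>j\<in>J. (csin (\<kappa> * z j g))\<^sup>2)" .
    qed
    also have "\<dots> = complex_of_real (\<integral>g. (\<Prod>j\<in>J. (csin (\<kappa> * z j g))\<^sup>2) \<partial>?G)" by (rule integral_complex_of_real)
    finally have "(\<integral>p. (\<Prod>i\<in>R. e i p) \<partial>?PP) = (\<integral>g. (\<Prod>j\<in>J. (csin (\<kappa> * z j g))\<^sup>2) \<partial>?G)"
      by (simp only: of_real_eq_iff)
    also have "\<dots> \<le> (\<integral>g. (\<Prod>j\<in>J. d + (1 - d) * exp (- ((s / 2) * (z j g)\<^sup>2))) \<partial>?G)"
    proof (rule integral_mono)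
      show "integrable ?G (\<lambda>g. \<Prod>j\<in>J. (csin (\<kappa> * z j g))\<^sup>2)"
        by (rule G.integrable_const_bound[where B = 1])
          (use abs_csin_le_1 in \<open>auto simp: prod_nonneg abs_square_le_1 intro!: prod_le_1\<close>)
      show "integrable ?G (\<lambda>g. \<Prod>j\<in>J. d + (1 - d) * exp (- ((s / 2) * (z j g)\<^sup>2)))"
      proof (rule G.integrable_const_bound[where B = 1])
        have "0 \<le> d + (1 - d) * exp (- ((s / 2) * (z j g)\<^sup>2)) \<and>
            d + (1 - d) * exp (- ((s / 2) * (z j g)\<^sup>2)) \<le> 1" for j g
          using mult_left_mono[of "exp (- ((s / 2) * (z j g)\<^sup>2))" 1 "1 - d"] d s0
          by (simp add: add_nonneg_nonneg)
        then have "0 \<le> (\<Prod>j\<in>J. d + (1 - d) * exp (- ((s / 2) * (z j g)\<^sup>2)))"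
            "(\<Prod>j\<in>J. d + (1 - d) * exp (- ((s / 2) * (z j g)\<^sup>2))) \<le> 1" for g
          by (blast intro: prod_nonneg prod_le_1)+
        then show "AE g in ?G. norm (\<Prod>j\<in>J. d + (1 - d) * exp (- ((s / 2) * (z j g)\<^sup>2))) \<le> 1"
          by (intro AE_I2) (simp only: real_norm_def abs_of_nonneg)
      qed measurable
      show "(\<Prod>j\<in>J. (csin (\<kappa> * z j g))\<^sup>2) \<le> (\<Prod>j\<in>J. d + (1 - d) * exp (- ((s / 2) * (z j g)\<^sup>2)))" for g
      proof (intro prod_mono conjI zero_le_power2)
        fix j
        \<comment> \<open>The two copies contribute equal factors; one is bounded by 1 and the other
          by the mixture.\<close>
        have "(csin (\<kappa> * z j g))\<^sup>2 \<le> \<bar>csin (\<kappa> * z j g)\<bar>"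
          using mult_left_mono[OF abs_csin_le_1[of "\<kappa> * z j g"] abs_ge_zero[of "csin (\<kappa> * z j g)"]]
          by (simp add: power2_eq_square)
        also have "\<dots> \<le> d + (1 - d) * exp (- (d\<^sup>2 / 4 * (\<kappa> * z j g)\<^sup>2 / 2))" by (rule abs_csin_le_mixture[OF d])
        also have "d\<^sup>2 / 4 * (\<kappa> * z j g)\<^sup>2 / 2 = (s / 2) * (z j g)\<^sup>2"
          by (simp add: s_def \<kappa>_def power2_eq_square)
        finally show "(csin (\<kappa> * z j g))\<^sup>2 \<le> d + (1 - d) * exp (- ((s / 2) * (z j g)\<^sup>2))" .
      qed
    qed
    also have "\<dots> = (\<integral>g. (\<Sum>S\<in>Pow J. wt J S * exp (- (s / 2) * (\<Sum>j\<in>S. (z j g)\<^sup>2))) \<partial>?G)"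
    proof (intro Bochner_Integration.integral_cong refl)
      fix g
      have "(\<Prod>j\<in>S. exp (- ((s / 2) * (z j g)\<^sup>2))) = exp (- (s / 2) * (\<Sum>j\<in>S. (z j g)\<^sup>2))" if "S \<subseteq> J" for S
        using finite_subset[OF that fin(2)] by (simp add: exp_sum[symmetric] sum_distrib_left sum_negf)
      then show "(\<Prod>j\<in>J. d + (1 - d) * exp (- ((s / 2) * (z j g)\<^sup>2))) =
          (\<Sum>S\<in>Pow J. wt J S * exp (- (s / 2) * (\<Sum>j\<in>S. (z j g)\<^sup>2)))"
        by (subst prod_mixture_expand[OF fin(2)]) (auto simp: wt_def intro!: sum.cong)
    qed
    also have "\<dots> = (\<Sum>S\<in>Pow J. wt J S * (\<integral>g. exp (- (s / 2) * (\<Sum>j\<in>S. (z j g)\<^sup>2)) \<partial>?G))"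
    proof (subst Bochner_Integration.integral_sum)
      have "integrable ?G (\<lambda>g. exp (- (s / 2) * (\<Sum>j\<in>S. (z j g)\<^sup>2)))" for S
        by (rule G.integrable_const_bound[where B = 1]) (auto simp: s0 sum_nonneg)
      then show "integrable ?G (\<lambda>g. wt J S * exp (- (s / 2) * (\<Sum>j\<in>S. (z j g)\<^sup>2)))" for S
        by (rule integrable_mult_right)
    qed simp
    also have "\<dots> \<le> (\<Sum>S\<in>Pow J. wt J S * (\<Prod>j\<in>S. \<theta> powr ((\<Sum>i\<in>R. (b i j)\<^sup>2) / \<rho>\<^sup>2)))"
    proof (intro sum_mono mult_left_mono wt0)
      fix S assume S: "S \<in> Pow J"
      then have fS: "finite S" using fin(2) finite_subset by auto
      have "(\<integral>g. exp (- (s / 2) * (\<Sum>j\<in>S. (z j g)\<^sup>2)) \<partial>?G) \<le>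
          (1 + s * \<rho>\<^sup>2) powr (- ((\<Sum>i\<in>R. \<Sum>j\<in>S. (b i j)\<^sup>2) / (2 * \<rho>\<^sup>2)))"
        unfolding z_def using R S by (intro gauss_bilinear_bound fR fS \<rho> s0 op) auto
      \<comment> \<open>The exponent is additive over columns, so the bound is a product over
        \<open>S\<close> and the average over \<open>S\<close> folds back into a product of
        mixtures.\<close>
      also have "\<dots> = \<theta> powr (\<Sum>j\<in>S. (\<Sum>i\<in>R. (b i j)\<^sup>2) / \<rho>\<^sup>2)"
        by (subst sum.swap) (simp add: \<theta>_def powr_powr sum_divide_distrib[symmetric])
      also have "\<dots> = (\<Prod>j\<in>S. \<theta> powr ((\<Sum>i\<in>R. (b i j)\<^sup>2) / \<rho>\<^sup>2))"
        using \<theta> fS by (subst powr_sum) auto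
      finally show "(\<integral>g. exp (- (s / 2) * (\<Sum>j\<in>S. (z j g)\<^sup>2)) \<partial>?G) \<le> \<dots>" .
    qed
    also have "\<dots> = (\<Prod>j\<in>J. d + (1 - d) * \<theta> powr ((\<Sum>i\<in>R. (b i j)\<^sup>2) / \<rho>\<^sup>2))"
      by (subst prod_mixture_expand[OF fin(2)]) (simp add: wt_def)
    also have "\<dots> \<le> \<theta>' powr (\<Sum>j\<in>J. (\<Sum>i\<in>R. (b i j)\<^sup>2) / \<rho>\<^sup>2)"
      unfolding \<theta>'_def
    proof (intro prod_mixture_powr_le d \<theta> conjI)
      fix j assume j: "j \<in> J"
      show "0 \<le> (\<Sum>i\<in>R. (b i j)\<^sup>2) / \<rho>\<^sup>2" by (simp add: sum_nonneg)
      \<comment> \<open>The operator bound for the single column \<open>j\<close>, tested with a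
        unit vector.\<close>
      show "(\<Sum>i\<in>R. (b i j)\<^sup>2) / \<rho>\<^sup>2 \<le> 1" using op[OF R, of "{j}" "\<lambda>_. 1"] j \<rho> by simp
    qed
    also have "(\<Sum>j\<in>J. (\<Sum>i\<in>R. (b i j)\<^sup>2) / \<rho>\<^sup>2) = (\<Sum>i\<in>R. (\<Sum>j\<in>J. (b i j)\<^sup>2) / \<rho>\<^sup>2)"
      unfolding sum_divide_distrib[symmetric] by (subst sum.swap) (rule refl)
    also have "\<theta>' powr \<dots> = (\<Prod>i\<in>R. \<theta>' powr ((\<Sum>j\<in>J. (b i j)\<^sup>2) / \<rho>\<^sup>2))"
      using \<theta>' fR by (subst powr_sum) auto
    finally show ?thesis .
  qed
  have "(\<integral>p. (\<Prod>i\<in>I. \<bar>csin (t * Y i p)\<bar>) \<partial>?PP) \<le> (\<integral>p. (\<Sum>R\<in>Pow I. wt I R * (\<Prod>i\<in>R. e i p)) \<partial>?PP)"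
  proof (rule integral_mono)
    show "integrable ?PP (\<lambda>p. \<Prod>i\<in>I. \<bar>csin (t * Y i p)\<bar>)"
      by (rule PP.integrable_const_bound[where B = 1])
        (use abs_csin_le_1 in \<open>auto simp: abs_prod intro!: prod_le_1\<close>)
    show "integrable ?PP (\<lambda>p. \<Sum>R\<in>Pow I. wt I R * (\<Prod>i\<in>R. e i p))"
      by (intro Bochner_Integration.integrable_sum integrable_mult_right ipe)
    fix p
    have "(\<Prod>i\<in>I. \<bar>csin (t * Y i p)\<bar>) \<le> (\<Prod>i\<in>I. d + (1 - d) * e i p)"
    proof (intro prod_mono conjI abs_ge_zero)
      fix i
      have "d\<^sup>2 / 4 * (t * Y i p)\<^sup>2 / 2 = (\<kappa> * Y i p)\<^sup>2 / 2" by (simp add: \<kappa>_def power2_eq_square)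
      then show "\<bar>csin (t * Y i p)\<bar> \<le> d + (1 - d) * e i p"
        using abs_csin_le_mixture[OF d, of "t * Y i p"] by (simp add: e_def)
    qed
    then show "(\<Prod>i\<in>I. \<bar>csin (t * Y i p)\<bar>) \<le> (\<Sum>R\<in>Pow I. wt I R * (\<Prod>i\<in>R. e i p))"
      by (simp add: prod_mixture_expand[OF fin(1)] wt_def)
  qed
  also have "\<dots> = (\<Sum>R\<in>Pow I. wt I R * (\<integral>p. (\<Prod>i\<in>R. e i p) \<partial>?PP))"
    by (subst Bochner_Integration.integral_sum) (auto intro!: integrable_mult_right ipe)
  also have "\<dots> \<le> (\<Sum>R\<in>Pow I. wt I R * (\<Prod>i\<in>R. \<theta>' powr ((\<Sum>j\<in>J. (b i j)\<^sup>2) / \<rho>\<^sup>2)))"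
    by (intro sum_mono mult_left_mono wt0 inner) auto
  also have "\<dots> = (\<Prod>i\<in>I. d + (1 - d) * \<theta>' powr ((\<Sum>j\<in>J. (b i j)\<^sup>2) / \<rho>\<^sup>2))"
    by (subst prod_mixture_expand[OF fin(1)]) (simp add: wt_def)
  also have "\<dots> \<le> (d + (1 - d) * \<theta>') powr (\<Sum>i\<in>I. (\<Sum>j\<in>J. (b i j)\<^sup>2) / \<rho>\<^sup>2)"
  proof (intro prod_mixture_powr_le d \<theta>' conjI)
    fix i assume i: "i \<in> I"
    show "0 \<le> (\<Sum>j\<in>J. (b i j)\<^sup>2) / \<rho>\<^sup>2" by (simp add: sum_nonneg)
    \<comment> \<open>The row \<open>i\<close> is tested against itself, which gives
      \<open>x\<^sup>2 \<le> \<rho>\<^sup>2 * x\<close> for its squared norm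
      \<open>x\<close>.\<close>
    have "(\<Sum>j\<in>J. (b i j)\<^sup>2)\<^sup>2 \<le> \<rho>\<^sup>2 * (\<Sum>j\<in>J. (b i j)\<^sup>2)"
      using op[of "{i}" J "\<lambda>j. b i j"] i by (simp add: power2_eq_square)
    then show "(\<Sum>j\<in>J. (b i j)\<^sup>2) / \<rho>\<^sup>2 \<le> 1"
      using \<rho> sum_nonneg[of J "\<lambda>j. (b i j)\<^sup>2"]
      by (cases "(\<Sum>j\<in>J. (b i j)\<^sup>2) = 0") (auto simp: power2_eq_square divide_le_eq)
  qed
  finally show ?thesis
    by (simp add: Y_def \<theta>'_def \<theta>_def s_def sum_divide_distrib)
qed

section \<open>Polynomial decay for quadratic forms\<close>

definition quad :: "(nat \<Rightarrow> nat \<Rightarrow> real) \<Rightarrow> nat set \<Rightarrow> (nat \<Rightarrow> real) \<Rightarrow> real"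
  where "quad a A u = (\<Sum>i\<in>A. \<Sum>j\<in>A. a i j * u i * u j)"

definition qchar :: "(nat \<Rightarrow> nat \<Rightarrow> real) \<Rightarrow> nat set \<Rightarrow> real \<Rightarrow> complex"
  where "qchar a A t = (\<integral>u. iexp (t * quad a A u) \<partial>PiM A (\<lambda>_. unif))"

definition op_bound :: "(nat \<Rightarrow> nat \<Rightarrow> real) \<Rightarrow> real \<Rightarrow> bool"
  where "op_bound a \<rho> \<longleftrightarrow> (\<forall>R S y. finite R \<longrightarrow> finite S \<longrightarrow>
    (\<Sum>i\<in>R. (\<Sum>j\<in>S. a i j * y j)\<^sup>2) \<le> \<rho>\<^sup>2 * (\<Sum>j\<in>S. (y j)\<^sup>2))"

lemma quad_measurable [measurable]: "quad a A \<in> borel_measurable (PiM A (\<lambda>_. unif))"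
proof -
  have [measurable]: "(\<lambda>u. u j) \<in> borel_measurable (PiM A (\<lambda>_. unif))" if "j \<in> A" for j
    using that by (auto intro!: measurable_PiM_coord)
  show ?thesis unfolding quad_def[abs_def] by measurable
qed

lemma norm_qchar_le_1: "norm (qchar a A t) \<le> 1"
proof -
  interpret prob_space "PiM A (\<lambda>_. unif)" using prob_space_unif by (intro prob_space_PiM)
  show ?thesis unfolding qchar_def by (rule order.trans[OF integral_norm_bound]) (simp add: prob_space)
qed

text \<open>Greedy choice: each new index goes opposite to the side that carries more of its weight,
  so at least half of the weight of all pairs is cut. The factor is 4 because the left sum counts
  every pair twice and the cut counts it once.\<close>

lemma exists_cut:
  fixes w :: "nat \<Rightarrow> nat \<Rightarrow> real"
  assumes w: "\<And>i j. w i j \<ge> 0" "\<And>i j. w i j = w j i" "\<And>i. w i i = 0"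
  shows "\<exists>I\<subseteq>{..<N}. (\<Sum>i<N. \<Sum>j<N. w i j) \<le> 4 * (\<Sum>i\<in>I. \<Sum>j\<in>{..<N} - I. w i j)"
proof (induction N)
  case 0
  show ?case by (rule exI[of _ "{}"]) simp
next
  case (Suc N)
  then obtain I where I: "I \<subseteq> {..<N}"
    "(\<Sum>i<N. \<Sum>j<N. w i j) \<le> 4 * (\<Sum>i\<in>I. \<Sum>j\<in>{..<N} - I. w i j)" by auto
  define J where "J = {..<N} - I"
  have fin: "finite I" "finite J" "N \<notin> I" "N \<notin> J" using I finite_subset[OF I(1)] by (auto simp: J_def)
  have swapN: "(\<Sum>j\<in>A. w N j) = (\<Sum>j\<in>A. w j N)" for A
    by (rule sum.cong[OF refl w(2)])
  have "(\<Sum>i<Suc N. \<Sum>j<Suc N. w i j) = (\<Sum>i<N. \<Sum>j<N. w i j) + (\<Sum>i<N. w i N) + ((\<Sum>j<N. w N j) + w N N)"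
    by (simp only: sum.lessThan_Suc sum.distrib)
  also have "\<dots> = (\<Sum>i<N. \<Sum>j<N. w i j) + 2 * (\<Sum>i<N. w i N)"
    by (simp only: swapN w(3) mult_2 add_0_right add.assoc)
  finally have tot: "(\<Sum>i<Suc N. \<Sum>j<Suc N. w i j) = (\<Sum>i<N. \<Sum>j<N. w i j) + 2 * (\<Sum>i<N. w i N)" .
  have part: "(\<Sum>i<N. w i N) = (\<Sum>i\<in>I. w i N) + (\<Sum>i\<in>J. w i N)"
    using sum.subset_diff[OF I(1), of "\<lambda>i. w i N"] by (simp add: J_def)
  show ?case
  proof (cases "(\<Sum>i\<in>J. w i N) \<le> (\<Sum>i\<in>I. w i N)")
    case True
    have J': "{..<Suc N} - I = insert N J" using I by (auto simp: J_def)
    have "(\<Sum>i\<in>I. \<Sum>j\<in>{..<Suc N} - I. w i j) = (\<Sum>i\<in>I. \<Sum>j\<in>J. w i j) + (\<Sum>i\<in>I. w i N)"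
      unfolding J' using fin by (simp add: sum.distrib)
    moreover have "(\<Sum>i<N. \<Sum>j<N. w i j) \<le> 4 * (\<Sum>i\<in>I. \<Sum>j\<in>J. w i j)" using I(2) by (simp only: J_def)
    ultimately have "(\<Sum>i<Suc N. \<Sum>j<Suc N. w i j) \<le> 4 * (\<Sum>i\<in>I. \<Sum>j\<in>{..<Suc N} - I. w i j)"
      using True tot part by linarith
    moreover have "I \<subseteq> {..<Suc N}" using I(1) by auto
    ultimately show ?thesis by blast
  next
    case False
    have J': "{..<Suc N} - insert N I = J" using I by (auto simp: J_def)
    have "(\<Sum>i\<in>insert N I. \<Sum>j\<in>J. w i j) = (\<Sum>i\<in>I. \<Sum>j\<in>J. w i j) + (\<Sum>i\<in>J. w i N)"
      using fin by (simp add: swapN)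
    moreover have "(\<Sum>i<N. \<Sum>j<N. w i j) \<le> 4 * (\<Sum>i\<in>I. \<Sum>j\<in>J. w i j)" using I(2) by (simp only: J_def)
    ultimately have "(\<Sum>i<Suc N. \<Sum>j<Suc N. w i j) \<le>
        4 * (\<Sum>i\<in>insert N I. \<Sum>j\<in>{..<Suc N} - insert N I. w i j)"
      unfolding J' using False tot part by linarith
    moreover have "insert N I \<subseteq> {..<Suc N}" using I(1) by auto
    ultimately show ?thesis by blast
  qed
qed

lemma PiM_integral_fold:
  fixes f :: "('i \<Rightarrow> 'a) \<Rightarrow> 'b::{banach, second_countable_topology}"
  assumes "prob_space \<mu>" "I \<inter> J = {}" "finite I" "finite J"
    and "integrable (PiM (I \<union> J) (\<lambda>_. \<mu>)) f"
  shows "(\<integral>u. f u \<partial>PiM (I \<union> J) (\<lambda>_. \<mu>)) =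
    (\<integral>x. (\<integral>y. f (merge I J (x, y)) \<partial>PiM J (\<lambda>_. \<mu>)) \<partial>PiM I (\<lambda>_. \<mu>))"
proof -
  interpret prob_space \<mu> by fact
  interpret product_sigma_finite "\<lambda>_::'i. \<mu>" by standard
  show ?thesis by (rule product_integral_fold[OF assms(2-5)])
qed

text \<open>The terms inside \<open>I\<close> and inside \<open>J\<close> play the roles of
  \<open>\<alpha>\<close> and \<open>\<beta>\<close> in \<open>decoupling\<close>. By symmetry mixed
  terms occur twice, hence \<open>2 * t\<close>; being linear in the variables of \<open>I\<close>,
  they integrate to cardinal sines.\<close>

lemma qchar_decoupled:
  assumes fin: "finite I" "finite J" "I \<inter> J = {}" and sym: "\<And>i j. a i j = a j i"
  shows "(norm (qchar a (I \<union> J) t))\<^sup>2 \<le>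
    (\<integral>p. (\<Prod>i\<in>I. \<bar>csin ((2 * t) * (\<Sum>j\<in>J. a i j * (fst p j - snd p j)))\<bar>)
        \<partial>(PiM J (\<lambda>_. unif) \<Otimes>\<^sub>M PiM J (\<lambda>_. unif)))"
proof -
  let ?I = "PiM I (\<lambda>_. unif)" and ?J = "PiM J (\<lambda>_. unif)" and ?IJ = "PiM (I \<union> J) (\<lambda>_. unif)"
  have pI: "prob_space ?I" and pJ: "prob_space ?J" and pIJ: "prob_space ?IJ"
    using prob_space_unif by (auto intro!: prob_space_PiM)
  have [measurable]: "(\<lambda>u. u i) \<in> borel_measurable ?I" if "i \<in> I" for i
    using that by (auto intro!: measurable_PiM_coord)
  have [measurable]: "(\<lambda>u. u j) \<in> borel_measurable ?J" if "j \<in> J" for j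
    using that by (auto intro!: measurable_PiM_coord)
  define \<gamma> where "\<gamma> q = (2 * t) * (\<Sum>i\<in>I. \<Sum>j\<in>J. a i j * fst q i * snd q j)" for q :: "(nat \<Rightarrow> real) \<times> (nat \<Rightarrow> real)"
  have [measurable]: "\<gamma> \<in> borel_measurable (?I \<Otimes>\<^sub>M ?J)" unfolding \<gamma>_def by measurable
  have q: "t * quad a (I \<union> J) (merge I J (x, y)) = t * quad a I x + t * quad a J y + \<gamma> (x, y)" for x y
  proof -
    have m: "merge I J (x, y) i = x i" if "i \<in> I" for i using that by (simp add: merge_def)
    have m': "merge I J (x, y) j = y j" if "j \<in> J" for j using that fin by (auto simp: merge_def)
    have "quad a (I \<union> J) (merge I J (x, y)) = quad a I x + quad a J y +
       ((\<Sum>i\<in>I. \<Sum>j\<in>J. a i j * x i * y j) + (\<Sum>j\<in>J. \<Sum>i\<in>I. a j i * y j * x i))"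
      unfolding quad_def using fin by (simp add: sum.union_disjoint m m' sum.distrib cong: sum.cong)
    also have "(\<Sum>j\<in>J. \<Sum>i\<in>I. a j i * y j * x i) = (\<Sum>i\<in>I. \<Sum>j\<in>J. a i j * x i * y j)"
      by (subst sum.swap) (intro sum.cong refl, simp add: sym mult_ac)
    finally show ?thesis by (simp add: \<gamma>_def algebra_simps)
  qed
  have "integrable ?IJ (\<lambda>u. iexp (t * quad a (I \<union> J) u))"
    by (rule finite_measure.integrable_const_bound[where B = 1, OF prob_space.finite_measure[OF pIJ]]) auto
  from PiM_integral_fold[OF prob_space_unif fin(3,1,2) this]
  have eq: "qchar a (I \<union> J) t = (\<integral>x. (\<integral>y. iexp (t * quad a I x + t * quad a J y + \<gamma> (x, y)) \<partial>?J) \<partial>?I)"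
    unfolding qchar_def q .
  have "(norm (qchar a (I \<union> J) t))\<^sup>2 \<le> (\<integral>p. norm (\<integral>x. iexp (\<gamma> (x, fst p) - \<gamma> (x, snd p)) \<partial>?I) \<partial>(?J \<Otimes>\<^sub>M ?J))"
    unfolding eq by (rule decoupling[OF pI pJ]) measurable
  also have "\<dots> = (\<integral>p. (\<Prod>i\<in>I. \<bar>csin ((2 * t) * (\<Sum>j\<in>J. a i j * (fst p j - snd p j)))\<bar>) \<partial>(?J \<Otimes>\<^sub>M ?J))"
  proof (intro Bochner_Integration.integral_cong refl)
    fix p :: "(nat \<Rightarrow> real) \<times> (nat \<Rightarrow> real)"
    have diff: "\<gamma> (x, fst p) - \<gamma> (x, snd p) = (\<Sum>i\<in>I. ((2 * t) * (\<Sum>j\<in>J. a i j * (fst p j - snd p j))) * x i)" for x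
    proof -
      have "\<gamma> (x, fst p) - \<gamma> (x, snd p) =
          2 * t * (\<Sum>i\<in>I. \<Sum>j\<in>J. a i j * x i * fst p j - a i j * x i * snd p j)"
        by (simp only: \<gamma>_def fst_conv snd_conv sum_subtractf right_diff_distrib)
      also have "\<dots> = (\<Sum>i\<in>I. ((2 * t) * (\<Sum>j\<in>J. a i j * (fst p j - snd p j))) * x i)"
        unfolding sum_distrib_left sum_distrib_right by (intro sum.cong refl) (simp add: algebra_simps)
      finally show ?thesis .
    qed
    have "(\<integral>x. iexp (\<gamma> (x, fst p) - \<gamma> (x, snd p)) \<partial>?I) =
        complex_of_real (\<Prod>i\<in>I. csin ((2 * t) * (\<Sum>j\<in>J. a i j * (fst p j - snd p j))))"
      unfolding diff by (rule char_PiM[OF prob_space_unif sets_unif char_unif fin(1)])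
    then show "norm (\<integral>x. iexp (\<gamma> (x, fst p) - \<gamma> (x, snd p)) \<partial>?I) =
        (\<Prod>i\<in>I. \<bar>csin ((2 * t) * (\<Sum>j\<in>J. a i j * (fst p j - snd p j)))\<bar>)"
      by (simp only: norm_of_real abs_prod)
  qed
  finally show ?thesis .
qed

text \<open>Origin of the exponent: the cut keeps a quarter of a squared norm that is at least 1/2,
  and since the square of \<open>qchar\<close> is bounded, the resulting
  \<open>1 / (8 * \<rho>\<^sup>2)\<close> is halved.\<close>

lemma qchar_decay:
  assumes sym: "\<And>i j. a i j = a j i" and diag: "\<And>i. a i i = 0" and op: "op_bound a \<rho>" and \<rho>: "\<rho> > 0"
    and h: "(\<Sum>i<N. \<Sum>j<N. (a i j)\<^sup>2) \<ge> 1 / 2" and t: "\<bar>t\<bar> \<ge> 1"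
  shows "norm (qchar a {..<N} t) \<le> ((2 + 2 / \<rho>) * \<bar>t\<bar> powr (- 1 / 4)) powr (1 / (16 * \<rho>\<^sup>2))"
proof -
  define B where "B = (2 + 2 / \<rho>) * \<bar>t\<bar> powr (- 1 / 4)"
  have B0: "B > 0" using \<rho> t by (simp add: B_def add_pos_pos)
  show ?thesis
  proof (cases "B \<ge> 1")
    \<comment> \<open>A base of at least 1 makes the claim trivial. A base below 1 is what permits
      lowering the exponent from \<open>h' / \<rho>\<^sup>2\<close> to its minimal value in the
      other case.\<close>
    case True
    have "norm (qchar a {..<N} t) \<le> 1" by (rule norm_qchar_le_1)
    also have "1 \<le> B powr (1 / (16 * \<rho>\<^sup>2))" using True by (intro ge_one_powr_ge_zero) auto
    finally show ?thesis by (simp only: B_def)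
  next
    case False
    obtain I where I: "I \<subseteq> {..<N}"
      "(\<Sum>i<N. \<Sum>j<N. (a i j)\<^sup>2) \<le> 4 * (\<Sum>i\<in>I. \<Sum>j\<in>{..<N} - I. (a i j)\<^sup>2)"
    proof -
      have "\<exists>I\<subseteq>{..<N}. (\<Sum>i<N. \<Sum>j<N. (a i j)\<^sup>2) \<le> 4 * (\<Sum>i\<in>I. \<Sum>j\<in>{..<N} - I. (a i j)\<^sup>2)"
      proof (rule exists_cut)
        show "(a i j)\<^sup>2 = (a j i)\<^sup>2" for i j by (rule arg_cong[OF sym])
      qed (simp_all add: diag)
      with that show ?thesis by blast
    qed
    define J where "J = {..<N} - I"
    have fin: "finite I" "finite J" "I \<inter> J = {}" "I \<union> J = {..<N}"
      using I finite_subset[OF I(1)] by (auto simp: J_def)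
    define h' where "h' = (\<Sum>i\<in>I. \<Sum>j\<in>J. (a i j)\<^sup>2)"
    have h': "h' \<ge> 1 / 8" using I h by (simp add: h'_def J_def)
    \<comment> \<open>Both \<open>d\<close> and \<open>1 / (t * d\<^sup>2)\<close> have to tend to
      0; here the second is of order \<open>\<bar>t\<bar> powr (- 1 / 2)\<close>. Any power strictly
      between -1/2 and 0 would give some polynomial decay.\<close>
    define d where "d = \<bar>t\<bar> powr (- 1 / 4)"
    have t0: "t \<noteq> 0" using t by auto
    have d: "0 < d" "d \<le> 1" using t t0 powr_mono[of "- 1 / 4" 0 "\<bar>t\<bar>"] by (auto simp: d_def)
    define \<theta> where "\<theta> = (1 + ((2 * t) * d\<^sup>2 / 4)\<^sup>2 * \<rho>\<^sup>2) powr (- 1 / 2)"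
    have d4: "d\<^sup>2 * d\<^sup>2 = 1 / \<bar>t\<bar>"
      using t by (simp add: d_def power2_eq_square powr_add[symmetric] powr_minus_divide)
    have "\<theta> \<le> ((\<rho> / 2 * \<bar>t\<bar> powr (1 / 2))\<^sup>2) powr (- 1 / 2)"
      unfolding \<theta>_def
    proof (intro powr_mono2')
      have "((2 * t) * d\<^sup>2 / 4)\<^sup>2 * \<rho>\<^sup>2 = t\<^sup>2 * (d\<^sup>2 * d\<^sup>2) * \<rho>\<^sup>2 / 4" by (simp add: power2_eq_square)
      also have "\<dots> = \<bar>t\<bar> * \<rho>\<^sup>2 / 4" using t unfolding d4 by (simp add: power2_eq_square field_simps abs_if split: if_splits)
      also have "\<dots> = (\<rho> / 2 * \<bar>t\<bar> powr (1 / 2))\<^sup>2" using t by (simp add: power_mult_distrib powr_half_sqrt power_divide)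
      finally show "(\<rho> / 2 * \<bar>t\<bar> powr (1 / 2))\<^sup>2 \<le> 1 + ((2 * t) * d\<^sup>2 / 4)\<^sup>2 * \<rho>\<^sup>2" by simp
      show "0 < (\<rho> / 2 * \<bar>t\<bar> powr (1 / 2))\<^sup>2" using \<rho> t by auto
    qed simp
    also have "\<dots> = 2 / \<rho> * \<bar>t\<bar> powr (- 1 / 2)"
    proof -
      define c where "c = \<rho> / 2 * \<bar>t\<bar> powr (1 / 2)"
      have "c > 0" using \<rho> t0 by (simp add: c_def)
      then have "(c\<^sup>2) powr - (1 / 2) = 1 / c" by (simp add: powr_minus_divide powr_half_sqrt)
      also have "\<dots> = 2 / \<rho> * \<bar>t\<bar> powr - (1 / 2)" using \<rho> by (simp add: c_def powr_minus_divide)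
      finally show ?thesis by (simp add: c_def)
    qed
    also have "\<dots> \<le> 2 / \<rho> * \<bar>t\<bar> powr (- 1 / 4)"
      using \<rho> t by (intro mult_left_mono powr_mono) auto
    finally have \<theta>: "\<theta> \<le> 2 / \<rho> * d" by (simp add: d_def)
    have \<theta>0: "\<theta> \<ge> 0" by (simp add: \<theta>_def)
    \<comment> \<open>The base after deletion of columns and rows; it is at most
      \<open>2 * d + \<theta>\<close>, where both contributions are multiples of
      \<open>d\<close>.\<close>
    define m where "m = d + (1 - d) * (d + (1 - d) * \<theta>)"
    have m0: "m > 0" using d \<theta>0 by (simp add: m_def add_pos_nonneg)
    have "(1 - d) * \<theta> \<le> 1 * \<theta>" using d \<theta>0 by (intro mult_right_mono) auto
    moreover have "(1 - d) * (d + (1 - d) * \<theta>) \<le> 1 * (d + (1 - d) * \<theta>)"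
      using d \<theta>0 by (intro mult_right_mono) auto
    ultimately have "m \<le> d + (d + \<theta>)" by (simp add: m_def)
    also have "\<dots> \<le> B" using \<theta> unfolding B_def d_def[symmetric] by (simp add: distrib_right)
    finally have mB: "m \<le> B" .
    have "(norm (qchar a {..<N} t))\<^sup>2 \<le> m powr (h' / \<rho>\<^sup>2)"
      unfolding fin(4)[symmetric] h'_def m_def \<theta>_def
    proof (rule order.trans[OF qchar_decoupled[OF fin(1-3) sym] decoupled_bound[OF fin(1,2) d \<rho>]])
      show "(\<Sum>i\<in>R. (\<Sum>j\<in>S. a i j * y j)\<^sup>2) \<le> \<rho>\<^sup>2 * (\<Sum>j\<in>S. (y j)\<^sup>2)" if "R \<subseteq> I" "S \<subseteq> J" for R S y
        using op[unfolded op_bound_def, rule_format, OF finite_subset[OF that(1) fin(1)] finite_subset[OF that(2) fin(2)]] .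
    qed
    also have "\<dots> \<le> B powr (h' / \<rho>\<^sup>2)" using m0 mB h' \<rho> by (intro powr_mono2) auto
    also have "\<dots> \<le> B powr (2 * (1 / (16 * \<rho>\<^sup>2)))"
      using False B0 h' \<rho> by (intro powr_mono') (auto simp: field_simps)
    also have "\<dots> = (B powr (1 / (16 * \<rho>\<^sup>2)))\<^sup>2"
      using B0 by (simp add: power2_eq_square powr_add[symmetric])
    finally show ?thesis
      unfolding B_def[symmetric] by (rule power2_le_imp_le) simp
  qed
qed

section \<open>Integration by parts for the uniform law\<close>

definition lin_row :: "(nat \<Rightarrow> nat \<Rightarrow> real) \<Rightarrow> nat set \<Rightarrow> nat \<Rightarrow> (nat \<Rightarrow> real) \<Rightarrow> real"
  where "lin_row a A i u = (\<Sum>j\<in>A. a i j * u j)"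

text \<open>Polynomials in the coordinates are bounded only on the cube, which has full measure.
  Asking for a bound there alone yields a class of integrable functions closed under sums and
  products.\<close>

definition tame :: "nat set \<Rightarrow> ((nat \<Rightarrow> real) \<Rightarrow> complex) \<Rightarrow> bool"
  where "tame A F \<longleftrightarrow> F \<in> borel_measurable (PiM A (\<lambda>_. unif)) \<and>
    (\<exists>C. \<forall>u. (\<forall>i\<in>A. \<bar>u i\<bar> \<le> 1) \<longrightarrow> norm (F u) \<le> C)"

lemma AE_cube:
  assumes "finite A"
  shows "AE u in PiM A (\<lambda>_. unif). \<forall>i\<in>A. \<bar>u i\<bar> \<le> 1"
  unfolding AE_finite_all[OF assms]
proof
  fix i assume "i \<in> A"
  have "AE x in unif. \<bar>x\<bar> \<le> 1" by (rule AE_uniform_measureI) auto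
  then show "AE u in PiM A (\<lambda>_. unif). \<bar>u i\<bar> \<le> 1"
    by (rule AE_PiM_component[OF prob_space_unif \<open>i \<in> A\<close>])
qed

lemma tame_integrable:
  assumes "finite A" "tame A F"
  shows "integrable (PiM A (\<lambda>_. unif)) F"
proof -
  interpret prob_space "PiM A (\<lambda>_. unif)" using prob_space_unif by (intro prob_space_PiM)
  obtain C where C: "\<And>u. (\<forall>i\<in>A. \<bar>u i\<bar> \<le> 1) \<Longrightarrow> norm (F u) \<le> C"
    using assms(2) unfolding tame_def by blast
  have "AE u in PiM A (\<lambda>_. unif). norm (F u) \<le> C"
    using AE_cube[OF assms(1)] by eventually_elim (rule C)
  then show ?thesis using assms(2) by (intro integrable_const_bound) (auto simp: tame_def)
qed

lemma tame_const: "tame A (\<lambda>_. c)"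
  by (auto simp: tame_def)

lemma tame_coord: "i \<in> A \<Longrightarrow> tame A (\<lambda>u. complex_of_real (u i))"
  by (auto simp: tame_def intro!: borel_measurable_of_real measurable_PiM_coord)

lemma tame_add:
  assumes "tame A F" "tame A G"
  shows "tame A (\<lambda>u. F u + G u)"
proof -
  obtain C D where "\<And>u. (\<forall>i\<in>A. \<bar>u i\<bar> \<le> 1) \<Longrightarrow> norm (F u) \<le> C"
      "\<And>u. (\<forall>i\<in>A. \<bar>u i\<bar> \<le> 1) \<Longrightarrow> norm (G u) \<le> D"
    using assms unfolding tame_def by blast
  then have "\<forall>u. (\<forall>i\<in>A. \<bar>u i\<bar> \<le> 1) \<longrightarrow> norm (F u + G u) \<le> C + D"
    by (auto intro!: norm_triangle_mono)
  then show ?thesis using assms unfolding tame_def by auto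
qed

lemma tame_mult:
  assumes "tame A F" "tame A G"
  shows "tame A (\<lambda>u. F u * G u)"
proof -
  obtain C D where CD: "\<And>u. (\<forall>i\<in>A. \<bar>u i\<bar> \<le> 1) \<Longrightarrow> norm (F u) \<le> C"
      "\<And>u. (\<forall>i\<in>A. \<bar>u i\<bar> \<le> 1) \<Longrightarrow> norm (G u) \<le> D"
    using assms unfolding tame_def by blast
  then have "norm (F u * G u) \<le> C * D" if "\<forall>i\<in>A. \<bar>u i\<bar> \<le> 1" for u
    using order.trans[OF norm_ge_zero CD(1)[OF that]] that
    unfolding norm_mult by (intro mult_mono CD) auto
  then have "\<exists>C. \<forall>u. (\<forall>i\<in>A. \<bar>u i\<bar> \<le> 1) \<longrightarrow> norm (F u * G u) \<le> C" by blast
  then show ?thesis using assms unfolding tame_def by auto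
qed

lemma tame_uminus: "tame A F \<Longrightarrow> tame A (\<lambda>u. - F u)"
  using tame_mult[OF tame_const[of A "-1"]] by simp

lemma tame_diff: "tame A F \<Longrightarrow> tame A G \<Longrightarrow> tame A (\<lambda>u. F u - G u)"
  using tame_add[OF _ tame_uminus] by simp

lemma tame_sum: "(\<And>i. i \<in> I \<Longrightarrow> tame A (F i)) \<Longrightarrow> tame A (\<lambda>u. \<Sum>i\<in>I. F i u)"
  by (induction I rule: infinite_finite_induct) (auto intro!: tame_add tame_const)

lemma tame_power: "tame A F \<Longrightarrow> tame A (\<lambda>u. F u ^ n)"
  by (induction n) (auto intro!: tame_mult tame_const)

lemma tame_row: "tame A (\<lambda>u. complex_of_real (lin_row a A i u))"
  unfolding lin_row_def of_real_sum of_real_mult by (intro tame_sum tame_mult tame_const tame_coord)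

lemma tame_iexp: "f \<in> borel_measurable (PiM A (\<lambda>_. unif)) \<Longrightarrow> tame A (\<lambda>u. iexp (f u))"
  unfolding tame_def by (auto intro!: exI[of _ 1])

lemmas tame_intros = tame_const tame_coord tame_add tame_mult tame_diff tame_uminus tame_sum tame_power
  tame_row

text \<open>\<open>- k\<close> is a primitive of \<open>v\<close> that vanishes at both end points,
  so there are no boundary terms; such a primitive exists when \<open>v\<close> has mean 0. The
  pairs in use are \<open>v = x\<close>, \<open>k = (1 - x^2) / 2\<close> and
  \<open>v = 1/3 - x^2\<close>, \<open>k = (x^3 - x) / 3\<close>.\<close>

lemma unif_stein:
  fixes H H' :: "real \<Rightarrow> complex" and k v :: "real \<Rightarrow> real"
  assumes k: "\<And>y. (k has_real_derivative - v y) (at y)" "k 1 = 0" "k (-1) = 0"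
    and v: "\<And>y. isCont v y"
    and H: "\<And>y. (H has_vector_derivative H' y) (at y)" and H': "\<And>y. isCont H' y"
  shows "(\<integral>y. of_real (v y) * H y \<partial>unif) = (\<integral>y. of_real (k y) * H' y \<partial>unif)"
proof -
  have ck: "isCont k y" for y using k(1) DERIV_isCont by blast
  have cH: "isCont H y" for y using H has_vector_derivative_continuous by blast
  have co: "continuous_on UNIV k" "continuous_on UNIV v" "continuous_on UNIV H" "continuous_on UNIV H'"
    using ck cH v H' by (auto intro: continuous_at_imp_continuous_on)
  have [measurable]: "k \<in> borel_measurable borel" "v \<in> borel_measurable borel"
      "H \<in> borel_measurable borel" "H' \<in> borel_measurable borel"
    using co by (auto intro: borel_measurable_continuous_onI)
  have int: "integrable lborel (\<lambda>y. indicator {-1..1} y *\<^sub>R f y)" if "continuous_on UNIV f" for f :: "real \<Rightarrow> complex"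
    using borel_integrable_compact[of "{-1..1}" f] continuous_on_subset[OF that] by simp
  have "(\<integral>y. indicator {-1..1} y *\<^sub>R (of_real (k y) * H' y - of_real (v y) * H y) \<partial>lborel)
      = of_real (k 1) * H 1 - of_real (k (-1)) * H (-1)"
  proof (rule integral_FTC_Icc)
    fix y :: real
    have "((\<lambda>y. of_real (k y) * H y) has_vector_derivative of_real (k y) * H' y + of_real (- v y) * H y) (at y)"
      by (intro has_vector_derivative_mult has_vector_derivative_of_real H)
        (simp add: k(1) flip: has_real_derivative_iff_has_vector_derivative)
    then show "((\<lambda>y. of_real (k y) * H y) has_vector_derivative of_real (k y) * H' y - of_real (v y) * H y)
        (at y within {-1..1})"
      by (auto intro: has_vector_derivative_at_within)
  next
    show "continuous_on {-1..1} (\<lambda>y. of_real (k y) * H' y - of_real (v y) * H y)"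
      using co by (auto intro!: continuous_intros intro: continuous_on_subset)
  qed simp
  also have "\<dots> = 0" by (simp add: k)
  finally have "(\<integral>y. indicator {-1..1} y *\<^sub>R (of_real (k y) * H' y) - indicator {-1..1} y *\<^sub>R (of_real (v y) * H y) \<partial>lborel) = 0"
    by (simp add: scaleR_diff_right)
  then have "(\<integral>y. indicator {-1..1} y *\<^sub>R (of_real (k y) * H' y) \<partial>lborel) = (\<integral>y. indicator {-1..1} y *\<^sub>R (of_real (v y) * H y) \<partial>lborel)"
    using co by (subst (asm) Bochner_Integration.integral_diff) (auto intro!: int continuous_intros)
  then show ?thesis by (simp add: integral_unif)
qed

lemma upd_deriv:
  "((\<lambda>x. (u(j := x)) i) has_real_derivative (if i = j then 1 else 0)) (at x)"
  by (auto intro!: derivative_eq_intros)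

lemma row_deriv:
  assumes "finite A" "j \<in> A"
  shows "((\<lambda>x. lin_row a A i (u(j := x))) has_real_derivative a i j) (at x)"
proof -
  have "((\<lambda>x. lin_row a A i (u(j := x))) has_real_derivative (\<Sum>k\<in>A. a i k * (if k = j then 1 else 0))) (at x)"
    unfolding lin_row_def by (intro DERIV_sum DERIV_cmult upd_deriv)
  then show ?thesis using assms by (simp add: if_distrib sum.delta cong: if_cong)
qed

lemma quad_row: "quad a A u = (\<Sum>i\<in>A. u i * lin_row a A i u)"
  unfolding quad_def lin_row_def sum_distrib_left by (intro sum.cong refl) simp

lemma quad_deriv:
  assumes A: "finite A" "j \<in> A" and sym: "\<And>i k. a i k = a k i"
  shows "((\<lambda>x. quad a A (u(j := x))) has_real_derivative 2 * lin_row a A j (u(j := x))) (at x)"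
proof -
  have "((\<lambda>x. quad a A (u(j := x))) has_real_derivative
      (\<Sum>i\<in>A. (if i = j then 1 else 0) * lin_row a A i (u(j := x)) + a i j * (u(j := x)) i)) (at x)"
    unfolding quad_row by (intro DERIV_sum DERIV_mult upd_deriv row_deriv A)
  also have "(\<Sum>i\<in>A. (if i = j then 1 else 0) * lin_row a A i (u(j := x)) + a i j * (u(j := x)) i)
      = lin_row a A j (u(j := x)) + (\<Sum>i\<in>A. a i j * (u(j := x)) i)"
    using A by (simp add: sum.distrib if_distrib[of "\<lambda>c. c * _"] sum.delta cong: if_cong)
  also have "(\<Sum>i\<in>A. a i j * (u(j := x)) i) = lin_row a A j (u(j := x))"
    unfolding lin_row_def by (intro sum.cong refl arg_cong2[where f = "(*)"] sym)
  finally show ?thesis by (simp only: mult_2)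
qed

text \<open>The product rule in the coordinate \<open>u j\<close>; the derivative of
  \<open>quad\<close> is twice a row by symmetry. At \<open>n = 0\<close> the truncated
  \<open>n - 1\<close> is harmless, as its factor \<open>of_nat n\<close> is 0.\<close>

lemma unif_ibp:
  fixes k v :: "real \<Rightarrow> real"
  assumes A: "finite A" "j \<in> A" and sym: "\<And>i l. a i l = a l i"
    and k: "\<And>y. (k has_real_derivative - v y) (at y)" "k 1 = 0" "k (-1) = 0"
    and v: "\<And>y. isCont v y"
    and tv: "tame A (\<lambda>u. of_real (v (u j)))" and tk: "tame A (\<lambda>u. of_real (k (u j)))"
  shows "(\<integral>u. of_real (v (u j)) * (of_real (lin_row a A i u) ^ n * iexp (t * quad a A u)) \<partial>PiM A (\<lambda>_. unif)) =
    (\<integral>u. of_real (k (u j)) * ((of_nat n * of_real (lin_row a A i u) ^ (n - 1) * of_real (a i j)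
        + 2 * \<i> * t * of_real (lin_row a A i u) ^ n * of_real (lin_row a A j u)) * iexp (t * quad a A u)) \<partial>PiM A (\<lambda>_. unif))"
    (is "(\<integral>u. ?F u \<partial>_) = (\<integral>u. ?G u \<partial>_)")
proof (rule PiM_integral_coord_eq[OF prob_space_unif A])
  have te: "tame A (\<lambda>u. iexp (t * quad a A u))" by (intro tame_iexp) measurable
  show "integrable (PiM A (\<lambda>_. unif)) ?F"
    by (intro tame_integrable A tame_intros tv te)
  show "integrable (PiM A (\<lambda>_. unif)) ?G"
    by (intro tame_integrable A tame_intros tk te)
  fix u :: "nat \<Rightarrow> real"
  define R where "R l x = lin_row a A l (u(j := x))" for l x
  define q where "q x = quad a A (u(j := x))" for x
  have dR: "(R l has_real_derivative a l j) (at x)" for l x unfolding R_def by (rule row_deriv[OF A])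
  have dq: "(q has_real_derivative 2 * R j x) (at x)" for x unfolding R_def q_def by (rule quad_deriv[OF A sym])
  have cR: "isCont (R l) x" for l x using dR DERIV_isCont by blast
  have cq: "isCont q x" for x using dq DERIV_isCont by blast
  have de: "((\<lambda>x. iexp (t * q x)) has_vector_derivative (2 * \<i> * t * of_real (R j x)) * iexp (t * q x)) (at x)" for x
  proof -
    have 1: "((\<lambda>x. \<i> * complex_of_real (t * q x)) has_vector_derivative \<i> * complex_of_real (t * (2 * R j x))) (at x)"
      using DERIV_cmult[OF dq, of t x]
      by (intro has_vector_derivative_mult_right has_vector_derivative_of_real)
        (simp add: has_real_derivative_iff_has_vector_derivative)
    from field_vector_diff_chain_at[OF 1 DERIV_exp] show ?thesis
      by (simp add: o_def mult_ac)
  qed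
  have dp: "((\<lambda>x. complex_of_real (R i x) ^ n) has_vector_derivative of_nat n * of_real (R i x) ^ (n - 1) * of_real (a i j)) (at x)" for x
    unfolding of_real_power[symmetric]
    using DERIV_power[OF dR[of i x], of n]
    by (intro has_vector_derivative_eq_rhs[OF has_vector_derivative_of_real])
      (auto simp: has_real_derivative_iff_has_vector_derivative)
  show "(\<integral>x. ?F (u(j := x)) \<partial>unif) = (\<integral>x. ?G (u(j := x)) \<partial>unif)"
    using unif_stein[OF k v, of "\<lambda>x. of_real (R i x) ^ n * iexp (t * q x)"
      "\<lambda>x. (of_nat n * of_real (R i x) ^ (n - 1) * of_real (a i j)
        + 2 * \<i> * t * of_real (R i x) ^ n * of_real (R j x)) * iexp (t * q x)"]
  proof (simp add: R_def[symmetric] q_def[symmetric], goal_cases)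
    case 1
    show ?case
    proof (rule 1)
      show "((\<lambda>x. complex_of_real (R i x) ^ n * exp (\<i> * (complex_of_real t * complex_of_real (q x)))) has_vector_derivative
          (of_nat n * complex_of_real (R i y) ^ (n - Suc 0) * complex_of_real (a i j) +
           2 * \<i> * complex_of_real t * complex_of_real (R i y) ^ n * complex_of_real (R j y)) *
          exp (\<i> * (complex_of_real t * complex_of_real (q y)))) (at y)" for y
        using has_vector_derivative_mult[OF dp de, of y] by (simp add: algebra_simps)
      show "isCont (\<lambda>y. (of_nat n * complex_of_real (R i y) ^ (n - Suc 0) * complex_of_real (a i j) +
           2 * \<i> * complex_of_real t * complex_of_real (R i y) ^ n * complex_of_real (R j y)) *
          exp (\<i> * (complex_of_real t * complex_of_real (q y)))) y" for y
        by (intro continuous_intros cR cq)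
    qed
  qed
qed

lemma tame_integrable_real:
  "finite A \<Longrightarrow> tame A (\<lambda>u. complex_of_real (f u)) \<Longrightarrow> integrable (PiM A (\<lambda>_. unif)) f"
  using tame_integrable[of A "\<lambda>u. complex_of_real (f u)"] by (simp add: complex_of_real_integrable_eq)

lemma norm_integral_le_AE:
  fixes f :: "'a \<Rightarrow> 'b::{banach, second_countable_topology}"
  assumes "integrable M f" "integrable M g" "AE x in M. norm (f x) \<le> g x"
  shows "norm (\<integral>x. f x \<partial>M) \<le> (\<integral>x. g x \<partial>M)"
  using assms by (intro order.trans[OF integral_norm_bound integral_mono_AE]) auto

lemma integral_sum_sum_mult:
  fixes f :: "'i \<Rightarrow> 'j \<Rightarrow> 'a \<Rightarrow> complex"
  assumes "\<And>i j. i \<in> A \<Longrightarrow> j \<in> B \<Longrightarrow> integrable M (f i j)"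
  shows "(\<integral>u. (\<Sum>i\<in>A. \<Sum>j\<in>B. c i j * f i j u) \<partial>M) = (\<Sum>i\<in>A. \<Sum>j\<in>B. c i j * (\<integral>u. f i j u \<partial>M))"
proof -
  have int: "integrable M (\<lambda>u. c i j * f i j u)" if "i \<in> A" "j \<in> B" for i j
    by (intro integrable_mult_right assms that)
  have "(\<integral>u. (\<Sum>i\<in>A. \<Sum>j\<in>B. c i j * f i j u) \<partial>M) = (\<Sum>i\<in>A. \<integral>u. (\<Sum>j\<in>B. c i j * f i j u) \<partial>M)"
    by (intro Bochner_Integration.integral_sum Bochner_Integration.integrable_sum int)
  also have "\<dots> = (\<Sum>i\<in>A. \<Sum>j\<in>B. \<integral>u. c i j * f i j u \<partial>M)"
    by (intro sum.cong refl Bochner_Integration.integral_sum int)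
  finally show ?thesis by (simp only: integral_mult_right_zero)
qed

section \<open>Gaussian approximation\<close>

locale zero_diagonal_form =
  fixes a :: "nat \<Rightarrow> nat \<Rightarrow> real" and A :: "nat set" and \<rho> :: real
  assumes fin: "finite A" and sym: "\<And>i j. a i j = a j i" and diag: "\<And>i. a i i = 0"
    and op: "op_bound a \<rho>" and \<rho>: "\<rho> > 0"
begin

abbreviation "P \<equiv> PiM A (\<lambda>_. unif)"
abbreviation "Y \<equiv> lin_row a A"
definition "r i = (\<Sum>j\<in>A. (a i j)\<^sup>2)"
definition "h = (\<Sum>i\<in>A. r i)"
definition "e t u = iexp (t * quad a A u)"

sublocale P: prob_space P
  using prob_space_unif by (intro prob_space_PiM)

lemma r_nonneg: "r i \<ge> 0" by (simp add: r_def sum_nonneg)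

lemma r_le: "i \<in> A \<Longrightarrow> r i \<le> \<rho>\<^sup>2"
  using op[unfolded op_bound_def, rule_format, of A "{i}" "\<lambda>_. 1"] fin sym[of i]
  by (simp add: r_def)

lemma tame_e: "tame A (e t)"
  unfolding e_def by (intro tame_iexp) measurable

lemma norm_e [simp]: "norm (e t u) = 1"
  by (simp add: e_def)

lemma tame_of_real_Y: "tame A (\<lambda>u. complex_of_real (Y i u ^ n))"
  unfolding of_real_power by (intro tame_intros)

lemma integrable_Y: "integrable P (\<lambda>u. Y i u ^ n)"
  by (rule tame_integrable_real[OF fin tame_of_real_Y])

lemma integrable_abs_Y: "integrable P (\<lambda>u. \<bar>Y i u\<bar> ^ n)"
  using integrable_Y[of i n] by (simp flip: power_abs add: integrable_abs)

lemma ibp: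
  assumes "j \<in> A"
  shows "(\<integral>u. of_real (u j) * (of_real (Y i u) ^ n * e t u) \<partial>P) =
    (\<integral>u. of_real ((1 - (u j)\<^sup>2) / 2) * ((of_nat n * of_real (Y i u) ^ (n - 1) * of_real (a i j)
        + 2 * \<i> * t * of_real (Y i u) ^ n * of_real (Y j u)) * e t u) \<partial>P)"
  unfolding e_def
proof (rule unif_ibp[OF fin assms sym, where k = "\<lambda>x. (1 - x\<^sup>2) / 2" and v = "\<lambda>x. x"])
  show "((\<lambda>x. (1 - x\<^sup>2) / 2) has_real_derivative - y) (at y)" for y :: real
    by (auto intro!: derivative_eq_intros)
  show "tame A (\<lambda>u. complex_of_real ((1 - (u j)\<^sup>2) / 2))"
    using assms unfolding divide_inverse of_real_mult of_real_diff of_real_power by (intro tame_intros)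
qed (use assms in \<open>auto intro: tame_coord\<close>)

text \<open>The weight is centred, and its primitive \<open>k\<close> is at most 1/3 in size on the
  cube. As \<open>a j j = 0\<close>, the form \<open>Y j\<close> does not depend on
  \<open>u j\<close>, so the derivative falls on the exponential alone and brings the factor
  \<open>2 * t * Y j\<close>.\<close>

lemma ibp_centered:
  assumes "j \<in> A"
  shows "norm (\<integral>u. of_real (1 / 3 - (u j)\<^sup>2) * (of_real (Y j u) ^ n * e t u) \<partial>P)
    \<le> 2 / 3 * \<bar>t\<bar> * (\<integral>u. \<bar>Y j u\<bar> ^ (n + 1) \<partial>P)"
proof -
  define k :: "real \<Rightarrow> real" where "k x = (x ^ 3 - x) / 3" for x
  have tk: "tame A (\<lambda>u. complex_of_real (k (u j)))"
    using assms unfolding k_def divide_inverse of_real_mult of_real_diff of_real_power by (intro tame_intros)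
  have eq: "(\<integral>u. of_real (1 / 3 - (u j)\<^sup>2) * (of_real (Y j u) ^ n * e t u) \<partial>P) =
      (\<integral>u. of_real (k (u j)) * ((of_nat n * of_real (Y j u) ^ (n - 1) * of_real (a j j)
        + 2 * \<i> * t * of_real (Y j u) ^ n * of_real (Y j u)) * e t u) \<partial>P)"
    unfolding e_def
  proof (rule unif_ibp[OF fin assms sym])
    show "(k has_real_derivative - (1 / 3 - y\<^sup>2)) (at y)" for y
    proof -
      have "((\<lambda>x. (x ^ 3 - x) / 3) has_real_derivative (3 * y\<^sup>2 - 1) / 3) (at y)"
        by (auto intro!: derivative_eq_intros)
      then show ?thesis by (simp add: k_def[abs_def] diff_divide_distrib)
    qed
    show "tame A (\<lambda>u. complex_of_real (1 / 3 - (u j)\<^sup>2))"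
      using assms unfolding of_real_diff of_real_power by (intro tame_intros)
    show "k 1 = 0" "k (-1) = 0" by (simp_all add: k_def)
    show "isCont (\<lambda>x. 1 / 3 - x\<^sup>2) y" for y :: real by (intro continuous_intros)
    show "tame A (\<lambda>u. complex_of_real (k (u j)))" by (rule tk)
  qed
  have "norm (\<integral>u. of_real (1 / 3 - (u j)\<^sup>2) * (of_real (Y j u) ^ n * e t u) \<partial>P)
      \<le> (\<integral>u. 2 / 3 * \<bar>t\<bar> * \<bar>Y j u\<bar> ^ (n + 1) \<partial>P)"
    unfolding eq
  proof (rule norm_integral_le_AE)
    show "integrable P (\<lambda>u. 2 / 3 * \<bar>t\<bar> * \<bar>Y j u\<bar> ^ (n + 1))"
      by (intro integrable_mult_right integrable_abs_Y)
    show "integrable P (\<lambda>u. of_real (k (u j)) * ((of_nat n * of_real (Y j u) ^ (n - 1) * of_real (a j j)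
        + 2 * \<i> * t * of_real (Y j u) ^ n * of_real (Y j u)) * e t u))"
      by (intro tame_integrable fin tame_intros tk tame_e)
    have k13: "\<bar>k x\<bar> \<le> 1 / 3" if "\<bar>x\<bar> \<le> 1" for x
    proof -
      have "x\<^sup>2 \<le> 1" using that by (simp add: abs_square_le_1)
      then have "\<bar>x\<^sup>2 - 1\<bar> \<le> 1" using zero_le_power2[of x] by linarith
      then have le: "\<bar>x\<bar> * \<bar>x\<^sup>2 - 1\<bar> \<le> 1 * 1"
        using that by (intro mult_mono) auto
      have "k x = x * (x\<^sup>2 - 1) / 3" unfolding k_def by (simp add: power2_eq_square power3_eq_cube right_diff_distrib)
      then have "\<bar>k x\<bar> = \<bar>x\<bar> * \<bar>x\<^sup>2 - 1\<bar> / 3" by (simp only: abs_mult abs_divide abs_numeral)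
      then show ?thesis using le by linarith
    qed
    show "AE u in P. norm (of_real (k (u j)) * ((of_nat n * of_real (Y j u) ^ (n - 1) * of_real (a j j)
        + 2 * \<i> * t * of_real (Y j u) ^ n * of_real (Y j u)) * e t u)) \<le> 2 / 3 * \<bar>t\<bar> * \<bar>Y j u\<bar> ^ (n + 1)"
      using AE_cube[OF fin]
    proof eventually_elim
      case (elim u)
      have "\<bar>k (u j)\<bar> * (2 * \<bar>t\<bar> * \<bar>Y j u\<bar> ^ (n + 1)) \<le> 1 / 3 * (2 * \<bar>t\<bar> * \<bar>Y j u\<bar> ^ (n + 1))"
        using elim assms k13 by (intro mult_right_mono) auto
      moreover have "norm (of_real (k (u j)) * ((of_nat n * of_real (Y j u) ^ (n - 1) * of_real (a j j)
          + 2 * \<i> * t * of_real (Y j u) ^ n * of_real (Y j u)) * e t u))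
          = \<bar>k (u j)\<bar> * (2 * \<bar>t\<bar> * \<bar>Y j u\<bar> ^ (n + 1))"
        by (simp add: diag norm_mult norm_power)
      ultimately show ?case by linarith
    qed
  qed
  then show ?thesis by simp
qed

section \<open>Moments of the linear forms\<close>

lemma ibp_real:
  assumes "j \<in> A"
  shows "(\<integral>u. u j * Y i u ^ n \<partial>P) = (\<integral>u. (1 - (u j)\<^sup>2) / 2 * (n * Y i u ^ (n - 1) * a i j) \<partial>P)"
proof -
  have "complex_of_real (\<integral>u. u j * Y i u ^ n \<partial>P) = (\<integral>u. of_real (u j) * (of_real (Y i u) ^ n * e 0 u) \<partial>P)"
    unfolding integral_complex_of_real[symmetric] by (simp add: e_def)
  also have "\<dots> = complex_of_real (\<integral>u. (1 - (u j)\<^sup>2) / 2 * (n * Y i u ^ (n - 1) * a i j) \<partial>P)"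
    unfolding ibp[OF assms] integral_complex_of_real[symmetric] by (simp add: e_def)
  finally show ?thesis by (simp only: of_real_eq_iff)
qed

text \<open>One factor \<open>Y i u\<close> is written as a combination of the \<open>u j\<close>
  and integrated by parts at frequency 0; the power drops by two and the entries get
  squared.\<close>

lemma moment_step:
  "(\<integral>u. Y i u ^ Suc n \<partial>P) = (\<Sum>j\<in>A. (a i j)\<^sup>2 * (\<integral>u. (1 - (u j)\<^sup>2) / 2 * (n * Y i u ^ (n - 1)) \<partial>P))"
proof -
  have int: "integrable P (\<lambda>u. u j * Y i u ^ n)" if "j \<in> A" for j
    using that by (intro tame_integrable_real fin) (simp only: of_real_mult, intro tame_intros tame_of_real_Y)
  have "(\<integral>u. Y i u ^ Suc n \<partial>P) = (\<integral>u. (\<Sum>j\<in>A. a i j * (u j * Y i u ^ n)) \<partial>P)"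
    by (simp add: lin_row_def[of a A i] sum_distrib_right mult_ac)
  also have "\<dots> = (\<Sum>j\<in>A. a i j * (\<integral>u. u j * Y i u ^ n \<partial>P))"
    using int by (subst Bochner_Integration.integral_sum) auto
  also have "\<dots> = (\<Sum>j\<in>A. (a i j)\<^sup>2 * (\<integral>u. (1 - (u j)\<^sup>2) / 2 * (n * Y i u ^ (n - 1)) \<partial>P))"
  proof (intro sum.cong refl)
    fix j assume "j \<in> A"
    have "(\<integral>u. (1 - (u j)\<^sup>2) / 2 * (n * Y i u ^ (n - 1) * a i j) \<partial>P) =
        (\<integral>u. a i j * ((1 - (u j)\<^sup>2) / 2 * (n * Y i u ^ (n - 1))) \<partial>P)"
      by (simp add: mult_ac)
    then show "a i j * (\<integral>u. u j * Y i u ^ n \<partial>P) = (a i j)\<^sup>2 * (\<integral>u. (1 - (u j)\<^sup>2) / 2 * (n * Y i u ^ (n - 1)) \<partial>P)"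
      unfolding ibp_real[OF \<open>j \<in> A\<close>] by (simp add: power2_eq_square)
  qed
  finally show ?thesis .
qed

text \<open>On the cube the weight lies between 0 and 1/2.\<close>

lemma weight_le:
  assumes "j \<in> A" and int: "integrable P f" and f: "\<And>u. f u \<ge> 0"
  shows "(\<integral>u. (1 - (u j)\<^sup>2) / 2 * f u \<partial>P) \<le> (\<integral>u. f u \<partial>P) / 2"
proof -
  have m [measurable]: "(\<lambda>u. u j) \<in> borel_measurable P" using assms by (auto intro!: measurable_PiM_coord)
  have [measurable]: "f \<in> borel_measurable P" using int by auto
  have cube: "0 \<le> (1 - (u j)\<^sup>2) / 2 * f u \<and> (1 - (u j)\<^sup>2) / 2 * f u \<le> 1 / 2 * f u"
    if "\<forall>i\<in>A. \<bar>u i\<bar> \<le> 1" for u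
  proof -
    have "(u j)\<^sup>2 \<le> 1" using that assms(1) by (simp add: abs_square_le_1)
    then show ?thesis using f[of u] by (intro conjI mult_right_mono mult_nonneg_nonneg) auto
  qed
  have "(\<integral>u. (1 - (u j)\<^sup>2) / 2 * f u \<partial>P) \<le> (\<integral>u. 1 / 2 * f u \<partial>P)"
  proof (rule integral_mono_AE)
    show "integrable P (\<lambda>u. (1 - (u j)\<^sup>2) / 2 * f u)"
    proof (rule Bochner_Integration.integrable_bound[OF int])
      show "AE u in P. norm ((1 - (u j)\<^sup>2) / 2 * f u) \<le> norm (f u)"
        using AE_cube[OF fin]
      proof eventually_elim
        case (elim u)
        then show ?case using cube[of u] f[of u] by (simp only: real_norm_def abs_of_nonneg) linarith
      qed
    qed measurable
    show "AE u in P. (1 - (u j)\<^sup>2) / 2 * f u \<le> 1 / 2 * f u"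
      using AE_cube[OF fin] by eventually_elim (use cube in blast)
  qed (use int in auto)
  then show ?thesis by simp
qed

text \<open>The exact value is \<open>r i / 3\<close>; estimating the weight by 1/2 costs only a
  constant.\<close>

lemma moment2: "(\<integral>u. (Y i u)\<^sup>2 \<partial>P) \<le> r i / 2"
proof -
  have "(\<integral>u. Y i u ^ Suc 1 \<partial>P) \<le> (\<Sum>j\<in>A. (a i j)\<^sup>2 * (1 / 2))"
    unfolding moment_step
    by (intro sum_mono mult_left_mono) (use weight_le[of _ "\<lambda>_. 1"] P.prob_space in auto)
  then show ?thesis by (simp add: r_def sum_divide_distrib numeral_2_eq_2)
qed

lemma moment4: "(\<integral>u. Y i u ^ 4 \<partial>P) \<le> 3 / 4 * (r i)\<^sup>2"
proof -
  have "(\<integral>u. Y i u ^ Suc 3 \<partial>P) \<le> (\<Sum>j\<in>A. (a i j)\<^sup>2 * (3 / 4 * r i))"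
    unfolding moment_step
  proof (intro sum_mono mult_left_mono)
    fix j assume j: "j \<in> A"
    have "(\<integral>u. (1 - (u j)\<^sup>2) / 2 * (3 * (Y i u)\<^sup>2) \<partial>P) \<le> (\<integral>u. 3 * (Y i u)\<^sup>2 \<partial>P) / 2"
      by (rule weight_le[OF j]) (auto intro: integrable_Y)
    then show "(\<integral>u. (1 - (u j)\<^sup>2) / 2 * (real 3 * Y i u ^ (3 - 1)) \<partial>P) \<le> 3 / 4 * r i"
      using moment2[of i] by simp
  qed simp
  also have "\<dots> = r i * (3 / 4 * r i)" by (simp only: r_def sum_distrib_right)
  also have "\<dots> = 3 / 4 * (r i)\<^sup>2" by (simp add: power2_eq_square)
  also have "Suc 3 = 4" by simp
  finally show ?thesis .
qed

text \<open>Young's inequality at the scale \<open>\<rho>\<close>, since the second moment is at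
  most of order \<open>\<rho>\<^sup>2\<close>.\<close>

lemma moment1_abs: "i \<in> A \<Longrightarrow> (\<integral>u. \<bar>Y i u\<bar> \<partial>P) \<le> \<rho>"
proof -
  assume i: "i \<in> A"
  have "(\<integral>u. \<bar>Y i u\<bar> \<partial>P) \<le> (\<integral>u. \<rho> / 2 + (Y i u)\<^sup>2 / (2 * \<rho>) \<partial>P)"
  proof (rule integral_mono)
    show "\<bar>Y i u\<bar> \<le> \<rho> / 2 + (Y i u)\<^sup>2 / (2 * \<rho>)" for u
      using \<rho> sum_squares_bound[of \<rho> "\<bar>Y i u\<bar>"] by (simp add: field_simps power2_eq_square)
  qed (use integrable_abs_Y[of i 1] integrable_Y[of i 2] in auto)
  also have "\<dots> = \<rho> / 2 + (\<integral>u. (Y i u)\<^sup>2 \<partial>P) / (2 * \<rho>)"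
    using integrable_Y[of i 2] P.prob_space by simp
  also have "\<dots> \<le> \<rho> / 2 + \<rho>\<^sup>2 / (2 * \<rho>)"
    using \<rho> moment2[of i] r_le[OF i] r_nonneg[of i] by (intro add_left_mono divide_right_mono) auto
  also have "\<dots> = \<rho>" using \<rho> by (simp add: power2_eq_square)
  finally show ?thesis .
qed

text \<open>Interpolation between the second and fourth moments with weight \<open>\<rho>\<close>.
  One factor \<open>r i\<close> is kept, to be summed to \<open>h\<close>; the other one in the
  fourth moment is traded for \<open>\<rho>\<^sup>2\<close>.\<close>

lemma moment3_abs: "i \<in> A \<Longrightarrow> (\<integral>u. \<bar>Y i u\<bar> ^ 3 \<partial>P) \<le> \<rho> * r i"
proof -
  assume i: "i \<in> A"
  have "(\<integral>u. \<bar>Y i u\<bar> ^ 3 \<partial>P) \<le> (\<integral>u. \<rho> / 2 * (Y i u)\<^sup>2 + Y i u ^ 4 / (2 * \<rho>) \<partial>P)"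
  proof (rule integral_mono)
    show "\<bar>Y i u\<bar> ^ 3 \<le> \<rho> / 2 * (Y i u)\<^sup>2 + Y i u ^ 4 / (2 * \<rho>)" for u
    proof -
      have "\<bar>Y i u\<bar> * (Y i u)\<^sup>2 \<le> (\<rho> / 2 + (Y i u)\<^sup>2 / (2 * \<rho>)) * (Y i u)\<^sup>2"
        using \<rho> sum_squares_bound[of \<rho> "\<bar>Y i u\<bar>"]
        by (intro mult_right_mono) (auto simp: field_simps power2_eq_square)
      moreover have "\<bar>Y i u\<bar> ^ 3 = \<bar>Y i u\<bar> * (Y i u)\<^sup>2"
        by (simp add: power3_eq_cube power2_eq_square)
      moreover have "Y i u ^ 4 = (Y i u)\<^sup>2 * (Y i u)\<^sup>2"
        by (simp flip: power_add)
      ultimately show ?thesis by (simp only: distrib_right times_divide_eq_left)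
    qed
  qed (use integrable_abs_Y[of i 3] integrable_Y in auto)
  also have "\<dots> = \<rho> / 2 * (\<integral>u. (Y i u)\<^sup>2 \<partial>P) + (\<integral>u. Y i u ^ 4 \<partial>P) / (2 * \<rho>)"
    using integrable_Y[of i 2] integrable_Y[of i 4] by simp
  also have "\<dots> \<le> \<rho> / 2 * (r i / 2) + (3 / 4 * (r i * \<rho>\<^sup>2)) / (2 * \<rho>)"
    using \<rho> moment2[of i] moment4[of i] mult_left_mono[OF r_le[OF i] r_nonneg[of i]]
    by (intro add_mono mult_left_mono divide_right_mono) (auto simp: power2_eq_square)
  also have "\<dots> = 5 / 8 * (\<rho> * r i)" using \<rho> by (simp add: power2_eq_square field_simps)
  also have "\<dots> \<le> \<rho> * r i" using \<rho> r_nonneg[of i] by simp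
  finally show ?thesis .
qed

text \<open>The squared gradient (with weight \<open>1 - x\<^sup>2\<close>) of the quadratic form, up to a constant factor.\<close>

definition "\<Gamma> u = (\<Sum>i\<in>A. (1 - (u i)\<^sup>2) * (Y i u)\<^sup>2)"

section \<open>Replacing the squared gradient by its mean\<close>

lemma sum_moment2: "(\<Sum>i\<in>A. (\<integral>u. (Y i u)\<^sup>2 \<partial>P)) \<le> h / 2"
  unfolding h_def sum_divide_distrib by (intro sum_mono moment2)

lemma h_nonneg: "h \<ge> 0" by (simp add: h_def sum_nonneg r_nonneg)

lemma qchar_eq: "qchar a A t = (\<integral>u. e t u \<partial>P)"
  by (simp add: qchar_def e_def)

text \<open>One factor of \<open>(Y i u)\<^sup>2\<close> is expanded and integrated by parts, which
  yields the weights \<open>(1 - (u j)\<^sup>2) / 2 = 1/3 + (1/3 - (u j)\<^sup>2) / 2\<close>. The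
  constant part gives \<open>h / 3\<close>, the centred part falls to \<open>ibp_centered\<close>,
  and the derivative of the exponential leaves a bilinear form \<open>X\<close> in the rows and
  their image under the matrix, which costs a factor \<open>\<rho>\<close>.\<close>

lemma integral_sq_Y_e:
  "norm ((\<integral>u. of_real (\<Sum>i\<in>A. (Y i u)\<^sup>2) * e t u \<partial>P) - of_real (h / 3) * qchar a A t) \<le> 5 / 6 * \<bar>t\<bar> * \<rho> * h"
proof -
  \<comment> \<open>The matrix applied a second time, to the vector of the \<open>Y i u\<close>; it
    arises when the sum over \<open>i\<close> is carried out first.\<close>
  define W where "W j u = (\<Sum>i\<in>A. a i j * Y i u)" for j u
  define X where "X u = (\<Sum>j\<in>A. (1 - (u j)\<^sup>2) * Y j u * W j u)" for u
  define V where "V j = (\<integral>u. of_real (1 / 3 - (u j)\<^sup>2) * e t u \<partial>P)" for j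
  have L1: "c * (w * ((c + 2 * \<i> * T * x * y) * z)) = c\<^sup>2 * (w * z) + \<i> * T * (2 * w * y * z) * (c * x)"
    for c w T x y z :: complex
    by (simp add: power2_eq_square algebra_simps)
  have L2: "of_real p * (of_real ((1 - s) / 2) * z) + \<i> * T * (2 * of_real ((1 - s) / 2) * of_real x * z) * of_real y
      = of_real (p / 3) * z + of_real (p / 2) * (of_real (1 / 3 - s) * z) + \<i> * T * (of_real ((1 - s) * x * y) * z)"
    for p s x y :: real and z T :: complex
    by (simp add: field_simps)
  have tX: "tame A (\<lambda>u. complex_of_real (X u))"
    unfolding X_def W_def of_real_sum of_real_mult of_real_diff of_real_power by (intro tame_intros)
  have tV: "tame A (\<lambda>u. of_real (1 / 3 - (u j)\<^sup>2) * e t u)" if "j \<in> A" for j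
    using that unfolding of_real_diff of_real_power by (intro tame_intros tame_e)
  have tw: "tame A (\<lambda>u. of_real ((1 - (u j)\<^sup>2) / 2))" if "j \<in> A" for j
    using that unfolding divide_inverse of_real_mult of_real_diff of_real_power by (intro tame_intros)
  have "(\<integral>u. of_real (\<Sum>i\<in>A. (Y i u)\<^sup>2) * e t u \<partial>P) =
      (\<integral>u. (\<Sum>i\<in>A. \<Sum>j\<in>A. of_real (a i j) * (of_real (u j) * (of_real (Y i u) ^ 1 * e t u))) \<partial>P)"
  proof (intro Bochner_Integration.integral_cong refl)
    fix u
    have "(\<Sum>i\<in>A. (Y i u)\<^sup>2) = (\<Sum>i\<in>A. \<Sum>j\<in>A. a i j * (u j * Y i u))"
      unfolding power2_eq_square lin_row_def[of a A _ u] by (simp add: sum_distrib_left sum_distrib_right mult_ac)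
    then show "of_real (\<Sum>i\<in>A. (Y i u)\<^sup>2) * e t u =
        (\<Sum>i\<in>A. \<Sum>j\<in>A. of_real (a i j) * (of_real (u j) * (of_real (Y i u) ^ 1 * e t u)))"
      by (simp add: sum_distrib_right mult.assoc)
  qed
  also have "\<dots> = (\<Sum>i\<in>A. \<Sum>j\<in>A. of_real (a i j) * (\<integral>u. of_real (u j) * (of_real (Y i u) ^ 1 * e t u) \<partial>P))"
    by (rule integral_sum_sum_mult) (intro tame_integrable fin tame_intros tame_e)
  also have "\<dots> = (\<Sum>i\<in>A. \<Sum>j\<in>A. of_real (a i j) * (\<integral>u. of_real ((1 - (u j)\<^sup>2) / 2) *
      ((of_real (a i j) + 2 * \<i> * t * of_real (Y i u) * of_real (Y j u)) * e t u) \<partial>P))"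
  proof (intro sum.cong refl arg_cong2[where f = "(*)"])
    fix i j assume "j \<in> A"
    from ibp[OF this, of i 1 t]
    show "(\<integral>u. of_real (u j) * (of_real (Y i u) ^ 1 * e t u) \<partial>P) = (\<integral>u. of_real ((1 - (u j)\<^sup>2) / 2) *
      ((of_real (a i j) + 2 * \<i> * t * of_real (Y i u) * of_real (Y j u)) * e t u) \<partial>P)"
      by (simp only: of_nat_1 power_one_right cancel_comm_monoid_add_class.diff_cancel power_0 mult_1)
  qed
  also have "\<dots> = (\<integral>u. (\<Sum>i\<in>A. \<Sum>j\<in>A. of_real (a i j) * (of_real ((1 - (u j)\<^sup>2) / 2) *
      ((of_real (a i j) + 2 * \<i> * t * of_real (Y i u) * of_real (Y j u)) * e t u))) \<partial>P)"
    by (rule integral_sum_sum_mult[symmetric]) (intro tame_integrable fin tame_intros tame_e tw)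
  also have "\<dots> = (\<integral>u. (\<Sum>j\<in>A. of_real (r j / 3) * e t u + of_real (r j / 2) * (of_real (1 / 3 - (u j)\<^sup>2) * e t u))
      + \<i> * t * (of_real (X u) * e t u) \<partial>P)"
  proof (intro Bochner_Integration.integral_cong refl)
    fix u
    let ?w = "\<lambda>j::nat. complex_of_real ((1 - (u j)\<^sup>2) / 2)"
    have "(\<Sum>i\<in>A. \<Sum>j\<in>A. of_real (a i j) * (?w j * ((of_real (a i j) + 2 * \<i> * t * of_real (Y i u) * of_real (Y j u)) * e t u)))
        = (\<Sum>j\<in>A. \<Sum>i\<in>A. of_real ((a i j)\<^sup>2) * (?w j * e t u) + \<i> * t * (2 * ?w j * of_real (Y j u) * e t u) * of_real (a i j * Y i u))"
      by (subst sum.swap) (intro sum.cong refl, simp only: of_real_mult of_real_power, rule L1)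
    also have "\<dots> = (\<Sum>j\<in>A. of_real (r j) * (?w j * e t u) + \<i> * t * (2 * ?w j * of_real (Y j u) * e t u) * of_real (W j u))"
    proof (intro sum.cong refl)
      fix j
      have "r j = (\<Sum>i\<in>A. (a i j)\<^sup>2)" unfolding r_def by (intro sum.cong refl arg_cong[where f = "\<lambda>x. x\<^sup>2"] sym)
      then show "(\<Sum>i\<in>A. of_real ((a i j)\<^sup>2) * (?w j * e t u) + \<i> * t * (2 * ?w j * of_real (Y j u) * e t u) * of_real (a i j * Y i u))
        = of_real (r j) * (?w j * e t u) + \<i> * t * (2 * ?w j * of_real (Y j u) * e t u) * of_real (W j u)"
        unfolding W_def of_real_sum by (simp only: sum.distrib sum_distrib_left sum_distrib_right of_real_sum)
    qed
    also have "\<dots> = (\<Sum>j\<in>A. of_real (r j / 3) * e t u + of_real (r j / 2) * (of_real (1 / 3 - (u j)\<^sup>2) * e t u)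
        + \<i> * t * (of_real ((1 - (u j)\<^sup>2) * Y j u * W j u) * e t u))"
      by (intro sum.cong refl L2)
    also have "\<dots> = (\<Sum>j\<in>A. of_real (r j / 3) * e t u + of_real (r j / 2) * (of_real (1 / 3 - (u j)\<^sup>2) * e t u))
        + \<i> * t * (of_real (X u) * e t u)"
      unfolding X_def of_real_sum by (simp only: sum.distrib sum_distrib_left sum_distrib_right of_real_sum)
    finally show "(\<Sum>i\<in>A. \<Sum>j\<in>A. of_real (a i j) * (?w j * ((of_real (a i j) + 2 * \<i> * t * of_real (Y i u) * of_real (Y j u)) * e t u)))
        = (\<Sum>j\<in>A. of_real (r j / 3) * e t u + of_real (r j / 2) * (of_real (1 / 3 - (u j)\<^sup>2) * e t u))
        + \<i> * t * (of_real (X u) * e t u)" .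
  qed
  also have "\<dots> = (\<Sum>j\<in>A. of_real (r j / 3) * qchar a A t + of_real (r j / 2) * V j) + \<i> * t * (\<integral>u. of_real (X u) * e t u \<partial>P)"
  proof -
    have i1: "integrable P (e t)" by (intro tame_integrable fin tame_e)
    have i2: "integrable P (\<lambda>u. of_real (X u) * e t u)" by (intro tame_integrable fin tame_intros tX tame_e)
    have i3: "integrable P (\<lambda>u. of_real (1 / 3 - (u j)\<^sup>2) * e t u)" if "j \<in> A" for j
      by (intro tame_integrable fin tV that)
    have i4: "integrable P (\<lambda>u. of_real (r j / 3) * e t u + of_real (r j / 2) * (of_real (1 / 3 - (u j)\<^sup>2) * e t u))" if "j \<in> A" for j
      by (intro Bochner_Integration.integrable_add integrable_mult_right i1 i3 that)
    have s: "(\<integral>u. of_real (r j / 3) * e t u + of_real (r j / 2) * (of_real (1 / 3 - (u j)\<^sup>2) * e t u) \<partial>P)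
        = of_real (r j / 3) * qchar a A t + of_real (r j / 2) * V j" if "j \<in> A" for j
      unfolding V_def qchar_eq
      by (subst Bochner_Integration.integral_add[OF integrable_mult_right[OF i1] integrable_mult_right[OF i3[OF that]]])
        (simp only: integral_mult_right_zero)
    show ?thesis
      by (subst Bochner_Integration.integral_add[OF Bochner_Integration.integrable_sum[OF i4] integrable_mult_right[OF i2]], assumption,
        subst Bochner_Integration.integral_sum[OF i4], assumption)
        (simp only: s integral_mult_right_zero cong: sum.cong)
  qed
  finally have S: "(\<integral>u. of_real (\<Sum>i\<in>A. (Y i u)\<^sup>2) * e t u \<partial>P) =
      (\<Sum>j\<in>A. of_real (r j / 3) * qchar a A t + of_real (r j / 2) * V j) + \<i> * t * (\<integral>u. of_real (X u) * e t u \<partial>P)" .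
  define IX where "IX = (\<integral>u. of_real (X u) * e t u \<partial>P)"
  have h3: "(\<Sum>j\<in>A. of_real (r j / 3) * qchar a A t) = of_real (h / 3) * qchar a A t"
    by (simp only: h_def sum_divide_distrib of_real_sum sum_distrib_right)
  have S': "(\<integral>u. of_real (\<Sum>i\<in>A. (Y i u)\<^sup>2) * e t u \<partial>P) - of_real (h / 3) * qchar a A t
      = (\<Sum>j\<in>A. of_real (r j / 2) * V j) + \<i> * t * IX"
    unfolding S IX_def sum.distrib h3 by simp
  have "norm ((\<Sum>j\<in>A. of_real (r j / 2) * V j) + \<i> * t * IX)
      \<le> (\<Sum>j\<in>A. norm (of_real (r j / 2) * V j)) + norm (\<i> * t * IX)"
    by (intro norm_triangle_mono norm_sum order.refl)
  \<comment> \<open>The centred terms contribute 1/3 and the term with \<open>X\<close> contributes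
    1/2, together 5/6.\<close>
  also have "\<dots> \<le> (\<Sum>j\<in>A. r j / 2 * (2 / 3 * \<bar>t\<bar> * \<rho>)) + \<bar>t\<bar> * (\<rho> * (h / 2))"
  proof (intro add_mono sum_mono)
    fix j assume j: "j \<in> A"
    have "norm (V j) \<le> 2 / 3 * \<bar>t\<bar> * (\<integral>u. \<bar>Y j u\<bar> ^ (0 + 1) \<partial>P)"
      using ibp_centered[OF j, of 0 t] by (simp add: V_def)
    also have "\<dots> \<le> 2 / 3 * \<bar>t\<bar> * \<rho>" using moment1_abs[OF j] by (intro mult_left_mono) auto
    finally show "norm (of_real (r j / 2) * V j) \<le> r j / 2 * (2 / 3 * \<bar>t\<bar> * \<rho>)"
      using r_nonneg[of j] unfolding norm_mult by (intro mult_mono) auto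
  next
    have "norm (\<integral>u. of_real (X u) * e t u \<partial>P) \<le> (\<integral>u. \<rho> * (\<Sum>i\<in>A. (Y i u)\<^sup>2) \<partial>P)"
    proof (rule norm_integral_le_AE)
      show "integrable P (\<lambda>u. of_real (X u) * e t u)" by (intro tame_integrable fin tame_intros tX tame_e)
      show "integrable P (\<lambda>u. \<rho> * (\<Sum>i\<in>A. (Y i u)\<^sup>2))"
        by (intro integrable_mult_right Bochner_Integration.integrable_sum integrable_Y)
      show "AE u in P. norm (of_real (X u) * e t u) \<le> \<rho> * (\<Sum>i\<in>A. (Y i u)\<^sup>2)"
        using AE_cube[OF fin]
      proof eventually_elim
        case (elim u)
        have W2: "(\<Sum>j\<in>A. (W j u)\<^sup>2) \<le> \<rho>\<^sup>2 * (\<Sum>i\<in>A. (Y i u)\<^sup>2)"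
        proof -
          have "W j u = (\<Sum>i\<in>A. a j i * Y i u)" for j
            unfolding W_def by (intro sum.cong refl arg_cong2[where f = "(*)"] sym)
          then show ?thesis
            using op[unfolded op_bound_def, rule_format, OF fin fin, of "\<lambda>i. Y i u"] by simp
        qed
        \<comment> \<open>The weight \<open>\<rho>\<close> balances the two sums: by
          \<open>W2\<close> each is at most \<open>\<rho> / 2\<close> times the sum of the
          \<open>(Y i u)\<^sup>2\<close>.\<close>
        have "\<bar>X u\<bar> \<le> (\<Sum>j\<in>A. \<rho> / 2 * (Y j u)\<^sup>2 + (W j u)\<^sup>2 / (2 * \<rho>))"
          unfolding X_def
        proof (rule order.trans[OF sum_abs sum_mono])
          fix j assume j: "j \<in> A"
          have "(u j)\<^sup>2 \<le> 1" using elim j by (simp add: abs_square_le_1)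
          then have u1: "\<bar>1 - (u j)\<^sup>2\<bar> \<le> 1" using zero_le_power2[of "u j"] by linarith
          have "\<bar>(1 - (u j)\<^sup>2) * Y j u * W j u\<bar> \<le> 1 * (\<bar>Y j u\<bar> * \<bar>W j u\<bar>)"
            unfolding abs_mult mult.assoc by (intro mult_right_mono u1) auto
          also have "\<dots> \<le> \<rho> / 2 * (Y j u)\<^sup>2 + (W j u)\<^sup>2 / (2 * \<rho>)"
            using \<rho> sum_squares_bound[of "\<rho> * \<bar>Y j u\<bar>" "\<bar>W j u\<bar>"] by (simp add: field_simps power2_eq_square)
          finally show "\<bar>(1 - (u j)\<^sup>2) * Y j u * W j u\<bar> \<le> \<rho> / 2 * (Y j u)\<^sup>2 + (W j u)\<^sup>2 / (2 * \<rho>)" .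
        qed
        also have "\<dots> = \<rho> / 2 * (\<Sum>j\<in>A. (Y j u)\<^sup>2) + (\<Sum>j\<in>A. (W j u)\<^sup>2) / (2 * \<rho>)"
          by (simp add: sum.distrib sum_distrib_left sum_divide_distrib)
        also have "\<dots> \<le> \<rho> / 2 * (\<Sum>j\<in>A. (Y j u)\<^sup>2) + (\<rho>\<^sup>2 * (\<Sum>i\<in>A. (Y i u)\<^sup>2)) / (2 * \<rho>)"
          using \<rho> by (intro add_left_mono divide_right_mono W2) auto
        also have "\<dots> = \<rho> * (\<Sum>i\<in>A. (Y i u)\<^sup>2)" using \<rho> by (simp add: power2_eq_square)
        finally show ?case by (simp add: norm_mult)
      qed
    qed
    also have "\<dots> = \<rho> * (\<Sum>i\<in>A. (\<integral>u. (Y i u)\<^sup>2 \<partial>P))"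
      by (simp add: Bochner_Integration.integral_sum integrable_Y)
    also have "\<dots> \<le> \<rho> * (h / 2)" using \<rho> sum_moment2 by (intro mult_left_mono) auto
    finally have "norm IX \<le> \<rho> * (h / 2)" by (simp only: IX_def)
    from mult_left_mono[OF this abs_ge_zero[of t]]
    show "norm (\<i> * t * IX) \<le> \<bar>t\<bar> * (\<rho> * (h / 2))"
      by (simp only: norm_mult norm_ii norm_of_real mult_1)
  qed
  also have "\<dots> = 5 / 6 * \<bar>t\<bar> * \<rho> * h"
  proof -
    have "(\<Sum>j\<in>A. r j / 2 * (2 / 3 * \<bar>t\<bar> * \<rho>)) = h / 2 * (2 / 3 * \<bar>t\<bar> * \<rho>)"
      by (simp only: h_def sum_divide_distrib sum_distrib_right)
    then show ?thesis by (simp only:) simp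
  qed
  finally show ?thesis unfolding S' .
qed

end

context zero_diagonal_form
begin

text \<open>The splitting \<open>1 - x\<^sup>2 = 2/3 + (1/3 - x\<^sup>2)\<close> reduces the outer
  weight to its mean, after which \<open>integral_sq_Y_e\<close> applies. The centred part is
  \<open>ibp_centered\<close> with \<open>n = 2\<close> and a third absolute moment. The constants
  5/9 and 2/3 add up to less than 2.\<close>

lemma integral_Gamma_e:
  "norm ((\<integral>u. of_real (\<Gamma> u) * e t u \<partial>P) - of_real (2 / 9 * h) * qchar a A t) \<le> 2 * \<bar>t\<bar> * \<rho> * h"
proof -
  define V where "V i = (\<integral>u. of_real (1 / 3 - (u i)\<^sup>2) * (of_real (Y i u) ^ 2 * e t u) \<partial>P)" for i
  define S where "S = (\<integral>u. of_real (\<Sum>i\<in>A. (Y i u)\<^sup>2) * e t u \<partial>P)"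
  have i1: "integrable P (\<lambda>u. of_real (\<Sum>i\<in>A. (Y i u)\<^sup>2) * e t u)"
    unfolding of_real_sum of_real_power by (intro tame_integrable fin tame_intros tame_e)
  have i2: "integrable P (\<lambda>u. of_real (1 / 3 - (u i)\<^sup>2) * (of_real (Y i u) ^ 2 * e t u))" if "i \<in> A" for i
    using that unfolding of_real_diff of_real_power by (intro tame_integrable fin tame_intros tame_e)
  have "(\<integral>u. of_real (\<Gamma> u) * e t u \<partial>P) = (\<integral>u. of_real (2 / 3) * (of_real (\<Sum>i\<in>A. (Y i u)\<^sup>2) * e t u) +
      (\<Sum>i\<in>A. of_real (1 / 3 - (u i)\<^sup>2) * (of_real (Y i u) ^ 2 * e t u)) \<partial>P)"
  proof (intro Bochner_Integration.integral_cong refl)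
    fix u
    have "\<Gamma> u = 2 / 3 * (\<Sum>i\<in>A. (Y i u)\<^sup>2) + (\<Sum>i\<in>A. (1 / 3 - (u i)\<^sup>2) * (Y i u)\<^sup>2)"
      unfolding \<Gamma>_def sum_distrib_left sum.distrib[symmetric]
      by (intro sum.cong refl) (simp add: algebra_simps)
    then show "of_real (\<Gamma> u) * e t u = of_real (2 / 3) * (of_real (\<Sum>i\<in>A. (Y i u)\<^sup>2) * e t u) +
      (\<Sum>i\<in>A. of_real (1 / 3 - (u i)\<^sup>2) * (of_real (Y i u) ^ 2 * e t u))"
      by (simp only: of_real_add of_real_mult of_real_sum of_real_power distrib_right sum_distrib_right mult.assoc)
  qed
  also have "\<dots> = of_real (2 / 3) * S + (\<Sum>i\<in>A. V i)"
    unfolding S_def V_def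
    by (subst Bochner_Integration.integral_add[OF integrable_mult_right[OF i1] Bochner_Integration.integrable_sum[OF i2]],
        assumption, subst Bochner_Integration.integral_sum[OF i2], assumption)
      (simp only: integral_mult_right_zero)
  finally have G: "(\<integral>u. of_real (\<Gamma> u) * e t u \<partial>P) = of_real (2 / 3) * S + (\<Sum>i\<in>A. V i)" .
  have V: "norm (V i) \<le> 2 / 3 * \<bar>t\<bar> * (\<rho> * r i)" if "i \<in> A" for i
  proof -
    have "norm (V i) \<le> 2 / 3 * \<bar>t\<bar> * (\<integral>u. \<bar>Y i u\<bar> ^ (2 + 1) \<partial>P)"
      unfolding V_def by (rule ibp_centered[OF that])
    moreover have "(\<integral>u. \<bar>Y i u\<bar> ^ (2 + 1) \<partial>P) \<le> \<rho> * r i" using moment3_abs[OF that] by simp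
    then have "2 / 3 * \<bar>t\<bar> * (\<integral>u. \<bar>Y i u\<bar> ^ (2 + 1) \<partial>P) \<le> 2 / 3 * \<bar>t\<bar> * (\<rho> * r i)"
      by (intro mult_left_mono) auto
    ultimately show ?thesis by linarith
  qed
  have "norm (\<Sum>i\<in>A. V i) \<le> (\<Sum>i\<in>A. 2 / 3 * \<bar>t\<bar> * (\<rho> * r i))"
    by (intro sum_norm_le V)
  also have "(\<Sum>i\<in>A. 2 / 3 * \<bar>t\<bar> * (\<rho> * r i)) = 2 / 3 * \<bar>t\<bar> * (\<rho> * h)"
    by (simp only: h_def sum_distrib_left)
  finally have nV: "norm (\<Sum>i\<in>A. V i) \<le> 2 / 3 * \<bar>t\<bar> * (\<rho> * h)" .
  have nS: "norm (S - of_real (h / 3) * qchar a A t) \<le> 5 / 6 * \<bar>t\<bar> * \<rho> * h"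
    unfolding S_def by (rule integral_sq_Y_e)
  have split: "(\<integral>u. of_real (\<Gamma> u) * e t u \<partial>P) - of_real (2 / 9 * h) * qchar a A t =
      of_real (2 / 3) * (S - of_real (h / 3) * qchar a A t) + (\<Sum>i\<in>A. V i)"
    unfolding G by (simp add: algebra_simps)
  have "norm (of_real (2 / 3) * (S - of_real (h / 3) * qchar a A t) + (\<Sum>i\<in>A. V i)) \<le>
      2 / 3 * (5 / 6 * \<bar>t\<bar> * \<rho> * h) + 2 / 3 * \<bar>t\<bar> * (\<rho> * h)"
  proof (rule norm_triangle_mono[OF _ nV])
    have n: "norm (complex_of_real (2 / 3) * z) = 2 / 3 * norm z" for z by (simp add: norm_mult)
    show "norm (of_real (2 / 3) * (S - of_real (h / 3) * qchar a A t)) \<le> 2 / 3 * (5 / 6 * \<bar>t\<bar> * \<rho> * h)"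
      unfolding n by (rule mult_left_mono[OF nS]) simp
  qed
  also have "\<dots> \<le> 2 * \<bar>t\<bar> * \<rho> * h"
  proof -
    have "\<bar>t\<bar> * \<rho> * h \<ge> 0" using \<rho> h_nonneg by auto
    then show ?thesis by linarith
  qed
  finally show ?thesis unfolding split .
qed

text \<open>\<open>quad\<close> is the sum of the \<open>u i * Y i u\<close>. Integrating each term
  by parts in \<open>u i\<close> differentiates only the exponential, because
  \<open>a i i = 0\<close>; the two factors \<open>\<i>\<close> produce the sign.\<close>

lemma qchar_deriv:
  "(qchar a A has_vector_derivative - (of_real t * (\<integral>u. of_real (\<Gamma> u) * e t u \<partial>P))) (at t)"
proof -
  have tq: "tame A (\<lambda>u. complex_of_real (quad a A u))"
    unfolding quad_row of_real_sum of_real_mult by (intro tame_intros)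
  have "((\<lambda>t. \<integral>u. e t u \<partial>P) has_vector_derivative (\<integral>u. \<i> * of_real (quad a A u) * e t u \<partial>P)) (at t within UNIV)"
  proof (rule has_vector_derivative_integral[where G = "\<lambda>u. \<bar>quad a A u\<bar>"])
    show "integrable P (e s)" for s by (intro tame_integrable fin tame_e)
    show "((\<lambda>s. e s u) has_vector_derivative \<i> * of_real (quad a A u) * e s u) (at s within UNIV)" for s u
    proof -
      have "((\<lambda>z. exp (\<i> * (z * of_real (quad a A u)))) has_field_derivative
          \<i> * of_real (quad a A u) * exp (\<i> * (of_real s * of_real (quad a A u)))) (at (of_real s))"
        by (auto intro!: derivative_eq_intros)
      from has_vector_derivative_real_field[OF this] show ?thesis by (simp add: e_def)
    qed
    show "norm (\<i> * of_real (quad a A u) * e s u) \<le> \<bar>quad a A u\<bar>" for s u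
      by (simp add: norm_mult)
    show "integrable P (\<lambda>u. \<bar>quad a A u\<bar>)"
      using tame_integrable_real[OF fin tq] by (rule integrable_abs)
    show "(\<lambda>u. \<i> * of_real (quad a A u) * e t u) \<in> borel_measurable P"
      by (rule borel_measurable_integrable) (intro tame_integrable fin tame_intros tame_e tq)
  qed auto
  moreover have "(\<integral>u. \<i> * of_real (quad a A u) * e t u \<partial>P) = - (of_real t * (\<integral>u. of_real (\<Gamma> u) * e t u \<partial>P))"
  proof -
    \<comment> \<open>The inner sum over a singleton only brings the expression into the shape of
      \<open>integral_sum_sum_mult\<close>.\<close>
    have "(\<integral>u. \<i> * of_real (quad a A u) * e t u \<partial>P) =
        (\<integral>u. (\<Sum>i\<in>A. \<Sum>j\<in>{0::nat}. \<i> * (of_real (u i) * (of_real (Y i u) ^ 1 * e t u))) \<partial>P)"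
      unfolding quad_row of_real_sum
      by (intro Bochner_Integration.integral_cong refl) (simp add: sum_distrib_left sum_distrib_right mult_ac)
    also have "\<dots> = (\<Sum>i\<in>A. \<Sum>j\<in>{0::nat}. \<i> * (\<integral>u. of_real (u i) * (of_real (Y i u) ^ 1 * e t u) \<partial>P))"
      by (rule integral_sum_sum_mult) (intro tame_integrable fin tame_intros tame_e)
    also have "\<dots> = (\<Sum>i\<in>A. \<Sum>j\<in>{0::nat}. \<i> * (\<integral>u. \<i> * t * (of_real ((1 - (u i)\<^sup>2) * (Y i u)\<^sup>2) * e t u) \<partial>P))"
    proof (intro sum.cong refl arg_cong2[where f = "(*)"])
      fix i assume "i \<in> A"
      from ibp[OF this, of i 1 t]
      show "(\<integral>u. of_real (u i) * (of_real (Y i u) ^ 1 * e t u) \<partial>P) =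
          (\<integral>u. \<i> * t * (of_real ((1 - (u i)\<^sup>2) * (Y i u)\<^sup>2) * e t u) \<partial>P)"
      proof (rule trans)
        show "(\<integral>u. of_real ((1 - (u i)\<^sup>2) / 2) * ((of_nat 1 * of_real (Y i u) ^ (1 - 1) * of_real (a i i)
            + 2 * \<i> * t * of_real (Y i u) ^ 1 * of_real (Y i u)) * e t u) \<partial>P) =
          (\<integral>u. \<i> * t * (of_real ((1 - (u i)\<^sup>2) * (Y i u)\<^sup>2) * e t u) \<partial>P)"
          by (intro Bochner_Integration.integral_cong refl) (simp add: diag power2_eq_square field_simps)
      qed
    qed
    also have "\<dots> = (\<Sum>i\<in>A. \<Sum>j\<in>{0::nat}. - of_real t * (\<integral>u. of_real ((1 - (u i)\<^sup>2) * (Y i u)\<^sup>2) * e t u \<partial>P))"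
    proof -
      have "\<i> * (\<i> * of_real t * z) = - of_real t * z" for z by (simp add: mult.assoc[symmetric])
      then show ?thesis by (simp only: integral_mult_right_zero)
    qed
    also have "\<dots> = (\<integral>u. (\<Sum>i\<in>A. \<Sum>j\<in>{0::nat}. - of_real t * (of_real ((1 - (u i)\<^sup>2) * (Y i u)\<^sup>2) * e t u)) \<partial>P)"
      by (rule integral_sum_sum_mult[symmetric], unfold of_real_mult of_real_diff of_real_power)
        (intro tame_integrable fin tame_intros tame_e)
    also have "\<dots> = (\<integral>u. - of_real t * (of_real (\<Gamma> u) * e t u) \<partial>P)"
      by (intro Bochner_Integration.integral_cong refl)
        (simp only: \<Gamma>_def of_real_sum sum_distrib_left sum_distrib_right sum.insert_if sum.empty finite.emptyI empty_iff if_False add_0_right)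
    also have "\<dots> = - (of_real t * (\<integral>u. of_real (\<Gamma> u) * e t u \<partial>P))"
      unfolding integral_mult_right_zero by simp
    finally show ?thesis .
  qed
  ultimately show ?thesis unfolding qchar_eq[abs_def] by simp
qed

text \<open>With \<open>\<Gamma>\<close> replaced by its mean, \<open>qchar\<close> would solve
  \<open>y' = - (2 * h / 9) * t * y\<close>, whose solution with value 1 at 0 is the Gaussian. The
  integrating factor \<open>E\<close> turns the defect in this equation into the derivative of
  \<open>\<psi>\<close>.\<close>

lemma qchar_near_gaussian:
  "norm (qchar a A t - exp (- (h * t\<^sup>2 / 9))) \<le> 2 * \<rho> * h * \<bar>t\<bar> ^ 3"
proof -
  define G where "G s = (\<integral>u. of_real (\<Gamma> u) * e s u \<partial>P)" for s
  define E where "E s = exp (h * s\<^sup>2 / 9)" for s :: real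
  define \<psi> where "\<psi> s = qchar a A s * of_real (E s)" for s
  have dE: "((\<lambda>s. complex_of_real (E s)) has_vector_derivative of_real (2 * h * s / 9 * E s)) (at s)" for s
    unfolding E_def
    by (intro has_vector_derivative_of_real)
      (auto intro!: derivative_eq_intros simp flip: has_real_derivative_iff_has_vector_derivative)
  have d\<psi>: "(\<psi> has_vector_derivative of_real (- s * E s) * (G s - of_real (2 / 9 * h) * qchar a A s)) (at s within X)" for s X
  proof -
    have "(\<psi> has_vector_derivative qchar a A s * of_real (2 * h * s / 9 * E s) + - (of_real s * G s) * of_real (E s)) (at s)"
      unfolding \<psi>_def G_def by (intro has_vector_derivative_mult qchar_deriv dE)
    also have "qchar a A s * of_real (2 * h * s / 9 * E s) + - (of_real s * G s) * of_real (E s) =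
        of_real (- s * E s) * (G s - of_real (2 / 9 * h) * qchar a A s)"
      by (simp add: field_simps)
    finally show ?thesis by (rule has_vector_derivative_at_within)
  qed
  have "norm (\<psi> t - \<psi> 0) \<le> (\<bar>t\<bar> * E t * (2 * \<bar>t\<bar> * \<rho> * h)) * norm (t - 0)"
  proof (rule differentiable_bound[where S = "closed_segment 0 t"])
    show "(\<psi> has_derivative (\<lambda>x. x *\<^sub>R (of_real (- s * E s) * (G s - of_real (2 / 9 * h) * qchar a A s))))
        (at s within closed_segment 0 t)" for s
      using d\<psi> by (simp add: has_vector_derivative_def)
    fix s assume "s \<in> closed_segment 0 t"
    then have st: "\<bar>s\<bar> \<le> \<bar>t\<bar>" by (auto simp: closed_segment_eq_real_ivl split: if_splits)
    have s2: "s\<^sup>2 \<le> t\<^sup>2" using st by (simp add: abs_le_square_iff)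
    \<comment> \<open>\<open>E\<close> grows with \<open>\<bar>s\<bar>\<close>, so its value at
      \<open>t\<close> bounds it on the segment and cancels in the end against the division by
      \<open>E t\<close>.\<close>
    have E: "0 < E s" "E s \<le> E t"
      using s2 h_nonneg by (auto simp: E_def intro!: divide_right_mono mult_left_mono)
    have "norm (of_real (- s * E s) * (G s - of_real (2 / 9 * h) * qchar a A s)) \<le> (\<bar>s\<bar> * E s) * (2 * \<bar>s\<bar> * \<rho> * h)"
      using integral_Gamma_e[of s] E unfolding norm_mult norm_of_real G_def abs_mult
      by (intro mult_mono) auto
    also have "\<dots> \<le> (\<bar>t\<bar> * E t) * (2 * \<bar>t\<bar> * \<rho> * h)"
      using E st \<rho> h_nonneg by (intro mult_mono) auto
    finally have "norm (of_real (- s * E s) * (G s - of_real (2 / 9 * h) * qchar a A s)) \<le> \<bar>t\<bar> * E t * (2 * \<bar>t\<bar> * \<rho> * h)" .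
    then show "onorm (\<lambda>x. x *\<^sub>R (of_real (- s * E s) * (G s - of_real (2 / 9 * h) * qchar a A s)))
        \<le> \<bar>t\<bar> * E t * (2 * \<bar>t\<bar> * \<rho> * h)"
      by (rule onorm_scaleR_left_le)
  qed auto
  moreover have "\<psi> 0 = 1"
    using P.prob_space by (simp add: \<psi>_def E_def qchar_def)
  ultimately have \<psi>t: "norm (\<psi> t - 1) \<le> \<bar>t\<bar> * E t * (2 * \<bar>t\<bar> * \<rho> * h) * \<bar>t\<bar>" by simp
  have Et: "E t > 0" by (simp add: E_def)
  have eq: "qchar a A t - exp (- (h * t\<^sup>2 / 9)) = (\<psi> t - 1) * of_real (1 / E t)"
    by (simp add: \<psi>_def E_def exp_minus field_simps exp_of_real[symmetric] del: of_real_exp)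
  have "norm (qchar a A t - exp (- (h * t\<^sup>2 / 9))) = norm (\<psi> t - 1) * (1 / E t)"
    unfolding eq norm_mult norm_of_real using Et by simp
  also have "\<dots> \<le> \<bar>t\<bar> * E t * (2 * \<bar>t\<bar> * \<rho> * h) * \<bar>t\<bar> * (1 / E t)"
    using Et \<psi>t by (intro mult_right_mono) auto
  also have "\<dots> = 2 * \<rho> * h * \<bar>t\<bar> ^ 3"
    using Et by (simp add: power3_eq_cube)
  finally show ?thesis .
qed

end

section \<open>Fourier inversion\<close>

text \<open>The index \<open>k\<close> counts derivatives in \<open>x\<close> of the inverse Fourier
  transform, taken under the integral; differentiation becomes the shift from \<open>k\<close> to
  \<open>Suc k\<close>.\<close>

definition fourier_inv :: "(real \<Rightarrow> complex) \<Rightarrow> nat \<Rightarrow> real \<Rightarrow> complex"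
  where "fourier_inv \<phi> k x = of_real (1 / (2 * pi)) * (\<integral>t. (- (\<i> * of_real t)) ^ k * iexp (- (t * x)) * \<phi> t \<partial>lborel)"

lemma integrable_damped:
  assumes "integrable lborel (\<lambda>t. t ^ k *\<^sub>R \<phi> t)"
  shows "integrable lborel (\<lambda>t. (- (\<i> * of_real t)) ^ k * iexp (- (t * x)) * \<phi> t)"
proof (rule Bochner_Integration.integrable_bound[OF assms])
  have "(\<lambda>t. (- \<i>) ^ k * iexp (- (t * x)) * (t ^ k *\<^sub>R \<phi> t)) \<in> borel_measurable lborel"
    using borel_measurable_integrable[OF assms] by measurable
  also have "(\<lambda>t. (- \<i>) ^ k * iexp (- (t * x)) * (t ^ k *\<^sub>R \<phi> t)) =
      (\<lambda>t. (- (\<i> * of_real t)) ^ k * iexp (- (t * x)) * \<phi> t)"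
  proof
    fix t :: real
    have "(- (\<i> * complex_of_real t)) ^ k = (- \<i>) ^ k * of_real t ^ k"
      by (simp flip: power_mult_distrib)
    then show "(- \<i>) ^ k * iexp (- (t * x)) * (t ^ k *\<^sub>R \<phi> t) = (- (\<i> * of_real t)) ^ k * iexp (- (t * x)) * \<phi> t"
      by (simp add: scaleR_conv_of_real)
  qed
  finally show "(\<lambda>t. (- (\<i> * of_real t)) ^ k * iexp (- (t * x)) * \<phi> t) \<in> borel_measurable lborel" .
qed (simp add: norm_mult norm_power power_abs)

lemma fourier_inv_deriv:
  assumes "integrable lborel (\<lambda>t. t ^ k *\<^sub>R \<phi> t)" "integrable lborel (\<lambda>t. t ^ Suc k *\<^sub>R \<phi> t)"
  shows "(fourier_inv \<phi> k has_vector_derivative fourier_inv \<phi> (Suc k) x) (at x)"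
proof -
  have "((\<lambda>x. \<integral>t. (- (\<i> * of_real t)) ^ k * iexp (- (t * x)) * \<phi> t \<partial>lborel) has_vector_derivative
      (\<integral>t. (- (\<i> * of_real t)) ^ Suc k * iexp (- (t * x)) * \<phi> t \<partial>lborel)) (at x within UNIV)"
  proof (rule has_vector_derivative_integral[where G = "\<lambda>t. norm (t ^ Suc k *\<^sub>R \<phi> t)"])
    show "integrable lborel (\<lambda>t. norm (t ^ Suc k *\<^sub>R \<phi> t))" by (rule integrable_norm[OF assms(2)])
    show "(\<lambda>t. (- (\<i> * of_real t)) ^ Suc k * iexp (- (t * x)) * \<phi> t) \<in> borel_measurable lborel"
      by (rule borel_measurable_integrable[OF integrable_damped[OF assms(2)]])
    show "((\<lambda>x. (- (\<i> * of_real t)) ^ k * iexp (- (t * x)) * \<phi> t) has_vector_derivative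
        (- (\<i> * of_real t)) ^ Suc k * iexp (- (t * s)) * \<phi> t) (at s within UNIV)" for s t
    proof -
      have "((\<lambda>z. (- (\<i> * of_real t)) ^ k * exp (\<i> * (- (of_real t * z))) * \<phi> t) has_field_derivative
          (- (\<i> * of_real t)) ^ Suc k * exp (\<i> * (- (of_real t * of_real s))) * \<phi> t) (at (of_real s))"
        by (auto intro!: derivative_eq_intros simp: algebra_simps)
      from has_vector_derivative_real_field[OF this] show ?thesis by simp
    qed
    show "integrable lborel (\<lambda>t. (- (\<i> * of_real t)) ^ k * iexp (- (t * s)) * \<phi> t)" for s
      by (rule integrable_damped[OF assms(1)])
    show "norm ((- (\<i> * of_real t)) ^ Suc k * iexp (- (t * s)) * \<phi> t) \<le> norm (t ^ Suc k *\<^sub>R \<phi> t)" for s t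
      by (simp add: norm_mult norm_power power_abs abs_mult)
  qed auto
  then have "((\<lambda>x. of_real (1 / (2 * pi)) * (\<integral>t. (- (\<i> * of_real t)) ^ k * iexp (- (t * x)) * \<phi> t \<partial>lborel)) has_vector_derivative
      of_real (1 / (2 * pi)) * (\<integral>t. (- (\<i> * of_real t)) ^ Suc k * iexp (- (t * x)) * \<phi> t \<partial>lborel)) (at x)"
    by (intro has_vector_derivative_mult_right) simp
  then show ?thesis by (simp only: fourier_inv_def[abs_def])
qed

lemma Re_fourier_inv_deriv:
  assumes "integrable lborel (\<lambda>t. t ^ k *\<^sub>R \<phi> t)" "integrable lborel (\<lambda>t. t ^ Suc k *\<^sub>R \<phi> t)"
  shows "((\<lambda>x. Re (fourier_inv \<phi> k x)) has_real_derivative Re (fourier_inv \<phi> (Suc k) x)) (at x)"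
  using bounded_linear.has_vector_derivative[OF bounded_linear_Re fourier_inv_deriv[OF assms]]
  by (simp add: has_real_derivative_iff_has_vector_derivative)

lemma Re_fourier_inv_deriv_funpow:
  assumes "\<And>k. k \<le> p \<Longrightarrow> integrable lborel (\<lambda>t. t ^ k *\<^sub>R \<phi> t)" "k \<le> p"
  shows "(deriv ^^ k) (\<lambda>x. Re (fourier_inv \<phi> 0 x)) = (\<lambda>x. Re (fourier_inv \<phi> k x))"
  using assms(2)
proof (induction k)
  case (Suc k)
  then have "(deriv ^^ Suc k) (\<lambda>x. Re (fourier_inv \<phi> 0 x)) = deriv (\<lambda>x. Re (fourier_inv \<phi> k x))"
    by simp
  also have "\<dots> = (\<lambda>x. Re (fourier_inv \<phi> (Suc k) x))"
    by (intro ext DERIV_imp_deriv Re_fourier_inv_deriv assms(1)) (use Suc.prems in auto)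
  finally show ?case .
qed simp

text \<open>Integrability is asked one order beyond \<open>p\<close>, since continuity of the last
  derivative is obtained from its differentiability.\<close>

lemma Ck_Re_fourier_inv:
  assumes "\<And>k. k \<le> Suc p \<Longrightarrow> integrable lborel (\<lambda>t. t ^ k *\<^sub>R \<phi> t)"
  shows "Ck p (\<lambda>x. Re (fourier_inv \<phi> 0 x))"
proof -
  have D: "(deriv ^^ k) (\<lambda>x. Re (fourier_inv \<phi> 0 x)) = (\<lambda>x. Re (fourier_inv \<phi> k x))" if "k \<le> p" for k
    using that by (intro Re_fourier_inv_deriv_funpow[of "Suc p"] assms) auto
  have d: "((\<lambda>x. Re (fourier_inv \<phi> k x)) has_real_derivative Re (fourier_inv \<phi> (Suc k) x)) (at x)" if "k \<le> p" for k x
    using that by (intro Re_fourier_inv_deriv assms) auto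
  show ?thesis
    unfolding Ck_def
  proof (intro conjI allI impI)
    fix k x assume "k < p"
    then show "(deriv ^^ k) (\<lambda>x. Re (fourier_inv \<phi> 0 x)) differentiable at x"
      using D[of k] d[of k x] real_differentiable_def by auto
  next
    show "continuous_on UNIV ((deriv ^^ p) (\<lambda>x. Re (fourier_inv \<phi> 0 x)))"
      unfolding D[OF order.refl]
      using d[OF order.refl] by (intro continuous_at_imp_continuous_on ballI) (blast intro: DERIV_isCont)
  qed
qed

text \<open>The exponential has modulus 1, so the bound is uniform in \<open>x\<close>; the factor
  \<open>1 / (2 * pi)\<close> is estimated by 1.\<close>

lemma fourier_inv_diff_bound:
  assumes "integrable lborel (\<lambda>t. t ^ k *\<^sub>R \<phi> t)" "integrable lborel (\<lambda>t. t ^ k *\<^sub>R \<psi> t)"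
  shows "\<bar>Re (fourier_inv \<phi> k x) - Re (fourier_inv \<psi> k x)\<bar> \<le> (\<integral>t. \<bar>t\<bar> ^ k * norm (\<phi> t - \<psi> t) \<partial>lborel)"
proof -
  have i: "integrable lborel (\<lambda>t. t ^ k *\<^sub>R (\<phi> t - \<psi> t))"
    using Bochner_Integration.integrable_diff[OF assms] by (simp add: scaleR_diff_right)
  define D where "D = (\<integral>t. (- (\<i> * of_real t)) ^ k * iexp (- (t * x)) * (\<phi> t - \<psi> t) \<partial>lborel)"
  have eq: "fourier_inv \<phi> k x - fourier_inv \<psi> k x = of_real (1 / (2 * pi)) * D"
    unfolding fourier_inv_def D_def right_diff_distrib
    by (subst Bochner_Integration.integral_diff[OF integrable_damped[OF assms(1)] integrable_damped[OF assms(2)]])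
      (simp only: right_diff_distrib)
  have D: "norm D \<le> (\<integral>t. \<bar>t\<bar> ^ k * norm (\<phi> t - \<psi> t) \<partial>lborel)"
    unfolding D_def
    by (rule norm_integral_le_AE[OF integrable_damped[OF i]])
      (use integrable_norm[OF i] in \<open>simp_all add: norm_mult norm_power power_abs\<close>)
  have "\<bar>Re (fourier_inv \<phi> k x) - Re (fourier_inv \<psi> k x)\<bar> \<le> norm (fourier_inv \<phi> k x - fourier_inv \<psi> k x)"
    using abs_Re_le_cmod[of "fourier_inv \<phi> k x - fourier_inv \<psi> k x"] by simp
  also have "\<dots> = 1 / (2 * pi) * norm D" unfolding eq norm_mult norm_of_real by simp
  also have "\<dots> \<le> 1 * norm D" using pi_gt3 by (intro mult_right_mono) (auto simp: field_simps)
  finally show ?thesis using D by simp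
qed

text \<open>Levy's formula gives the mass of \<open>{a<..b}\<close> as an increment of
  \<open>H\<close>, but only for end points that are not atoms. Integrability of the characteristic
  function makes \<open>H\<close> Lipschitz, which excludes atoms. Then \<open>Re (H x)\<close> is
  the distribution function up to a constant, and its derivative is the density.\<close>

lemma distribution_density_fourier_inv:
  assumes M: "real_distribution M" and int: "integrable lborel (char M)"
  shows "M = density lborel (\<lambda>x. ennreal (Re (fourier_inv (char M) 0 x)))" (is ?dens)
    and "0 \<le> Re (fourier_inv (char M) 0 x)"
    and "(\<lambda>x. Re (fourier_inv (char M) 0 x)) \<in> borel_measurable borel"
proof -
  interpret real_distribution M by fact
  let ?\<phi> = "char M"
  \<comment> \<open>primitive of \<open>iexp (- (t * x))\<close> in \<open>x\<close>; the value at \<open>t = 0\<close> is not the junk value of the quotient\<close>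
  define \<kappa> where "\<kappa> x t = (if t = 0 then complex_of_real x else (1 - iexp (- (t * x))) / (\<i> * of_real t))" for x t :: real
  have [measurable]: "\<kappa> x \<in> borel_measurable borel" for x
    unfolding \<kappa>_def[abs_def] by measurable
  have d\<kappa>: "((\<lambda>x. \<kappa> x t) has_vector_derivative iexp (- (t * x))) (at x)" for x t
  proof (cases "t = 0")
    case True
    then show ?thesis unfolding \<kappa>_def
      using has_vector_derivative_real_field[OF DERIV_ident] by simp
  next
    case False
    have "((\<lambda>z. (1 - exp (\<i> * (- (of_real t * z)))) / (\<i> * of_real t)) has_field_derivative
        exp (\<i> * (- (of_real t * of_real x)))) (at (of_real x))"
      using False by (auto intro!: derivative_eq_intros simp: algebra_simps)
    from has_vector_derivative_real_field[OF this] show ?thesis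
      using False by (simp add: \<kappa>_def)
  qed
  have \<kappa>_diff: "norm (\<kappa> b t - \<kappa> a t) \<le> \<bar>b - a\<bar>" for a b t
  proof -
    have "norm (\<kappa> b t - \<kappa> a t) \<le> 1 * norm (b - a)"
    proof (rule differentiable_bound[where S = UNIV])
      show "((\<lambda>x. \<kappa> x t) has_derivative (\<lambda>h. h *\<^sub>R iexp (- (t * x)))) (at x within UNIV)" for x
        using d\<kappa> by (simp add: has_vector_derivative_def)
      show "onorm (\<lambda>h. h *\<^sub>R iexp (- (t * x))) \<le> 1" for x
        by (rule onorm_scaleR_left_le) simp
    qed auto
    then show ?thesis by simp
  qed
  have \<kappa>0: "\<kappa> 0 t = 0" for t by (simp add: \<kappa>_def)
  have int\<kappa>: "integrable lborel (\<lambda>t. (\<kappa> b t - \<kappa> a t) * ?\<phi> t)" for a b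
  proof (rule Bochner_Integration.integrable_bound)
    show "integrable lborel (\<lambda>t. \<bar>b - a\<bar> * norm (?\<phi> t))" using int by auto
    show "AE t in lborel. norm ((\<kappa> b t - \<kappa> a t) * ?\<phi> t) \<le> norm (\<bar>b - a\<bar> * norm (?\<phi> t))"
      by (auto simp: norm_mult intro!: mult_right_mono \<kappa>_diff)
  qed measurable
  define H where "H x = of_real (1 / (2 * pi)) * (\<integral>t. \<kappa> x t * ?\<phi> t \<partial>lborel)" for x
  have int\<kappa>0: "integrable lborel (\<lambda>t. \<kappa> x t * ?\<phi> t)" for x
    using int\<kappa>[of x 0] by (simp add: \<kappa>0)
  have H_diff: "H b - H a = of_real (1 / (2 * pi)) * (\<integral>t. (\<kappa> b t - \<kappa> a t) * ?\<phi> t \<partial>lborel)" for a b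
    unfolding H_def left_diff_distrib right_diff_distrib[symmetric]
    by (subst Bochner_Integration.integral_diff[OF int\<kappa>0 int\<kappa>0]) (rule refl)
  have dH: "(H has_vector_derivative fourier_inv ?\<phi> 0 x) (at x)" for x
  proof -
    have "((\<lambda>x. \<integral>t. \<kappa> x t * ?\<phi> t \<partial>lborel) has_vector_derivative (\<integral>t. iexp (- (t * x)) * ?\<phi> t \<partial>lborel)) (at x within UNIV)"
    proof (rule has_vector_derivative_integral[where G = "\<lambda>t. norm (?\<phi> t)"])
      show "((\<lambda>x. \<kappa> x t * ?\<phi> t) has_vector_derivative iexp (- (t * s)) * ?\<phi> t) (at s within UNIV)" for s t
        using d\<kappa> by (intro has_vector_derivative_mult_left) auto
    qed (use int in \<open>auto simp: int\<kappa>0 norm_mult\<close>)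
    then have "((\<lambda>x. of_real (1 / (2 * pi)) * (\<integral>t. \<kappa> x t * ?\<phi> t \<partial>lborel)) has_vector_derivative
        of_real (1 / (2 * pi)) * (\<integral>t. iexp (- (t * x)) * ?\<phi> t \<partial>lborel)) (at x)"
      by (intro has_vector_derivative_mult_right) simp
    then show ?thesis by (simp only: H_def[abs_def] fourier_inv_def power_0 mult_1)
  qed
  have levy: "complex_of_real (measure M {a<..b}) = H b - H a"
    if "a \<le> b" "measure M {a} = 0" "measure M {b} = 0" for a b
  proof (rule LIMSEQ_unique[OF Levy_Inversion[OF that]])
    have "(\<lambda>n. \<integral>t. indicator {- real n<..real n} t *\<^sub>R ((iexp (- (t * a)) - iexp (- (t * b))) / (\<i> * t) * ?\<phi> t) \<partial>lborel)
        \<longlonglongrightarrow> (\<integral>t. (\<kappa> b t - \<kappa> a t) * ?\<phi> t \<partial>lborel)"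
    proof (rule integral_dominated_convergence[where w = "\<lambda>t. \<bar>b - a\<bar> * norm (?\<phi> t)"])
      have k: "(iexp (- (t * a)) - iexp (- (t * b))) / (\<i> * t) = \<kappa> b t - \<kappa> a t" if "t \<noteq> 0" for t
        using that by (simp add: \<kappa>_def diff_divide_distrib)
      \<comment> \<open>At \<open>t = 0\<close> Levy's integrand has the default value of division
        by zero and may differ from the limit; this is a null set.\<close>
      have nz: "AE t in lborel. t \<noteq> (0::real)" by (rule AE_lborel_singleton)
      show "AE t in lborel. (\<lambda>n. indicator {- real n<..real n} t *\<^sub>R ((iexp (- (t * a)) - iexp (- (t * b))) / (\<i> * t) * ?\<phi> t))
          \<longlonglongrightarrow> (\<kappa> b t - \<kappa> a t) * ?\<phi> t"
        using nz
      proof eventually_elim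
        case (elim t)
        obtain m :: nat where m: "\<bar>t\<bar> < real m" using reals_Archimedean2 by blast
        have "\<forall>\<^sub>F n in sequentially. (\<kappa> b t - \<kappa> a t) * ?\<phi> t =
            indicator {- real n<..real n} t *\<^sub>R ((iexp (- (t * a)) - iexp (- (t * b))) / (\<i> * t) * ?\<phi> t)"
          using eventually_ge_at_top[of m]
        proof eventually_elim
          case (elim n)
          then have "t \<in> {- real n<..real n}" using m by auto
          then show ?case unfolding k[OF \<open>t \<noteq> 0\<close>] by simp
        qed
        then show ?case by (rule Lim_transform_eventually[OF tendsto_const])
      qed
      show "AE t in lborel. norm (indicator {- real n<..real n} t *\<^sub>R ((iexp (- (t * a)) - iexp (- (t * b))) / (\<i> * t) * ?\<phi> t))
          \<le> \<bar>b - a\<bar> * norm (?\<phi> t)" for n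
        using nz
      proof eventually_elim
        case (elim t)
        have "norm ((\<kappa> b t - \<kappa> a t) * ?\<phi> t) \<le> \<bar>b - a\<bar> * norm (?\<phi> t)"
          unfolding norm_mult by (intro mult_right_mono \<kappa>_diff) auto
        then show ?case unfolding k[OF elim] by (auto simp: indicator_def)
      qed
    qed (use int in auto)
    then have "(\<lambda>n. of_real (1 / (2 * pi)) * (\<integral>t. indicator {- real n<..real n} t *\<^sub>R ((iexp (- (t * a)) - iexp (- (t * b))) / (\<i> * t) * ?\<phi> t) \<partial>lborel))
        \<longlonglongrightarrow> H b - H a"
      unfolding H_diff by (intro tendsto_mult_left)
    moreover have "(CLBINT t=-T..T. (iexp (- (t * a)) - iexp (- (t * b))) / (\<i> * t) * ?\<phi> t) =
       (\<integral>t. indicator {- real T<..real T} t *\<^sub>R ((iexp (- (t * a)) - iexp (- (t * b))) / (\<i> * t) * ?\<phi> t) \<partial>lborel)" for T :: nat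
      using interval_integral_Ioc[of "- real T" "real T" "\<lambda>t. (iexp (- (t * a)) - iexp (- (t * b))) / (\<i> * t) * ?\<phi> t"]
      by (simp add: set_lebesgue_integral_def)
    ultimately show "(\<lambda>T. 1 / (2 * pi) * (CLBINT t=-T..T. (iexp (- (t * a)) - iexp (- (t * b))) / (\<i> * t) * ?\<phi> t))
        \<longlonglongrightarrow> H b - H a" by simp
  qed
  define L where "L = (\<integral>t. norm (?\<phi> t) \<partial>lborel)"
  have L0: "L \<ge> 0" by (simp add: L_def)
  have H_lip: "norm (H b - H a) \<le> L * \<bar>b - a\<bar>" for a b
  proof -
    have "norm (\<integral>t. (\<kappa> b t - \<kappa> a t) * ?\<phi> t \<partial>lborel) \<le> (\<integral>t. \<bar>b - a\<bar> * norm (?\<phi> t) \<partial>lborel)"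
      by (rule norm_integral_le_AE[OF int\<kappa>]) (use int \<kappa>_diff in \<open>auto simp: norm_mult intro!: mult_right_mono\<close>)
    also have "\<dots> = L * \<bar>b - a\<bar>" by (simp add: L_def)
    finally have 1: "norm (\<integral>t. (\<kappa> b t - \<kappa> a t) * ?\<phi> t \<partial>lborel) \<le> L * \<bar>b - a\<bar>" .
    have "norm (H b - H a) = 1 / (2 * pi) * norm (\<integral>t. (\<kappa> b t - \<kappa> a t) * ?\<phi> t \<partial>lborel)"
      unfolding H_diff norm_mult norm_of_real by simp
    also have "\<dots> \<le> 1 * norm (\<integral>t. (\<kappa> b t - \<kappa> a t) * ?\<phi> t \<partial>lborel)"
      using pi_gt3 by (intro mult_right_mono) (auto simp: field_simps)
    finally show ?thesis using 1 by simp
  qed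
  have no_atoms: "measure M {c} = 0" for c
  proof (rule ccontr)
    assume "measure M {c} \<noteq> 0"
    then have c: "measure M {c} > 0" by (simp add: zero_less_measure_iff)
    \<comment> \<open>An interval around \<open>c\<close> shorter than \<open>2 * \<epsilon>\<close>
      has mass at most \<open>2 * L * \<epsilon>\<close>, less than the supposed atom;
      \<open>L + 1\<close> keeps the denominator positive. Admissible end points exist because atoms
      are countable.\<close>
    define \<epsilon> where "\<epsilon> = measure M {c} / (2 * (L + 1))"
    have \<epsilon>: "\<epsilon> > 0" using c L0 by (simp add: \<epsilon>_def)
    obtain a where a: "c - \<epsilon> < a" "a < c" "measure M {a} = 0"
      using open_minus_countable[OF countable_support, of "{c - \<epsilon><..<c}"] \<epsilon> by auto
    obtain b where b: "c < b" "b < c + \<epsilon>" "measure M {b} = 0"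
      using open_minus_countable[OF countable_support, of "{c<..<c + \<epsilon>}"] \<epsilon> by auto
    have "measure M {c} \<le> measure M {a<..b}" using a b by (intro finite_measure_mono) auto
    also have "\<dots> = norm (H b - H a)" using arg_cong[OF levy[of a b], of norm] a b by simp
    also have "\<dots> \<le> L * \<bar>b - a\<bar>" by (rule H_lip)
    also have "\<dots> \<le> L * (2 * \<epsilon>)" using a b L0 by (intro mult_left_mono) auto
    also have "\<dots> < (L + 1) * (2 * \<epsilon>)" using \<epsilon> by (intro mult_strict_right_mono) auto
    also have "\<dots> = measure M {c}"
    proof -
      have "L + 1 \<noteq> 0" using L0 by linarith
      then show ?thesis by (simp add: \<epsilon>_def del: distrib_left_numeral)
    qed
    finally show False by simp
  qed
  have meas: "measure M {a<..b} = Re (H b) - Re (H a)" if "a \<le> b" for a b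
    using arg_cong[OF levy[OF that no_atoms no_atoms], of Re] by simp
  have dR: "((\<lambda>x. Re (H x)) has_real_derivative Re (fourier_inv ?\<phi> 0 x)) (at x)" for x
    using bounded_linear.has_vector_derivative[OF bounded_linear_Re dH[of x]]
    by (simp add: has_real_derivative_iff_has_vector_derivative)
  \<comment> \<open>Increments of \<open>Re (H x)\<close> are probabilities; nonnegativity of the
    derivative follows for every \<open>x\<close>, not just almost everywhere.\<close>
  have "mono_on UNIV (\<lambda>x. Re (H x))"
  proof (rule mono_onI)
    fix a b :: real assume "a \<le> b"
    then show "Re (H a) \<le> Re (H b)" using meas[of a b] measure_nonneg[of M "{a<..b}"] by linarith
  qed
  from mono_on_imp_deriv_nonneg[OF this dR]
  show nonneg: "0 \<le> Re (fourier_inv ?\<phi> 0 x)" for x by simp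
  show bm: "(\<lambda>x. Re (fourier_inv ?\<phi> 0 x)) \<in> borel_measurable borel"
  proof -
    have "(\<lambda>x. \<integral>t. iexp (- (t * x)) * ?\<phi> t \<partial>lborel) \<in> borel_measurable borel" by measurable
    then show ?thesis unfolding fourier_inv_def by simp
  qed
  have dens: "emeasure (density lborel (\<lambda>x. ennreal (Re (fourier_inv ?\<phi> 0 x)))) {a<..b} = ennreal (Re (H b) - Re (H a))"
    if "a \<le> b" for a b
  proof -
    have "emeasure (density lborel (\<lambda>x. ennreal (Re (fourier_inv ?\<phi> 0 x)))) {a<..b} =
        (\<integral>\<^sup>+x. ennreal (Re (fourier_inv ?\<phi> 0 x)) * indicator {a<..b} x \<partial>lborel)"
      using bm by (intro emeasure_density) auto
    \<comment> \<open>Closing the interval adds a null set and prepares for the fundamental theorem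
      on \<open>{a..b}\<close>.\<close>
    also have "\<dots> = (\<integral>\<^sup>+x. ennreal (Re (fourier_inv ?\<phi> 0 x)) * indicator {a..b} x \<partial>lborel)"
      by (rule nn_integral_cong_AE, use AE_lborel_singleton[of a] in eventually_elim) (auto simp: indicator_def)
    also have "\<dots> = ennreal (Re (H b) - Re (H a))"
      by (rule nn_integral_FTC_Icc[OF bm dR nonneg that])
    finally show ?thesis .
  qed
  show ?dens
  proof (rule measure_eqI_generator_eq[where \<Omega> = UNIV and E = "range (\<lambda>(a, b). {a<..b::real})" and A = "\<lambda>i. {- real (i::nat)<..real i}"])
    fix X assume "X \<in> range (\<lambda>(a, b). {a<..b::real})"
    then obtain a b where X: "X = {a<..b}" by auto
    show "emeasure M X = emeasure (density lborel (\<lambda>x. ennreal (Re (fourier_inv ?\<phi> 0 x)))) X"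
      using dens[of a b] meas[of a b] by (cases "a \<le> b") (auto simp: X emeasure_eq_measure)
  next
    show "(\<Union>i. {- real (i::nat)<..real i}) = UNIV"
      by (rule UN_Ioc_eq_UNIV)
  qed (auto simp: borel_sigma_sets_Ioc Int_stable_def M_is_borel)
qed

section \<open>Operators and sections\<close>

text \<open>
  With \<open>c = onorm T\<close>, symmetry gives \<open>|(T\<^sup>2 - c\<^sup>2) x|\<^sup>2 \<le> c\<^sup>2 (c\<^sup>2 |x|\<^sup>2 - |T x|\<^sup>2)\<close>, so \<open>T - c\<close> and
  \<open>T + c\<close> cannot both have bounded inverses. No completeness is involved.
\<close>

lemma norm_le_spectral_radius:
  fixes T :: "'a::real_inner \<Rightarrow> 'a"
  assumes T: "bounded_linear T" and sym: "symmetric_op T" and r: "r > 0" "spectral_radius T < ereal r"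
  shows "norm (T x) \<le> r * norm x"
proof -
  interpret T: bounded_linear T by fact
  define c where "c = onorm T"
  have Tc: "norm (T x) \<le> c * norm x" for x unfolding c_def by (rule onorm[OF T])
  have "c < r"
  proof (rule ccontr)
    assume "\<not> c < r"
    then have c: "c \<ge> r" "c > 0" using r by auto
    have notspec: "d \<notin> op_spectrum T" if "\<bar>d\<bar> = c" for d
    proof
      assume "d \<in> op_spectrum T"
      then have "ereal \<bar>d\<bar> \<le> spectral_radius T" unfolding spectral_radius_def by (rule SUP_upper)
      then have "ereal \<bar>d\<bar> < ereal r" using r(2) by (rule order.strict_trans1)
      then show False using that c by simp
    qed
    obtain R1 where R1: "bounded_linear R1" "\<And>x. R1 (T x - c *\<^sub>R x) = x"
      using notspec[of c] c unfolding op_spectrum_def by auto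
    obtain R2 where R2: "bounded_linear R2" "\<And>x. R2 (T x - (- c) *\<^sub>R x) = x"
      using notspec[of "- c"] c unfolding op_spectrum_def by auto
    define K where "K = onorm R2 * onorm R1 + 1"
    have K: "K > 0" using onorm_pos_le[OF R1(1)] onorm_pos_le[OF R2(1)] by (simp add: K_def add_nonneg_pos)
    have inv: "norm x \<le> K * norm (T (T x) - c\<^sup>2 *\<^sub>R x)" for x
    proof -
      \<comment> \<open>\<open>T\<^sup>2 - c\<^sup>2\<close> factors as
        \<open>(T - c) (T + c)\<close>, so \<open>R1\<close> and \<open>R2\<close> undo it one after
        the other.\<close>
      define y where "y = T x - (- c) *\<^sub>R x"
      have y: "T y - c *\<^sub>R y = T (T x) - c\<^sup>2 *\<^sub>R x"
        by (simp add: y_def T.add T.scaleR power2_eq_square algebra_simps)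
      have "norm x = norm (R2 y)" unfolding y_def R2(2) ..
      also have "\<dots> \<le> onorm R2 * norm y" by (rule onorm[OF R2(1)])
      also have "norm y = norm (R1 (T (T x) - c\<^sup>2 *\<^sub>R x))" unfolding y[symmetric] R1(2) ..
      also have "onorm R2 * norm (R1 (T (T x) - c\<^sup>2 *\<^sub>R x)) \<le> onorm R2 * (onorm R1 * norm (T (T x) - c\<^sup>2 *\<^sub>R x))"
        by (intro mult_left_mono onorm[OF R1(1)] onorm_pos_le[OF R2(1)])
      also have "\<dots> \<le> K * norm (T (T x) - c\<^sup>2 *\<^sub>R x)"
        by (simp add: K_def distrib_right mult.assoc)
      finally show ?thesis .
    qed
    have sq: "(norm (T (T x) - c\<^sup>2 *\<^sub>R x))\<^sup>2 \<le> c\<^sup>2 * (c\<^sup>2 * (norm x)\<^sup>2 - (norm (T x))\<^sup>2)" for x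
    proof -
      have "(norm (T (T x) - c\<^sup>2 *\<^sub>R x))\<^sup>2 = (norm (T (T x)))\<^sup>2 - 2 * c\<^sup>2 * inner (T (T x)) x + c\<^sup>2 * c\<^sup>2 * (norm x)\<^sup>2"
        unfolding power2_norm_eq_inner
        by (simp add: inner_diff_left inner_diff_right inner_commute algebra_simps)
      also have "inner (T (T x)) x = (norm (T x))\<^sup>2"
        using sym by (simp add: symmetric_op_def power2_norm_eq_inner)
      also have "(norm (T (T x)))\<^sup>2 \<le> (c * norm (T x))\<^sup>2" by (intro power_mono Tc) simp
      finally show ?thesis by (simp add: power_mult_distrib algebra_simps)
    qed
    \<comment> \<open>Together \<open>inv\<close> and \<open>sq\<close> improve the bound
      \<open>c\<close> to the root of \<open>c\<^sup>2 - 1 / (K\<^sup>2 * c\<^sup>2)\<close>,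
      against the minimality of the operator norm. The maximum with 0 keeps the root
      meaningful.\<close>
    define s where "s = max 0 (c\<^sup>2 - 1 / (K\<^sup>2 * c\<^sup>2))"
    have "norm (T x) \<le> sqrt s * norm x" for x
    proof (rule power2_le_imp_le)
      have "(norm x)\<^sup>2 \<le> (K * norm (T (T x) - c\<^sup>2 *\<^sub>R x))\<^sup>2" by (intro power_mono inv) simp
      also have "\<dots> \<le> K\<^sup>2 * (c\<^sup>2 * (c\<^sup>2 * (norm x)\<^sup>2 - (norm (T x))\<^sup>2))"
        unfolding power_mult_distrib by (intro mult_left_mono sq) simp
      finally have "(norm (T x))\<^sup>2 \<le> (c\<^sup>2 - 1 / (K\<^sup>2 * c\<^sup>2)) * (norm x)\<^sup>2"
        using K c by (simp add: field_simps)
      also have "\<dots> \<le> s * (norm x)\<^sup>2" by (intro mult_right_mono) (simp_all add: s_def)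
      finally show "(norm (T x))\<^sup>2 \<le> (sqrt s * norm x)\<^sup>2" by (simp add: power_mult_distrib s_def)
    qed (simp add: s_def)
    then have "c \<le> sqrt s" unfolding c_def by (intro onorm_bound) (simp_all add: s_def)
    then have "c\<^sup>2 \<le> s" using c power_mono[of c "sqrt s" 2] by (simp add: s_def)
    moreover have "K\<^sup>2 * c\<^sup>2 > 0" using K c by simp
    ultimately show False using c by (simp add: s_def max_def split: if_splits)
  qed
  then have "c * norm x \<le> r * norm x" by (intro mult_right_mono) auto
  then show ?thesis using Tc[of x] by linarith
qed

text \<open>\<open>T\<close> is applied to the vector with coordinates \<open>y\<close> on
  \<open>S\<close> and 0 elsewhere; discarding the coordinates outside \<open>R\<close> only
  decreases the norm.\<close>

lemma op_bound_mat_entry: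
  assumes T: "bounded_linear T" and nr: "\<And>x. norm (T x) \<le> \<rho> * norm x"
  shows "op_bound (mat_entry T) \<rho>"
  unfolding op_bound_def
proof (intro allI impI)
  fix R S :: "nat set" and y :: "nat \<Rightarrow> real"
  assume fin: "finite R" "finite S"
  interpret T: bounded_linear T by fact
  define v where "v = (\<Sum>j\<in>S. y j *\<^sub>R unit_vec j)"
  have row: "(\<Sum>j\<in>S. mat_entry T i j * y j) = coord (T v) i" for i
    by (simp add: inner_unit_vec[symmetric] v_def T.sum T.scaleR inner_sum_right mat_entry_def mult.commute)
  have uu: "inner (unit_vec j) (unit_vec k) = (if j = k then 1 else 0)" for j k
    by (simp add: inner_unit_vec unit_vec.rep_eq)
  have nv: "(norm v)\<^sup>2 = (\<Sum>j\<in>S. (y j)\<^sup>2)"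
    unfolding power2_norm_eq_inner v_def inner_sum_left inner_sum_right
    using fin by (simp add: uu sum.delta if_distrib power2_eq_square cong: if_cong)
  have "(\<Sum>i\<in>R. (coord (T v) i)\<^sup>2) \<le> (\<Sum>i. (coord (T v) i)\<^sup>2)"
    by (intro sum_le_suminf summable_coord_sq fin) auto
  also have "\<dots> = (norm (T v))\<^sup>2"
    unfolding power2_norm_eq_inner inner_ell2_def by (simp only: power2_eq_square)
  also have "\<dots> \<le> (\<rho> * norm v)\<^sup>2" by (intro power_mono nr) simp
  finally show "(\<Sum>i\<in>R. (\<Sum>j\<in>S. mat_entry T i j * y j)\<^sup>2) \<le> \<rho>\<^sup>2 * (\<Sum>j\<in>S. (y j)\<^sup>2)"
    by (simp add: row power_mult_distrib nv)
qed

section \<open>Passage from finite sections to the whole matrix\<close>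

lemma mat_entry_sym: "symmetric_op T \<Longrightarrow> mat_entry T i j = mat_entry T j i"
  by (simp add: mat_entry_def symmetric_op_def inner_commute)

text \<open>Squares are cofinal among the finite sets of index pairs, so the unordered sums over
  pairs can be evaluated along them.\<close>

lemma filterlim_square_sections:
  "filterlim (\<lambda>N::nat. {..<N} \<times> {..<N}) (finite_subsets_at_top UNIV) sequentially"
  unfolding filterlim_finite_subsets_at_top
proof (intro allI impI)
  fix X :: "(nat \<times> nat) set" assume "finite X \<and> X \<subseteq> UNIV"
  then have "finite (fst ` X \<union> snd ` X)" by auto
  then obtain m where m: "fst ` X \<union> snd ` X \<subseteq> {..<m}" using finite_nat_iff_bounded by blast
  show "\<forall>\<^sub>F N in sequentially. finite ({..<N} \<times> {..<N}) \<and> X \<subseteq> {..<N} \<times> {..<N} \<and> {..<N} \<times> {..<N} \<subseteq> (UNIV :: (nat \<times> nat) set)"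
    using eventually_ge_at_top[of m]
  proof eventually_elim
    case (elim N)
    have "x \<in> {..<N} \<times> {..<N}" if "x \<in> X" for x
    proof -
      have "fst x \<in> {..<m}" "snd x \<in> {..<m}" using m that by auto
      then show ?thesis using elim by (cases x) auto
    qed
    then show ?case by auto
  qed
qed

lemma hilbert_schmidt_sections_tendsto:
  assumes "symmetric_op T" "Hilbert_Schmidt T"
  shows "(\<lambda>N. \<Sum>i<N. \<Sum>j<N. (mat_entry T i j)\<^sup>2) \<longlonglongrightarrow> op_trace (T \<circ> T)"
  using filterlim_compose[OF op_trace_square[OF assms, unfolded has_sum_def] filterlim_square_sections]
  by (simp add: sum.cartesian_product case_prod_beta)

lemma L2_sections_tendsto:
  assumes "has_L2_sum M (\<lambda>(i, j) w. a i j * U i w * U j w) Q UNIV"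
  shows "(\<lambda>N. \<integral>\<^sup>+ w. ennreal ((Q w - quad a {..<N} (\<lambda>i. U i w))\<^sup>2) \<partial>M) \<longlonglongrightarrow> 0"
proof -
  have "(\<Sum>x\<in>{..<N} \<times> {..<N}. (case x of (i, j) \<Rightarrow> \<lambda>w. a i j * U i w * U j w) w) = quad a {..<N} (\<lambda>i. U i w)" for N w
    by (simp add: quad_def sum.cartesian_product case_prod_beta)
  then show ?thesis
    using filterlim_compose[OF assms[unfolded has_L2_sum_def, THEN conjunct2] filterlim_square_sections]
    by simp
qed

lemma norm_iexp_diff_le: "norm (iexp x - iexp y) \<le> \<bar>x - y\<bar>"
proof -
  have "iexp x - iexp y = iexp y * (iexp (x - y) - 1)"
    by (simp add: right_diff_distrib exp_add[symmetric] algebra_simps)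
  then show ?thesis using iexp_approx1[of "x - y" 0] by (simp add: norm_mult)
qed

text \<open>As \<open>iexp\<close> is Lipschitz, the characteristic functions at \<open>t\<close>
  differ by at most \<open>\<bar>t\<bar>\<close> times the distance in mean square.\<close>

lemma char_L2_limit:
  assumes M: "prob_space M" and [measurable]: "Q \<in> borel_measurable M" "\<And>N. X N \<in> borel_measurable M"
    and lim: "(\<lambda>N::nat. \<integral>\<^sup>+ w. ennreal ((Q w - X N w)\<^sup>2) \<partial>M) \<longlonglongrightarrow> 0"
  shows "(\<lambda>N. \<integral>w. iexp (t * X N w) \<partial>M) \<longlonglongrightarrow> char (distr M borel Q) t"
proof -
  interpret prob_space M by fact
  define D where "D N = (\<integral>\<^sup>+ w. ennreal ((Q w - X N w)\<^sup>2) \<partial>M)" for N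
  have D0: "D \<longlonglongrightarrow> 0" using lim by (simp add: D_def[abs_def])
  \<comment> \<open>Single terms may be infinite; from some index on they are below 1, and the
    squared distance becomes integrable.\<close>
  have fin: "\<forall>\<^sub>F N in sequentially. D N < 1"
    using order_tendstoD(2)[OF D0, of 1] by simp
  have charQ: "char (distr M borel Q) t = (\<integral>w. iexp (t * Q w) \<partial>M)"
    unfolding char_def by (rule integral_distr) auto
  have ie: "integrable M (\<lambda>w. iexp (t * f w))" if [measurable]: "f \<in> borel_measurable M" for f
    by (rule integrable_const_bound[where B = 1]) auto
  have bound: "\<forall>\<^sub>F N in sequentially. (norm ((\<integral>w. iexp (t * X N w) \<partial>M) - char (distr M borel Q) t))\<^sup>2 \<le> t\<^sup>2 * enn2real (D N)"
    using fin
  proof eventually_elim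
    case (elim N)
    have int: "integrable M (\<lambda>w. (Q w - X N w)\<^sup>2)"
      by (rule integrableI_nonneg) (use elim in \<open>auto simp: D_def intro: order.strict_trans\<close>)
    have val: "(\<integral>w. (Q w - X N w)\<^sup>2 \<partial>M) = enn2real (D N)"
      unfolding D_def by (rule integral_eq_nn_integral) auto
    \<comment> \<open>The factor 1/2 brings the modulus down to at most 1, as
      \<open>sq_norm_integral_le\<close> asks.\<close>
    define F where "F w = (iexp (t * X N w) - iexp (t * Q w)) / 2" for w
    have [measurable]: "F \<in> borel_measurable M" unfolding F_def by measurable
    have F1: "norm (F w) \<le> 1" for w
      using norm_triangle_ineq4[of "iexp (t * X N w)" "iexp (t * Q w)"] by (simp add: F_def norm_divide)
    have F2: "(norm (F w))\<^sup>2 \<le> t\<^sup>2 / 4 * (Q w - X N w)\<^sup>2" for w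
    proof -
      have "norm (F w) \<le> \<bar>t * X N w - t * Q w\<bar> / 2"
        using norm_iexp_diff_le[of "t * X N w" "t * Q w"] by (simp add: F_def norm_divide)
      then have "(norm (F w))\<^sup>2 \<le> (\<bar>t * X N w - t * Q w\<bar> / 2)\<^sup>2" by (intro power_mono) auto
      also have "t * X N w - t * Q w = t * (X N w - Q w)" by (simp add: right_diff_distrib)
      also have "(\<bar>t * (X N w - Q w)\<bar> / 2)\<^sup>2 = t\<^sup>2 / 4 * (Q w - X N w)\<^sup>2"
        by (simp add: power_divide power_mult_distrib power2_commute)
      finally show ?thesis .
    qed
    have diff: "(\<integral>w. iexp (t * X N w) \<partial>M) - char (distr M borel Q) t = 2 * (\<integral>w. F w \<partial>M)"
      unfolding F_def charQ
      using Bochner_Integration.integral_diff[OF ie[of "X N"] ie[of Q]] by simp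
    have "(norm (\<integral>w. F w \<partial>M))\<^sup>2 \<le> (\<integral>w. (norm (F w))\<^sup>2 \<partial>M)"
      by (rule sq_norm_integral_le[OF M _ F1]) measurable
    also have "\<dots> \<le> (\<integral>w. t\<^sup>2 / 4 * (Q w - X N w)\<^sup>2 \<partial>M)"
      by (rule integral_mono_AE)
        (use int F2 F1 in \<open>auto intro!: integrable_const_bound[where B = 1] simp: power_le_one\<close>)
    also have "\<dots> = t\<^sup>2 / 4 * enn2real (D N)" by (simp add: val)
    finally show ?case unfolding diff by (simp add: norm_mult power_mult_distrib)
  qed
  have "(\<lambda>N. enn2real (D N)) \<longlonglongrightarrow> 0"
    by (rule tendsto_enn2real) (use D0 in simp_all)
  then have "(\<lambda>N. t\<^sup>2 * enn2real (D N)) \<longlonglongrightarrow> 0"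
    by (rule tendsto_mult_right_zero)
  then have "(\<lambda>N. (norm ((\<integral>w. iexp (t * X N w) \<partial>M) - char (distr M borel Q) t))\<^sup>2) \<longlonglongrightarrow> 0"
    by (intro tendsto_sandwich[OF _ bound tendsto_const]) auto
  then have "(\<lambda>N. norm ((\<integral>w. iexp (t * X N w) \<partial>M) - char (distr M borel Q) t)) \<longlonglongrightarrow> 0"
    using tendsto_real_sqrt[of "\<lambda>N. (norm ((\<integral>w. iexp (t * X N w) \<partial>M) - char (distr M borel Q) t))\<^sup>2" 0] by simp
  then show ?thesis by (simp add: LIM_zero_iff tendsto_norm_zero_iff)
qed

text \<open>\<open>quad\<close> reads only the coordinates of the section, whose joint law is the
  product. The section is \<open>{..<Suc N}\<close> because independence is expressed by the joint
  law over a nonempty index set.\<close>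

lemma qchar_eq_expectation:
  assumes M: "prob_space M" and ind: "prob_space.indep_vars M (\<lambda>_. borel) U UNIV"
    and unif: "\<And>i. distr M lborel (U i) = unif"
  shows "(\<integral>w. iexp (t * quad a {..<Suc N} (\<lambda>i. U i w)) \<partial>M) = qchar a {..<Suc N} t"
proof -
  interpret prob_space M by fact
  let ?A = "{..<Suc N}"
  have [measurable]: "U i \<in> borel_measurable M" for i
    using ind by (auto simp: indep_vars_def)
  have d: "distr M borel (U i) = unif" for i
    using unif[of i] by (simp cong: distr_cong)
  have iU: "indep_vars (\<lambda>_. borel) U ?A" by (rule indep_vars_subset[OF ind]) simp
  have "distr M (PiM ?A (\<lambda>_. borel)) (\<lambda>w. \<lambda>i\<in>?A. U i w) = PiM ?A (\<lambda>i. distr M borel (U i))"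
    using iU by (subst (asm) indep_vars_iff_distr_eq_PiM') auto
  then have P: "PiM ?A (\<lambda>_. unif) = distr M (PiM ?A (\<lambda>_. borel)) (\<lambda>w. \<lambda>i\<in>?A. U i w)"
    by (simp only: d)
  have [measurable]: "quad a ?A \<in> borel_measurable (PiM ?A (\<lambda>_. borel))"
    unfolding quad_def[abs_def] by measurable
  have "qchar a ?A t = (\<integral>w. iexp (t * quad a ?A (\<lambda>i\<in>?A. U i w)) \<partial>M)"
    unfolding qchar_def P by (rule integral_distr) auto
  then show ?thesis by (simp add: quad_def)
qed

section \<open>Convergence of densities\<close>

lemma fourier_inv_gaussian:
  "Re (fourier_inv (\<lambda>t. complex_of_real (exp (- (t\<^sup>2 / 9)))) 0 x) = normal_density 0 (sqrt (2 / 9)) x"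
proof -
  \<comment> \<open>The substitution \<open>t = c * s\<close> with \<open>c\<^sup>2 = 9 / 2\<close>
    turns \<open>t\<^sup>2 / 9\<close> into \<open>s\<^sup>2 / 2\<close>, so the integral becomes
    the standard normal characteristic function at \<open>- (c * x)\<close>.\<close>
  define c :: real where "c = 3 / sqrt 2"
  have c: "c > 0" "c\<^sup>2 = 9 / 2" by (simp_all add: c_def power_divide)
  have "(\<integral>t. iexp (- (t * x)) * of_real (exp (- (t\<^sup>2 / 9))) \<partial>lborel) =
      \<bar>c\<bar> *\<^sub>R (\<integral>s. iexp (- ((0 + c * s) * x)) * of_real (exp (- ((0 + c * s)\<^sup>2 / 9))) \<partial>lborel)"
    using c by (intro lborel_integral_real_affine) auto
  also have "(\<integral>s. iexp (- ((0 + c * s) * x)) * of_real (exp (- ((0 + c * s)\<^sup>2 / 9))) \<partial>lborel)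
      = (\<integral>s. of_real (sqrt (2 * pi)) * (std_normal_density s *\<^sub>R iexp ((- (c * x)) * s)) \<partial>lborel)"
  proof (intro Bochner_Integration.integral_cong refl)
    fix s :: real
    have 1: "(0 + c * s)\<^sup>2 / 9 = s\<^sup>2 / 2" by (simp add: power_mult_distrib c(2))
    have 2: "exp (- (s\<^sup>2 / 2)) = sqrt (2 * pi) * std_normal_density s"
      by (simp add: std_normal_density_def)
    have 3: "- ((0 + c * s) * x) = (- (c * x)) * s" by simp
    show "iexp (- ((0 + c * s) * x)) * of_real (exp (- ((0 + c * s)\<^sup>2 / 9)))
        = of_real (sqrt (2 * pi)) * (std_normal_density s *\<^sub>R iexp ((- (c * x)) * s))"
      unfolding 1 2 3 by (simp add: scaleR_conv_of_real mult_ac)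
  qed
  also have "\<dots> = of_real (sqrt (2 * pi)) * (\<integral>s. std_normal_density s *\<^sub>R iexp ((- (c * x)) * s) \<partial>lborel)"
    by (rule integral_mult_right_zero)
  also have "(\<integral>s. std_normal_density s *\<^sub>R iexp ((- (c * x)) * s) \<partial>lborel) = char std_normal_distribution (- (c * x))"
    unfolding char_def by (subst integral_density) auto
  also have "of_real (sqrt (2 * pi)) * \<dots> = of_real (sqrt (2 * pi) * exp (- (9 * x\<^sup>2 / 4)))"
    unfolding char_std_normal_distribution by (simp add: power_mult_distrib c(2))
  finally have I: "(\<integral>t. iexp (- (t * x)) * of_real (exp (- (t\<^sup>2 / 9))) \<partial>lborel) =
      complex_of_real (c * (sqrt (2 * pi) * exp (- (9 * x\<^sup>2 / 4))))"
    using c(1) by (simp add: scaleR_conv_of_real)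
  have "Re (fourier_inv (\<lambda>t. complex_of_real (exp (- (t\<^sup>2 / 9)))) 0 x) =
      1 / (2 * pi) * (c * (sqrt (2 * pi) * exp (- (9 * x\<^sup>2 / 4))))"
    unfolding fourier_inv_def power_0 mult_1 I of_real_mult[symmetric] Re_complex_of_real ..
  also have "\<dots> = normal_density 0 (sqrt (2 / 9)) x"
  proof -
    have "1 / (2 * pi) * (c * sqrt (2 * pi)) = 1 / sqrt (2 * pi * (2 / 9))"
    proof (rule power2_eq_imp_eq)
      show "(1 / (2 * pi) * (c * sqrt (2 * pi)))\<^sup>2 = (1 / sqrt (2 * pi * (2 / 9)))\<^sup>2"
        by (simp add: power_mult_distrib power_divide c(2) real_sqrt_pow2) (simp add: power2_eq_square field_simps)
    qed (use c in auto)
    then show ?thesis by (simp add: normal_density_def mult.assoc[symmetric])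
  qed
  finally show ?thesis .
qed

text \<open>The bounds for sections depend on the section only through its squared Hilbert-Schmidt
  norm, which tends to 1 and in particular exceeds 1/2 eventually; they pass to the limit of the
  characteristic functions.\<close>

lemma char_quadratic_form:
  assumes T: "symmetric_op T" "Hilbert_Schmidt T" "\<And>i. mat_entry T i i = 0" "op_trace (T \<circ> T) = 1"
    and M: "prob_space M" and ind: "prob_space.indep_vars M (\<lambda>_. borel) U UNIV"
    and unif: "\<And>i. distr M lborel (U i) = unif"
    and Q: "has_L2_sum M (\<lambda>(i, j) w. mat_entry T i j * U i w * U j w) Q UNIV"
    and \<rho>: "op_bound (mat_entry T) \<rho>" "\<rho> > 0"
  shows char_quadratic_form_decay: "\<bar>t\<bar> \<ge> 1 \<Longrightarrow> norm (char (distr M borel Q) t) \<le>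
      ((2 + 2 / \<rho>) * \<bar>t\<bar> powr (- 1 / 4)) powr (1 / (16 * \<rho>\<^sup>2))"
    and char_quadratic_form_near_gaussian:
      "norm (char (distr M borel Q) t - exp (- (t\<^sup>2 / 9))) \<le> 2 * \<rho> * \<bar>t\<bar> ^ 3"
proof -
  interpret prob_space M by fact
  let ?a = "mat_entry T"
  let ?\<phi> = "char (distr M borel Q)"
  define h where "h N = (\<Sum>i<Suc N. \<Sum>j<Suc N. (?a i j)\<^sup>2)" for N
  have sym: "?a i j = ?a j i" for i j by (rule mat_entry_sym[OF T(1)])
  have h: "h \<longlonglongrightarrow> 1"
    using LIMSEQ_Suc[OF hilbert_schmidt_sections_tendsto[OF T(1,2)]] T(4) by (simp only: h_def[abs_def])
  have [measurable]: "U i \<in> borel_measurable M" for i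
    using ind by (auto simp: indep_vars_def)
  have [measurable]: "Q \<in> borel_measurable M" using Q by (simp add: has_L2_sum_def)
  have "(\<lambda>N. \<integral>w. iexp (t * quad ?a {..<Suc N} (\<lambda>i. U i w)) \<partial>M) \<longlonglongrightarrow> ?\<phi> t" for t
  proof (rule char_L2_limit[OF M])
    show "(\<lambda>w. quad ?a {..<Suc N} (\<lambda>i. U i w)) \<in> borel_measurable M" for N
      unfolding quad_def by measurable
    show "(\<lambda>N. \<integral>\<^sup>+ w. ennreal ((Q w - quad ?a {..<Suc N} (\<lambda>i. U i w))\<^sup>2) \<partial>M) \<longlonglongrightarrow> 0"
      by (rule LIMSEQ_Suc[OF L2_sections_tendsto[OF Q]])
  qed measurable
  then have lim: "(\<lambda>N. qchar ?a {..<Suc N} t) \<longlonglongrightarrow> ?\<phi> t" for t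
    by (simp only: qchar_eq_expectation[OF M ind unif])
  show "norm (?\<phi> t) \<le> ((2 + 2 / \<rho>) * \<bar>t\<bar> powr (- 1 / 4)) powr (1 / (16 * \<rho>\<^sup>2))" if "\<bar>t\<bar> \<ge> 1"
  proof (rule tendsto_upperbound[OF tendsto_norm[OF lim]])
    have "\<forall>\<^sub>F N in sequentially. h N > 1 / 2" using order_tendstoD(1)[OF h, of "1 / 2"] by simp
    then show "\<forall>\<^sub>F N in sequentially. norm (qchar ?a {..<Suc N} t) \<le>
        ((2 + 2 / \<rho>) * \<bar>t\<bar> powr (- 1 / 4)) powr (1 / (16 * \<rho>\<^sup>2))"
    proof eventually_elim
      case (elim N)
      show ?case
        by (rule qchar_decay[OF sym T(3) \<rho> _ that]) (use elim in \<open>simp only: h_def less_imp_le\<close>)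
    qed
  qed simp
  show "norm (?\<phi> t - exp (- (t\<^sup>2 / 9))) \<le> 2 * \<rho> * \<bar>t\<bar> ^ 3"
  proof (rule LIMSEQ_le)
    have "(\<lambda>N. norm (qchar ?a {..<Suc N} t - complex_of_real (exp (- (h N * t\<^sup>2 / 9))))) \<longlonglongrightarrow>
        norm (?\<phi> t - complex_of_real (exp (- (1 * t\<^sup>2 / 9))))"
      by (intro tendsto_intros lim h) simp
    then show "(\<lambda>N. norm (qchar ?a {..<Suc N} t - complex_of_real (exp (- (h N * t\<^sup>2 / 9))))) \<longlonglongrightarrow>
        norm (?\<phi> t - exp (- (t\<^sup>2 / 9)))" by simp
    have "(\<lambda>N. 2 * \<rho> * h N * \<bar>t\<bar> ^ 3) \<longlonglongrightarrow> 2 * \<rho> * 1 * \<bar>t\<bar> ^ 3"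
      by (intro tendsto_intros h)
    then show "(\<lambda>N. 2 * \<rho> * h N * \<bar>t\<bar> ^ 3) \<longlonglongrightarrow> 2 * \<rho> * \<bar>t\<bar> ^ 3" by simp
    have "norm (qchar ?a {..<Suc N} t - complex_of_real (exp (- (h N * t\<^sup>2 / 9)))) \<le> 2 * \<rho> * h N * \<bar>t\<bar> ^ 3" for N
    proof -
      interpret Z: zero_diagonal_form ?a "{..<Suc N}" \<rho>
        using sym T(3) \<rho> by unfold_locales auto
      have "Z.h = h N" unfolding Z.h_def Z.r_def h_def ..
      then show ?thesis using Z.qchar_near_gaussian[of t] by (simp only:)
    qed
    then show "\<exists>N. \<forall>n\<ge>N. norm (qchar ?a {..<Suc n} t - complex_of_real (exp (- (h n * t\<^sup>2 / 9)))) \<le> 2 * \<rho> * h n * \<bar>t\<bar> ^ 3"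
      by blast
  qed
qed

text \<open>The ranges below and above 1 are merged into one integrable majorant; the two spare
  powers in \<open>k + 2 \<le> m\<close> supply its decay.\<close>

lemma moment_dominator:
  fixes z :: complex
  assumes "norm z \<le> 1" "\<bar>t\<bar> \<ge> 1 \<Longrightarrow> norm z \<le> C / \<bar>t\<bar> ^ m" "k + 2 \<le> m" "C \<ge> 0"
  shows "\<bar>t\<bar> ^ k * norm z \<le> 2 * (C + 1) * inverse (1 + t\<^sup>2)"
proof (cases "\<bar>t\<bar> \<ge> 1")
  case True
  have t2: "t\<^sup>2 \<ge> 1" using True by (simp add: abs_le_square_iff[of 1 t, simplified])
  have "\<bar>t\<bar> ^ k * norm z \<le> \<bar>t\<bar> ^ (m - 2) * (C / \<bar>t\<bar> ^ m)"
    using assms True by (intro mult_mono power_increasing) auto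
  also have "\<bar>t\<bar> ^ m = \<bar>t\<bar> ^ (m - 2) * t\<^sup>2"
  proof -
    have "\<bar>t\<bar> ^ (m - 2 + 2) = \<bar>t\<bar> ^ (m - 2) * \<bar>t\<bar>\<^sup>2" by (rule power_add)
    moreover have "m - 2 + 2 = m" using assms(3) by simp
    ultimately show ?thesis by (simp only: power2_abs)
  qed
  also have "\<bar>t\<bar> ^ (m - 2) * (C / (\<bar>t\<bar> ^ (m - 2) * t\<^sup>2)) = C / t\<^sup>2"
    using True by auto
  also have "\<dots> \<le> 2 * (C + 1) / (1 + t\<^sup>2)"
  proof -
    have "C * (1 + t\<^sup>2) \<le> (C + 1) * (2 * t\<^sup>2)"
      using t2 assms(4) by (intro mult_mono) auto
    also have "\<dots> = 2 * (C + 1) * t\<^sup>2" by simp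
    finally have "C * (1 + t\<^sup>2) \<le> 2 * (C + 1) * t\<^sup>2" .
    moreover have "0 < t\<^sup>2" "0 < 1 + t\<^sup>2" using t2 by linarith+
    ultimately show ?thesis
      by (simp only: pos_le_divide_eq pos_divide_le_eq times_divide_eq_left)
  qed
  finally show ?thesis by (simp add: divide_inverse)
next
  case False
  have "\<bar>t\<bar> ^ k * norm z \<le> 1 * 1"
    using False assms(1) by (intro mult_mono power_le_one) auto
  also have "1 * 1 \<le> 2 * (C + 1) / (1 + t\<^sup>2)"
  proof -
    have "t\<^sup>2 \<le> 1" using False by (simp add: abs_square_le_1)
    then show ?thesis using assms(4) by (simp add: divide_simps add_pos_nonneg)
  qed
  finally show ?thesis by (simp add: divide_inverse)
qed

lemma integrable_inverse_1_plus_sq: "integrable lborel (\<lambda>t::real. inverse (1 + t\<^sup>2))"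
  using integrable_inverse_1_plus_square by (simp add: set_integrable_def)

theorem mainTheorem2:
  fixes A :: "nat \<Rightarrow> ell2 \<Rightarrow> ell2"
    and M :: "'w measure"
    and U :: "nat \<Rightarrow> 'w \<Rightarrow> real"
    and Q :: "nat \<Rightarrow> 'w \<Rightarrow> real"
    and f :: "real \<Rightarrow> real"
  assumes "\<And>n. symmetric_op (A n)"
    and "\<And>n. Hilbert_Schmidt (A n)"
    and "\<And>n i. mat_entry (A n) i i = 0"
    and "\<And>n. op_trace (A n \<circ> A n) = 1"
    and "(\<lambda>n. spectral_radius (A n)) \<longlonglongrightarrow> 0"
    and "prob_space M"
    and "prob_space.indep_vars M (\<lambda>_. borel) U UNIV"
    and "\<And>i. distr M lborel (U i) = uniform_measure lborel {-1..1}"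
    and "\<And>n. has_L2_sum M (\<lambda>(i, j) w. mat_entry (A n) i j * U i w * U j w) (Q n) UNIV"
  defines "f \<equiv> normal_density 0 (sqrt (2 / 9))"
  shows "\<forall>p. \<exists>N. \<exists>g :: nat \<Rightarrow> real \<Rightarrow> real.
      (\<forall>n\<ge>N. distributed M lborel (Q n) (\<lambda>x. ennreal (g n x)) \<and>
              (\<forall>x. 0 \<le> g n x) \<and> Ck p (g n)) \<and>
      (\<lambda>n. sup_norm (\<lambda>x. (deriv ^^ p) (g n) x - (deriv ^^ p) f x)) \<longlonglongrightarrow> 0"
proof
  fix p :: nat
  interpret prob_space M by fact
  \<comment> \<open>Moments up to order \<open>p + 2\<close> are to be dominated, and
    \<open>moment_dominator\<close> takes two powers more.\<close>
  define m where "m = p + 4"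
  \<comment> \<open>Chosen to make the exponent \<open>1 / (16 * \<rho>\<^sup>2)\<close> equal to
    \<open>4 * m\<close>; applied to \<open>\<bar>t\<bar> powr (- 1 / 4)\<close> it gives decay of
    order \<open>m\<close>.\<close>
  define \<rho> where "\<rho> = 1 / (8 * sqrt (real m))"
  have m: "m > 0" by (simp add: m_def)
  have \<rho>: "\<rho> > 0" "1 / (16 * \<rho>\<^sup>2) = 4 * real m"
    using m by (simp_all add: \<rho>_def power_divide power_mult_distrib)
  define C where "C = (2 + 2 / \<rho>) powr (4 * real m)"
  have C: "C \<ge> 0" by (simp add: C_def)
  define \<phi> where "\<phi> n = char (distr M borel (Q n))" for n
  define \<phi>' where "\<phi>' t = complex_of_real (exp (- (t\<^sup>2 / 9)))" for t
  define w where "w t = 2 * (C + 1) * inverse (1 + t\<^sup>2)" for t :: real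
  have w: "integrable lborel w"
    unfolding w_def by (intro integrable_mult_right integrable_inverse_1_plus_sq)
  have Qm [measurable]: "Q n \<in> borel_measurable M" for n using assms(9)[of n] by (simp add: has_L2_sum_def)
  have rd: "real_distribution (distr M borel (Q n))" for n
    by (rule real_distribution_distr) measurable
  have \<phi>m [measurable]: "\<phi> n \<in> borel_measurable borel" for n
    unfolding \<phi>_def by (rule real_distribution.char_measurable[OF rd])
  have \<phi>'m [measurable]: "\<phi>' \<in> borel_measurable borel" unfolding \<phi>'_def[abs_def] by measurable
  have op: "\<forall>\<^sub>F n in sequentially. op_bound (mat_entry (A n)) r" if "r > 0" for r
  proof -
    have "\<forall>\<^sub>F n in sequentially. spectral_radius (A n) < ereal r"
      using assms(5) that by (intro order_tendstoD(2)) auto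
    then show ?thesis
    proof eventually_elim
      case (elim n)
      have bl: "bounded_linear (A n)" using assms(2)[of n] by (simp add: Hilbert_Schmidt_def)
      show ?case
        by (rule op_bound_mat_entry[OF bl norm_le_spectral_radius[OF bl assms(1) that elim]])
    qed
  qed
  have near: "\<forall>\<^sub>F n in sequentially. norm (\<phi> n t - \<phi>' t) \<le> 2 * r * \<bar>t\<bar> ^ 3" if "r > 0" for r t
    using op[OF that]
  proof eventually_elim
    case (elim n)
    show ?case unfolding \<phi>_def \<phi>'_def
      by (rule char_quadratic_form_near_gaussian[OF assms(1-4) assms(6-9) elim that])
  qed
  have lim: "(\<lambda>n. \<phi> n t) \<longlonglongrightarrow> \<phi>' t" for t
  proof (rule tendstoI)
    fix \<epsilon> :: real assume \<epsilon>: "\<epsilon> > 0"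
    \<comment> \<open>The operator norm that yields accuracy \<open>\<epsilon>\<close> at the fixed
      frequency \<open>t\<close>; the added 1 covers \<open>t = 0\<close>.\<close>
    define r where "r = \<epsilon> / (2 * (\<bar>t\<bar> ^ 3 + 1))"
    have t3: "\<bar>t\<bar> ^ 3 + 1 > 0" by (simp add: add_nonneg_pos)
    have r: "r > 0" using \<epsilon> t3 by (simp add: r_def)
    have "2 * r * \<bar>t\<bar> ^ 3 < 2 * r * (\<bar>t\<bar> ^ 3 + 1)" using r by (intro mult_strict_left_mono) auto
    also have "\<dots> = \<epsilon>" using t3 by (simp add: r_def del: distrib_left_numeral)
    finally have small: "2 * r * \<bar>t\<bar> ^ 3 < \<epsilon>" .
    show "\<forall>\<^sub>F n in sequentially. dist (\<phi> n t) (\<phi>' t) < \<epsilon>"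
      using near[OF r, of t] by eventually_elim (use small in \<open>simp add: dist_norm\<close>)
  qed
  obtain N where N: "\<And>n. n \<ge> N \<Longrightarrow> op_bound (mat_entry (A n)) \<rho>"
    using op[OF \<rho>(1)] unfolding eventually_sequentially by blast
  have dom: "\<bar>t\<bar> ^ k * norm (\<phi> n t) \<le> w t" if "n \<ge> N" "k \<le> p + 2" for n k t
    unfolding w_def
  proof (rule moment_dominator[where m = m])
    show "norm (\<phi> n t) \<le> 1" unfolding \<phi>_def by (rule real_distribution.cmod_char_le_1[OF rd])
    assume t: "\<bar>t\<bar> \<ge> 1"
    have "norm (\<phi> n t) \<le> ((2 + 2 / \<rho>) * \<bar>t\<bar> powr (- 1 / 4)) powr (4 * real m)"
      using char_quadratic_form_decay[OF assms(1-4) assms(6-9) N[OF that(1)] \<rho>(1) t]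
      unfolding \<phi>_def \<rho>(2) .
    also have "\<dots> = C * \<bar>t\<bar> powr (- real m)"
      using \<rho>(1) by (simp add: C_def powr_mult powr_powr)
    also have "\<dots> = C / \<bar>t\<bar> ^ m"
      using t by (simp add: powr_minus_divide powr_realpow)
    finally show "norm (\<phi> n t) \<le> C / \<bar>t\<bar> ^ m" .
  qed (use that C in \<open>auto simp: m_def\<close>)
  \<comment> \<open>The majorant passes to the pointwise limit, so the Gaussian characteristic
    function takes no estimate of its own.\<close>
  have dom': "\<bar>t\<bar> ^ k * norm (\<phi>' t) \<le> w t" if "k \<le> p + 2" for k t
  proof (rule tendsto_upperbound)
    show "(\<lambda>n. \<bar>t\<bar> ^ k * norm (\<phi> n t)) \<longlonglongrightarrow> \<bar>t\<bar> ^ k * norm (\<phi>' t)"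
      by (intro tendsto_intros lim)
    show "\<forall>\<^sub>F n in sequentially. \<bar>t\<bar> ^ k * norm (\<phi> n t) \<le> w t"
      using eventually_ge_at_top[of N] by eventually_elim (rule dom[OF _ that])
  qed simp
  have int: "integrable lborel (\<lambda>t. t ^ k *\<^sub>R \<phi> n t)" if "n \<ge> N" "k \<le> p + 2" for n k
  proof (rule Bochner_Integration.integrable_bound[OF w])
    show "AE t in lborel. norm (t ^ k *\<^sub>R \<phi> n t) \<le> norm (w t)"
      using order.trans[OF dom[OF that] abs_ge_self] by (simp add: power_abs)
  qed measurable
  have int': "integrable lborel (\<lambda>t. t ^ k *\<^sub>R \<phi>' t)" if "k \<le> p + 2" for k
  proof (rule Bochner_Integration.integrable_bound[OF w])
    show "AE t in lborel. norm (t ^ k *\<^sub>R \<phi>' t) \<le> norm (w t)"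
      using order.trans[OF dom'[OF that] abs_ge_self] by (simp add: power_abs)
  qed measurable
  define g where "g n x = Re (fourier_inv (\<phi> n) 0 x)" for n x
  have f_eq: "f = (\<lambda>x. Re (fourier_inv \<phi>' 0 x))"
    unfolding f_def \<phi>'_def[abs_def] fourier_inv_gaussian ..
  define I where "I n = (\<integral>t. \<bar>t\<bar> ^ p * norm (\<phi> n t - \<phi>' t) \<partial>lborel)" for n
  \<comment> \<open>The domination holds only from \<open>N\<close> on, hence the shift.\<close>
  have "(\<lambda>n. I (n + N)) \<longlonglongrightarrow> (\<integral>t. 0 \<partial>(lborel :: real measure))"
    unfolding I_def
  proof (rule integral_dominated_convergence[where w = "\<lambda>t. 2 * w t"])
    show "AE t in lborel. (\<lambda>n. \<bar>t\<bar> ^ p * norm (\<phi> (n + N) t - \<phi>' t)) \<longlonglongrightarrow> 0"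
    proof (rule AE_I2)
      fix t :: real
      have "(\<lambda>n. \<bar>t\<bar> ^ p * norm (\<phi> n t - \<phi>' t)) \<longlonglongrightarrow> \<bar>t\<bar> ^ p * norm (\<phi>' t - \<phi>' t)"
        by (intro tendsto_intros lim)
      then show "(\<lambda>n. \<bar>t\<bar> ^ p * norm (\<phi> (n + N) t - \<phi>' t)) \<longlonglongrightarrow> 0"
        by (intro LIMSEQ_ignore_initial_segment) simp
    qed
    show "AE t in lborel. norm (\<bar>t\<bar> ^ p * norm (\<phi> (n + N) t - \<phi>' t)) \<le> 2 * w t" for n
    proof (rule AE_I2)
      fix t :: real
      have "\<bar>t\<bar> ^ p * norm (\<phi> (n + N) t - \<phi>' t) \<le> \<bar>t\<bar> ^ p * (norm (\<phi> (n + N) t) + norm (\<phi>' t))"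
        by (intro mult_left_mono norm_triangle_ineq4) auto
      also have "\<dots> \<le> 2 * w t"
        using dom[of "n + N" p t] dom'[of p t] by (simp add: distrib_left)
      finally show "norm (\<bar>t\<bar> ^ p * norm (\<phi> (n + N) t - \<phi>' t)) \<le> 2 * w t" by simp
    qed
    show "integrable lborel (\<lambda>t. 2 * w t)" using w by simp
  qed measurable
  then have I: "I \<longlonglongrightarrow> 0" by (simp add: LIMSEQ_offset)
  have bound: "sup_norm (\<lambda>x. (deriv ^^ p) (g n) x - (deriv ^^ p) f x) \<le> ereal (I n)" if "n \<ge> N" for n
    unfolding sup_norm_def
  proof (rule SUP_least)
    fix x :: real
    have "(deriv ^^ p) (g n) = (\<lambda>x. Re (fourier_inv (\<phi> n) p x))"
      unfolding g_def[abs_def] by (rule Re_fourier_inv_deriv_funpow[of p]) (auto intro: int that)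
    moreover have "(deriv ^^ p) f = (\<lambda>x. Re (fourier_inv \<phi>' p x))"
      unfolding f_eq by (rule Re_fourier_inv_deriv_funpow[of p]) (auto intro: int')
    ultimately show "ereal \<bar>(deriv ^^ p) (g n) x - (deriv ^^ p) f x\<bar> \<le> ereal (I n)"
      using fourier_inv_diff_bound[OF int[OF that, of p] int'[of p], of x] by (simp add: I_def)
  qed
  have nonneg: "0 \<le> sup_norm (\<lambda>x. (deriv ^^ p) (g n) x - (deriv ^^ p) f x)" for n
    unfolding sup_norm_def by (rule SUP_upper2[of 0]) auto
  have conv: "(\<lambda>n. sup_norm (\<lambda>x. (deriv ^^ p) (g n) x - (deriv ^^ p) f x)) \<longlonglongrightarrow> 0"
  proof (rule tendsto_sandwich[OF _ _ tendsto_const])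
    show "\<forall>\<^sub>F n in sequentially. 0 \<le> sup_norm (\<lambda>x. (deriv ^^ p) (g n) x - (deriv ^^ p) f x)"
      by (intro always_eventually allI nonneg)
    show "\<forall>\<^sub>F n in sequentially. sup_norm (\<lambda>x. (deriv ^^ p) (g n) x - (deriv ^^ p) f x) \<le> ereal (I n)"
      using eventually_ge_at_top[of N] by eventually_elim (rule bound)
    show "(\<lambda>n. ereal (I n)) \<longlonglongrightarrow> 0"
      using I by (simp add: zero_ereal_def)
  qed
  have dens: "distributed M lborel (Q n) (\<lambda>x. ennreal (g n x)) \<and> (\<forall>x. 0 \<le> g n x) \<and> Ck p (g n)" if "n \<ge> N" for n
  proof (intro conjI allI)
    have i0: "integrable lborel (char (distr M borel (Q n)))"
      using int[OF that, of 0] by (simp add: \<phi>_def)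
    note D = distribution_density_fourier_inv[OF rd i0, folded \<phi>_def, folded g_def]
    show "0 \<le> g n x" for x by (rule D(2))
    have "distr M lborel (Q n) = distr M borel (Q n)" by (intro distr_cong) auto
    then show "distributed M lborel (Q n) (\<lambda>x. ennreal (g n x))"
      using D(1) D(3) unfolding distributed_def by auto
    show "Ck p (g n)"
      unfolding g_def[abs_def] by (rule Ck_Re_fourier_inv) (auto intro: int that)
  qed
  show "\<exists>N. \<exists>g :: nat \<Rightarrow> real \<Rightarrow> real.
      (\<forall>n\<ge>N. distributed M lborel (Q n) (\<lambda>x. ennreal (g n x)) \<and>
              (\<forall>x. 0 \<le> g n x) \<and> Ck p (g n)) \<and>
      (\<lambda>n. sup_norm (\<lambda>x. (deriv ^^ p) (g n) x - (deriv ^^ p) f x)) \<longlonglongrightarrow> 0"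
    by (intro exI[of _ N] exI[of _ g] conjI conv allI impI dens)
qed

end
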